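(* Let $m$ be any positive even integer, and assume that the number of column-even Latin $(m,m)$-squares differs from the number of column-odd Latin $(m,m)$-squares. Then for any partition $\overline\lambda:(\overline\lambda_1\ge\overline\lambda_2\ge\cdots\ge\overline\lambda_m\ge 0)$ (with at most $m$ parts) of $d$ (i.e. $|\overline\lambda|=d$), the symmetric Kronecker coefficient satisfies $$sk_{m\overline\lambda,\,d\delta_m,\,d\delta_m}>0 .$$
   Context: $\delta_m$ is the partition $(1\ge1\ge\cdots\ge1)$ with $m$ ones, so $d\delta_m$ is the rectangular partition $(d,\dots,d)$ with $m$ parts, of size $dm$. $m\overline\lambda=(m\overline\lambda_1,\dots,m\overline\lambda_m)$, also of size $dm$. For a partition $\nu$ of $k$, $W_\nu$ is the irreducible complex representation of the symmetric group $\mathfrak S_k$ corresponding to $\nu$. For a partition $\nu$ of $dm$, the symmetric Kronecker coefficient $sk_{\nu,d\delta_m,d\delta_m}$ is the multiplicity of the $\mathfrak S_{dm}$-module $W_\nu$ in the symmetric square $S^2(W_{d\delta_m})$. A Latin $(m,m)$-square is an $m\times m$ matrix $A=(a_p^q)$ (row $p$, column $q$) with entries in $[m]=\{1,\dots,m\}$ each of whose rows and columns is a permutation of $[m]$. The sign of column $q$ is $\epsilon(A^q)=$ sign of $\prod_{1\le p<p'\le m}(a_{p'}^q-a_p^q)$; $A$ is column-even if $\prod_{q=1}^m\epsilon(A^q)=+1$ and column-odd otherwise. *)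

theory Defs
  imports Complex_Main "HOL-Library.FuncSet" "HOL-Library.Function_Algebras"
    "HOL-Combinatorics.Permutations"
begin

section \<open>Representations of symmetric groups on spaces of complex functions\<close>

global_interpretation cfun: vector_space "\<lambda>(c::complex) (f::'x \<Rightarrow> complex) x. c * f x"
  defines cfun_span = cfun.span and cfun_subspace = cfun.subspace
  by unfold_locales (auto simp: algebra_simps)

text \<open>An action \<open>\<alpha>\<close> of the symmetric group on \<open>'x\<close> induces a linear action on functions on \<open>'x\<close>;
  it maps the indicator function of \<open>x\<close> to the indicator function of \<open>\<alpha> g x\<close>.\<close>

definition fun_act ::
    "((nat \<Rightarrow> nat) \<Rightarrow> 'x \<Rightarrow> 'x) \<Rightarrow> (nat \<Rightarrow> nat) \<Rightarrow> ('x \<Rightarrow> complex) \<Rightarrow> ('x \<Rightarrow> complex)"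
  where "fun_act \<alpha> g f = (\<lambda>x. f (\<alpha> (inv g) x))"

text \<open>In the following, \<open>\<SS>\<^sub>k\<close> is the group of permutations of \<open>{1..k}\<close>, and \<open>\<rho>\<close> is its action.\<close>

definition submodule ::
    "nat \<Rightarrow> ((nat \<Rightarrow> nat) \<Rightarrow> ('x \<Rightarrow> complex) \<Rightarrow> ('x \<Rightarrow> complex)) \<Rightarrow> ('x \<Rightarrow> complex) set \<Rightarrow> bool"
  where "submodule k \<rho> U \<longleftrightarrow>
    cfun_subspace U \<and> (\<forall>g. g permutes {1..k} \<longrightarrow> (\<forall>u\<in>U. \<rho> g u \<in> U))"

definition irreducible_submodule ::
    "nat \<Rightarrow> ((nat \<Rightarrow> nat) \<Rightarrow> ('x \<Rightarrow> complex) \<Rightarrow> ('x \<Rightarrow> complex)) \<Rightarrow> ('x \<Rightarrow> complex) set \<Rightarrow> bool"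
  where "irreducible_submodule k \<rho> U \<longleftrightarrow>
    submodule k \<rho> U \<and> U \<noteq> {0} \<and> (\<forall>U'\<subseteq>U. submodule k \<rho> U' \<longrightarrow> U' = {0} \<or> U' = U)"

definition isomorphic_modules ::
    "nat \<Rightarrow> ((nat \<Rightarrow> nat) \<Rightarrow> ('x \<Rightarrow> complex) \<Rightarrow> ('x \<Rightarrow> complex)) \<Rightarrow> ('x \<Rightarrow> complex) set \<Rightarrow>
     ((nat \<Rightarrow> nat) \<Rightarrow> ('y \<Rightarrow> complex) \<Rightarrow> ('y \<Rightarrow> complex)) \<Rightarrow> ('y \<Rightarrow> complex) set \<Rightarrow> bool"
  where "isomorphic_modules k \<rho> U \<sigma> W \<longleftrightarrow>
    (\<exists>\<phi>. bij_betw \<phi> U W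
       \<and> (\<forall>u\<in>U. \<forall>v\<in>U. \<phi> (u + v) = \<phi> u + \<phi> v)
       \<and> (\<forall>c. \<forall>u\<in>U. \<phi> (\<lambda>x. c * u x) = (\<lambda>y. c * \<phi> u y))
       \<and> (\<forall>g. g permutes {1..k} \<longrightarrow> (\<forall>u\<in>U. \<phi> (\<rho> g u) = \<sigma> g (\<phi> u))))"

text \<open>\<open>V\<close> is the internal direct sum of the irreducible submodules in the finite set \<open>D\<close>
  (summands of a direct sum are nonzero, hence distinct as subspaces).\<close>

definition irreducible_decomposition ::
    "nat \<Rightarrow> ((nat \<Rightarrow> nat) \<Rightarrow> ('x \<Rightarrow> complex) \<Rightarrow> ('x \<Rightarrow> complex)) \<Rightarrow> ('x \<Rightarrow> complex) set \<Rightarrow>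
     ('x \<Rightarrow> complex) set set \<Rightarrow> bool"
  where "irreducible_decomposition k \<rho> V D \<longleftrightarrow>
    finite D \<and> (\<forall>U\<in>D. irreducible_submodule k \<rho> U)
    \<and> V = {\<Sum>U\<in>D. u U | u. \<forall>U\<in>D. u U \<in> U}
    \<and> (\<forall>u. (\<forall>U\<in>D. u U \<in> U) \<and> (\<Sum>U\<in>D. u U) = 0 \<longrightarrow> (\<forall>U\<in>D. u U = 0))"

text \<open>The multiplicity of the irreducible module \<open>W\<close> in \<open>V\<close>: the number of summands isomorphic to
  \<open>W\<close> in a decomposition of \<open>V\<close> into irreducibles.  For finite-dimensional \<open>V\<close> a decomposition
  exists (Maschke) and the number does not depend on the choice of it (Krull-Schmidt).\<close>

definition rep_multiplicity ::
    "nat \<Rightarrow> ((nat \<Rightarrow> nat) \<Rightarrow> ('y \<Rightarrow> complex) \<Rightarrow> ('y \<Rightarrow> complex)) \<Rightarrow> ('y \<Rightarrow> complex) set \<Rightarrow>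
     ((nat \<Rightarrow> nat) \<Rightarrow> ('x \<Rightarrow> complex) \<Rightarrow> ('x \<Rightarrow> complex)) \<Rightarrow> ('x \<Rightarrow> complex) set \<Rightarrow> nat"
  where "rep_multiplicity k \<sigma> W \<rho> V =
    card {U \<in> (SOME D. irreducible_decomposition k \<rho> V D). isomorphic_modules k \<rho> U \<sigma> W}"

text \<open>The tensor square of a space \<open>V\<close> of functions on \<open>'x\<close> is realised as a space of functions on
  \<open>'x \<times> 'x\<close>, and the symmetric square as the symmetric tensors in it.  If \<open>\<alpha>\<close> is the action
  on \<open>'x\<close>, the diagonal action on tensors is \<open>fun_act (pair_act \<alpha>)\<close>.\<close>

definition tensor_square :: "('x \<Rightarrow> complex) set \<Rightarrow> ('x \<times> 'x \<Rightarrow> complex) set"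
  where "tensor_square V = cfun_span {\<lambda>(x, y). f x * h y | f h. f \<in> V \<and> h \<in> V}"

definition symmetric_square :: "('x \<Rightarrow> complex) set \<Rightarrow> ('x \<times> 'x \<Rightarrow> complex) set"
  where "symmetric_square V = {F \<in> tensor_square V. \<forall>x y. F (x, y) = F (y, x)}"

definition pair_act ::
    "((nat \<Rightarrow> nat) \<Rightarrow> 'x \<Rightarrow> 'x) \<Rightarrow> (nat \<Rightarrow> nat) \<Rightarrow> 'x \<times> 'x \<Rightarrow> 'x \<times> 'x"
  where "pair_act \<alpha> g = map_prod (\<alpha> g) (\<alpha> g)"


section \<open>Specht modules\<close>

text \<open>A partition is a weakly decreasing list; trailing zero parts are allowed.\<close>

definition is_partition :: "nat \<Rightarrow> nat list \<Rightarrow> bool"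
  where "is_partition n \<nu> \<longleftrightarrow> sorted_wrt (\<ge>) \<nu> \<and> sum_list \<nu> = n"

definition young_diagram :: "nat list \<Rightarrow> (nat \<times> nat) set"
  where "young_diagram \<nu> = {(i, j). i < length \<nu> \<and> j < \<nu> ! i}"

definition is_tableau :: "nat list \<Rightarrow> (nat \<times> nat \<Rightarrow> nat) \<Rightarrow> bool"
  where "is_tableau \<nu> t \<longleftrightarrow> bij_betw t (young_diagram \<nu>) {1..sum_list \<nu>}"

text \<open>A tabloid is the sequence of the sets of entries of the rows.\<close>

definition tabloid :: "nat list \<Rightarrow> (nat \<times> nat \<Rightarrow> nat) \<Rightarrow> nat \<Rightarrow> nat set"
  where "tabloid \<nu> t i = {t (i, j) | j. (i, j) \<in> young_diagram \<nu>}"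

definition tabloid_act :: "(nat \<Rightarrow> nat) \<Rightarrow> (nat \<Rightarrow> nat set) \<Rightarrow> (nat \<Rightarrow> nat set)"
  where "tabloid_act g T = (\<lambda>i. g ` T i)"

definition tableau_column :: "nat list \<Rightarrow> (nat \<times> nat \<Rightarrow> nat) \<Rightarrow> nat \<Rightarrow> nat set"
  where "tableau_column \<nu> t j = {t (i, j) | i. (i, j) \<in> young_diagram \<nu>}"

definition column_stabilizer :: "nat list \<Rightarrow> (nat \<times> nat \<Rightarrow> nat) \<Rightarrow> (nat \<Rightarrow> nat) set"
  where "column_stabilizer \<nu> t =
    {g. g permutes {1..sum_list \<nu>} \<and> (\<forall>j. g ` tableau_column \<nu> t j = tableau_column \<nu> t j)}"

definition polytabloid :: "nat list \<Rightarrow> (nat \<times> nat \<Rightarrow> nat) \<Rightarrow> (nat \<Rightarrow> nat set) \<Rightarrow> complex"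
  where "polytabloid \<nu> t = (\<lambda>T. \<Sum>g\<in>column_stabilizer \<nu> t.
    of_int (sign g) * (if T = tabloid_act g (tabloid \<nu> t) then 1 else 0))"

text \<open>The irreducible representation of \<open>\<SS>\<^sub>k\<close> corresponding to a partition \<open>\<nu>\<close> of \<open>k\<close>, with action
  \<open>fun_act tabloid_act\<close>.  In this convention \<open>[k]\<close> gives the trivial representation and
  \<open>replicate k 1\<close> the sign representation.\<close>

definition specht :: "nat list \<Rightarrow> ((nat \<Rightarrow> nat set) \<Rightarrow> complex) set"
  where "specht \<nu> = cfun_span {polytabloid \<nu> t | t. is_tableau \<nu> t}"

text \<open>The symmetric Kronecker coefficient \<open>sk\<close> with indices \<open>\<nu>, \<mu>, \<mu>\<close>, where \<open>\<nu>\<close> and \<open>\<mu>\<close> are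
  partitions of the same number.\<close>

definition sym_kronecker :: "nat list \<Rightarrow> nat list \<Rightarrow> nat"
  where "sym_kronecker \<nu> \<mu> =
    rep_multiplicity (sum_list \<mu>)
      (fun_act tabloid_act) (specht \<nu>)
      (fun_act (pair_act tabloid_act)) (symmetric_square (specht \<mu>))"


section \<open>Latin squares\<close>

text \<open>\<open>A (p, q)\<close> is the entry in row \<open>p\<close> and column \<open>q\<close>.\<close>

definition latin_squares :: "nat \<Rightarrow> (nat \<times> nat \<Rightarrow> nat) set"
  where "latin_squares m = {A \<in> ({1..m} \<times> {1..m}) \<rightarrow>\<^sub>E {1..m}.
    (\<forall>p\<in>{1..m}. bij_betw (\<lambda>q. A (p, q)) {1..m} {1..m}) \<and>
    (\<forall>q\<in>{1..m}. bij_betw (\<lambda>p. A (p, q)) {1..m} {1..m})}"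

definition column_sign :: "nat \<Rightarrow> (nat \<times> nat \<Rightarrow> nat) \<Rightarrow> nat \<Rightarrow> int"
  where "column_sign m A q =
    sgn (\<Prod>p'\<in>{1..m}. \<Prod>p\<in>{1..<p'}. int (A (p', q)) - int (A (p, q)))"

definition column_even :: "nat \<Rightarrow> (nat \<times> nat \<Rightarrow> nat) \<Rightarrow> bool"
  where "column_even m A \<longleftrightarrow> (\<Prod>q\<in>{1..m}. column_sign m A q) = 1"

end

theory Submission
  imports Defs "HOL-Computational_Algebra.Polynomial"
begin

text \<open>Let \<open>e\<close> be the polytabloid of a rectangular tableau.  The tensor \<open>e \<otimes> e\<close> lies in the symmetric
  square, and its restriction to the diagonal is the indicator function of the words whose \<open>d\<close>
  blocks of length \<open>m\<close> are permutations of the \<open>m\<close> letters.  A complex \<open>m \<times> m\<close> matrix \<open>g\<close> acts on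
  words letter by letter, equivariantly, and pairing the image of this indicator function with a
  polytabloid of shape \<open>m \<lambda>\<close>, whose rows are cut into the blocks, factors over the columns of \<open>\<lambda>\<close>
  into values \<open>f\<^sub>k(g)\<close>, one for each column of length \<open>k\<close>.  Here \<open>f\<^sub>k(g)\<close> is the sum, over all
  \<open>k \<times> m\<close> arrays whose rows are permutations, of the product over the array columns of the minors
  of \<open>g\<close> with the first \<open>k\<close> rows and the columns listed there.  If the pairing is nonzero, some
  irreducible summand of the symmetric square maps to tabloids of shape \<open>m \<lambda>\<close> with image not
  orthogonal to the Specht module, and the argument of James's submodule theorem identifies it with
  the Specht module.

  The coefficient of \<open>f\<^sub>k\<close> at the product of all variables is, up to a positive factor, the squared
  norm of the column antisymmetrization of the indicator function for \<open>k\<close> blocks.  The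
  antisymmetrization for \<open>m\<close> blocks has the difference of the numbers of column-even and column-odd
  Latin squares among its values, and it vanishes if the one for \<open>k \<le> m\<close> blocks does.  So every
  \<open>f\<^sub>k\<close> with \<open>k \<le> m\<close> is a nonzero polynomial, and these polynomials have a common non-root \<open>g\<close>.\<close>

section \<open>Permutations that preserve a colouring\<close>

lemma sum_PiE_insert:
  assumes "a \<notin> A"
  shows "(\<Sum>f\<in>PiE (insert a A) B. F f) = (\<Sum>y\<in>B a. \<Sum>f\<in>PiE A B. F (f(a := y)))"
proof -
  have "inj_on (\<lambda>(y, g). g(a := y)) (B a \<times> PiE A B)"
    using assms by (rule inj_combinator)
  then show ?thesis
    by (simp add: PiE_insert_eq sum.reindex sum.cartesian_product case_prod_unfold)
qed

lemma sum_PiE_prod: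
  fixes H :: "'a \<Rightarrow> 'b \<Rightarrow> 'c::comm_semiring_1"
  assumes "finite J"
  shows "(\<Sum>f\<in>PiE J B. \<Prod>j\<in>J. H j (f j)) = (\<Prod>j\<in>J. \<Sum>y\<in>B j. H j y)"
  using assms
proof (induction J)
  case (insert a A)
  have "(\<Sum>f\<in>PiE (insert a A) B. \<Prod>j\<in>insert a A. H j (f j))
      = (\<Sum>y\<in>B a. \<Sum>f\<in>PiE A B. H a y * (\<Prod>j\<in>A. H j (f j)))"
  proof -
    have *: "(\<Prod>j\<in>A. H j ((f(a := y)) j)) = (\<Prod>j\<in>A. H j (f j))" for f y
      using insert.hyps by (intro prod.cong) auto
    show ?thesis
      using insert.hyps by (subst sum_PiE_insert) (simp_all add: * del: fun_upd_apply, simp)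
  qed
  also have "\<dots> = (\<Prod>j\<in>insert a A. \<Sum>y\<in>B j. H j y)"
    using insert.hyps by (simp add: insert.IH flip: sum_distrib_left sum_distrib_right)
  finally show ?case .
qed simp

text \<open>All groups below have this form: \<open>column_stabilizer\<close> is the case of the
  colouring \<open>column_of\<close>, and on an array of cells the colourings \<open>fst\<close> and
  \<open>snd\<close> give the permutations within columns and within rows.\<close>

definition fperm :: "'a set \<Rightarrow> ('a \<Rightarrow> 'b) \<Rightarrow> ('a \<Rightarrow> 'a) set"
  where "fperm X c = {\<theta>. \<theta> permutes X \<and> (\<forall>x\<in>X. c (\<theta> x) = c x)}"

lemma fpermD: "\<theta> \<in> fperm X c \<Longrightarrow> \<theta> permutes X" "\<theta> \<in> fperm X c \<Longrightarrow> x \<in> X \<Longrightarrow> c (\<theta> x) = c x"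
  by (auto simp: fperm_def)

lemma finite_fperm [simp, intro]: "finite X \<Longrightarrow> finite (fperm X c)"
  by (rule finite_subset[OF _ finite_permutations]) (auto simp: fperm_def)

lemma id_in_fperm [simp]: "id \<in> fperm X c"
  by (auto simp: fperm_def permutes_id)

lemma fperm_compose: "\<theta> \<in> fperm X c \<Longrightarrow> \<eta> \<in> fperm X c \<Longrightarrow> \<theta> \<circ> \<eta> \<in> fperm X c"
  by (auto simp: fperm_def permutes_compose permutes_in_image)

lemma fperm_inv: "\<theta> \<in> fperm X c \<Longrightarrow> inv \<theta> \<in> fperm X c"
  unfolding fperm_def
proof safe
  fix x assume \<theta>: "\<theta> permutes X" "\<forall>x\<in>X. c (\<theta> x) = c x" and "x \<in> X"
  then have "inv \<theta> x \<in> X"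
    by (simp add: permutes_in_image permutes_inv)
  with \<theta> have "c (\<theta> (inv \<theta> x)) = c (inv \<theta> x)"
    by blast
  with \<theta> show "c (inv \<theta> x) = c x"
    by (simp add: permutes_inverses)
qed (rule permutes_inv)

lemma fperm_mono:
  assumes "X \<subseteq> X'"
  shows "fperm X c \<subseteq> fperm X' c"
proof
  fix \<theta> assume \<theta>: "\<theta> \<in> fperm X c"
  have "c (\<theta> x) = c x" for x
    using \<theta> permutes_not_in[OF fpermD(1)[OF \<theta>], of x] by (cases "x \<in> X") (simp_all add: fpermD(2))
  then show "\<theta> \<in> fperm X' c"
    using permutes_subset[OF fpermD(1)[OF \<theta>] assms] by (simp add: fperm_def)
qed

lemma fperm_permutation: "finite X \<Longrightarrow> \<theta> \<in> fperm X c \<Longrightarrow> permutation \<theta>"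
  by (auto simp: fperm_def permutation_permutes)

lemma sign_fperm_compose:
  "finite X \<Longrightarrow> \<theta> \<in> fperm X c \<Longrightarrow> \<eta> \<in> fperm X c \<Longrightarrow> sign (\<theta> \<circ> \<eta>) = sign \<theta> * sign \<eta>"
  by (metis fperm_permutation sign_compose)

lemma sum_fperm_inv:
  assumes "finite X"
  shows "(\<Sum>\<theta>\<in>fperm X c. F (inv \<theta>)) = (\<Sum>\<theta>\<in>fperm X c. F \<theta>)"
  by (rule sum.reindex_bij_witness[of _ inv inv])
     (auto simp: fperm_inv permutes_inv_inv dest: fpermD)

lemma sum_fperm_compose_right:
  assumes "\<tau> \<in> fperm X c"
  shows "(\<Sum>\<theta>\<in>fperm X c. F (\<theta> \<circ> \<tau>)) = (\<Sum>\<theta>\<in>fperm X c. F \<theta>)"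
  by (rule sum.reindex_bij_witness[of _ "\<lambda>\<theta>. \<theta> \<circ> inv \<tau>" "\<lambda>\<theta>. \<theta> \<circ> \<tau>"])
     (use assms in \<open>auto simp: fperm_compose fperm_inv comp_assoc permutes_inv_o dest: fpermD\<close>)

lemma sum_fperm_compose_left:
  assumes "\<tau> \<in> fperm X c"
  shows "(\<Sum>\<theta>\<in>fperm X c. F (\<tau> \<circ> \<theta>)) = (\<Sum>\<theta>\<in>fperm X c. F \<theta>)"
proof (rule sum.reindex_bij_witness[of _ "\<lambda>\<theta>. inv \<tau> \<circ> \<theta>" "\<lambda>\<theta>. \<tau> \<circ> \<theta>"])
  have "\<tau> \<circ> inv \<tau> = id" "inv \<tau> \<circ> \<tau> = id"
    using assms by (auto dest!: fpermD(1) simp: permutes_inv_o)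
  then show "\<tau> \<circ> (inv \<tau> \<circ> \<theta>) = \<theta>" "inv \<tau> \<circ> (\<tau> \<circ> \<theta>) = \<theta>" for \<theta>
    by (simp_all flip: comp_assoc)
qed (use assms in \<open>auto simp: fperm_compose fperm_inv\<close>)

text \<open>Conjugation by \<open>b\<close> is the bijection. Only equality of colours is compared,
  not the colours themselves; this lets column numbers be replaced by coordinates later.\<close>

lemma map_permutation_fperm_bij:
  assumes b: "bij_betw b A B" and c: "\<And>x y. x \<in> A \<Longrightarrow> y \<in> A \<Longrightarrow> cB (b x) = cB (b y) \<longleftrightarrow> cA x = cA y"
  shows "bij_betw (map_permutation A b) (fperm A cA) (fperm B cB)"
proof (rule bij_betw_byWitness[where f' = "map_permutation B (inv_into A b)"])
  have inj: "inj_on b A" and B: "B = b ` A"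
    using b by (auto simp: bij_betw_def)
  have b': "bij_betw (inv_into A b) B A"
    by (rule bij_betw_inv_into[OF b])
  show "\<forall>\<theta>\<in>fperm A cA. map_permutation B (inv_into A b) (map_permutation A b \<theta>) = \<theta>"
    by (auto dest!: fpermD(1) intro!: map_permutation_compose_inv[OF b] simp: inj)
  show "\<forall>\<theta>\<in>fperm B cB. map_permutation A b (map_permutation B (inv_into A b) \<theta>) = \<theta>"
    by (auto dest!: fpermD(1) intro!: map_permutation_compose_inv[OF b'])
       (simp add: f_inv_into_f B)
  show "map_permutation A b ` fperm A cA \<subseteq> fperm B cB"
    using b c by (auto simp: fperm_def map_permutation_permutes B map_permutation_apply inj permutes_in_image)
  have inj': "inj_on (inv_into A b) B"
    using b' by (simp add: bij_betw_def)
  have m: "map_permutation B (inv_into A b) \<theta> x = inv_into A b (\<theta> (b x))" if "x \<in> A" for \<theta> x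
    using map_permutation_apply[OF inj', of "b x" \<theta>] that by (simp add: inj B)
  show "map_permutation B (inv_into A b) ` fperm B cB \<subseteq> fperm A cA"
  proof clarsimp
    fix \<theta> assume \<theta>: "\<theta> \<in> fperm B cB"
    have "cA (inv_into A b (\<theta> (b x))) = cA x" if x: "x \<in> A" for x
    proof -
      have "\<theta> (b x) \<in> B"
        using \<theta> x B by (auto dest!: fpermD(1) simp: permutes_in_image)
      then have "inv_into A b (\<theta> (b x)) \<in> A" "b (inv_into A b (\<theta> (b x))) = \<theta> (b x)"
        by (auto simp: B inv_into_into f_inv_into_f)
      moreover have "cB (\<theta> (b x)) = cB (b x)"
        using \<theta> x B by (auto dest: fpermD(2))
      ultimately show ?thesis
        using c x by metis
    qed
    then show "map_permutation B (inv_into A b) \<theta> \<in> fperm A cA"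
      using \<theta> b' by (auto simp: fperm_def map_permutation_permutes m)
  qed
qed

lemma sum_fperm_transport:
  assumes b: "bij_betw b A B" and c: "\<And>x y. x \<in> A \<Longrightarrow> y \<in> A \<Longrightarrow> cB (b x) = cB (b y) \<longleftrightarrow> cA x = cA y"
  shows "(\<Sum>\<theta>\<in>fperm B cB. F \<theta>) = (\<Sum>\<theta>\<in>fperm A cA. F (map_permutation A b \<theta>))"
  by (rule sum.reindex_bij_betw[symmetric, OF map_permutation_fperm_bij]) (use assms in auto)

section \<open>Permutations of a disjoint union of blocks\<close>

definition glue :: "'j set \<Rightarrow> ('j \<Rightarrow> 'a \<Rightarrow> 'a) \<Rightarrow> 'j \<times> 'a \<Rightarrow> 'j \<times> 'a"
  where "glue J h = (\<lambda>(j, y). if j \<in> J then (j, h j y) else (j, y))"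

lemma glue_permutes:
  assumes "finite J" "\<And>j. j \<in> J \<Longrightarrow> finite (Y j)" "\<And>j. j \<in> J \<Longrightarrow> h j permutes Y j"
  shows "glue J h permutes Sigma J Y"
proof (rule inj_imp_permutes)
  show "inj_on (glue J h) (Sigma J Y)"
    by (auto simp: inj_on_def glue_def inj_eq[OF permutes_inj[OF assms(3)]])
  show "glue J h p = p" if "p \<notin> Sigma J Y" for p
    using that permutes_not_in[OF assms(3)[of "fst p"], of "snd p"] by (cases p) (auto simp: glue_def)
qed (use assms in \<open>auto simp: glue_def permutes_in_image\<close>)

lemma glue_in_fperm:
  assumes "finite J" "\<And>j. j \<in> J \<Longrightarrow> finite (Y j)" "\<And>j. j \<in> J \<Longrightarrow> h j \<in> fperm (Y j) (c j)"
  shows "glue J h \<in> fperm (Sigma J Y) (\<lambda>(j, y). (j, c j y))"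
  using glue_permutes[of J Y h] assms by (auto simp: fperm_def glue_def)

text \<open>The glued permutation is the composition of its parts on the single blocks, and each
  part is a copy of \<open>h j\<close>, so it has the same sign.\<close>

lemma sign_glue:
  assumes "finite J" "\<And>j. j \<in> J \<Longrightarrow> finite (Y j)" "\<And>j. j \<in> J \<Longrightarrow> h j permutes Y j"
  shows "sign (glue J h) = (\<Prod>j\<in>J. sign (h j))"
  using assms
proof (induction J)
  case empty
  have "glue {} h = id"
    by (auto simp: glue_def)
  then show ?case by simp
next
  case (insert a J)
  have single: "glue {a} h = map_permutation (Y a) (Pair a) (h a)"
  proof
    fix p :: "'a \<times> 'b"
    show "glue {a} h p = map_permutation (Y a) (Pair a) (h a) p"
    proof (cases "p \<in> Pair a ` Y a")
      case True
      then show ?thesis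
        by (auto simp: map_permutation_apply inj_on_def glue_def)
    next
      case False
      then show ?thesis
        using insert.prems
        by (cases p) (auto simp: map_permutation_def restrict_id_def glue_def image_iff intro: permutes_not_in)
    qed
  qed
  have "glue (insert a J) h = glue {a} h \<circ> glue J h"
    using insert.hyps by (auto simp: glue_def)
  moreover have "permutation (glue {a} h)" "permutation (glue J h)"
  proof -
    show "permutation (glue {a} h)"
      by (rule permutes_imp_permutation[OF _ glue_permutes[of "{a}" Y h]]) (use insert.prems in auto)
    show "permutation (glue J h)"
      by (rule permutes_imp_permutation[OF _ glue_permutes[of J Y h]]) (use insert in auto)
  qed
  moreover have "sign (glue {a} h) = sign (h a)"
    unfolding single using insert.prems by (intro sign_map_permutation) (auto simp: inj_on_def)
  ultimately show ?case
    using insert sign_compose[of "glue {a} h" "glue J h"] by (simp add: comp_def)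
qed

text \<open>Since the colour of \<open>(j, y)\<close> contains \<open>j\<close>, an element of the
  group maps every block to itself and is determined by its second components. The restriction to
  \<open>J\<close> makes this family extensional, as \<open>PiE\<close> requires.\<close>

lemma glue_bij:
  assumes "finite J" "\<And>j. j \<in> J \<Longrightarrow> finite (Y j)"
  shows "bij_betw (glue J) (PiE J (\<lambda>j. fperm (Y j) (c j)))
    (fperm (Sigma J Y) (\<lambda>(j, y). (j, c j y)))" (is "bij_betw _ ?P ?F")
proof (rule bij_betw_byWitness[where f' = "\<lambda>\<theta>. \<lambda>j\<in>J. \<lambda>y. snd (\<theta> (j, y))"])
  show "\<forall>h\<in>?P. (\<lambda>j\<in>J. \<lambda>y. snd (glue J h (j, y))) = h"
    by (auto simp: glue_def restrict_def PiE_def extensional_def fun_eq_iff)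
  have fst: "fst (\<theta> (j, y)) = j" if "\<theta> \<in> ?F" for \<theta> j y
    using that fpermD(2)[OF that, of "(j, y)"] fpermD(1)[OF that]
    by (cases "j \<in> J \<and> y \<in> Y j") (auto simp: permutes_not_in split: prod.splits)
  have not: "\<theta> (j, y) = (j, y)" if "\<theta> \<in> ?F" "j \<in> J \<Longrightarrow> y \<notin> Y j" for \<theta> j y
    using that by (auto dest!: fpermD(1) simp: permutes_not_in)
  show "\<forall>\<theta>\<in>?F. glue J (\<lambda>j\<in>J. \<lambda>y. snd (\<theta> (j, y))) = \<theta>"
  proof clarify
    fix \<theta> assume \<theta>: "\<theta> \<in> ?F"
    show "glue J (\<lambda>j\<in>J. \<lambda>y. snd (\<theta> (j, y))) = \<theta>"
    proof
      fix p show "glue J (\<lambda>j\<in>J. \<lambda>y. snd (\<theta> (j, y))) p = \<theta> p"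
        using fst[OF \<theta>, of "fst p" "snd p"] not[OF \<theta>, of "fst p" "snd p"]
        by (cases p) (auto simp: glue_def intro!: prod_eqI)
    qed
  qed
  show "glue J ` ?P \<subseteq> ?F"
    using assms by (auto intro!: glue_in_fperm)
  show "(\<lambda>\<theta>. \<lambda>j\<in>J. \<lambda>y. snd (\<theta> (j, y))) ` ?F \<subseteq> ?P"
  proof clarify
    fix \<theta> assume \<theta>: "\<theta> \<in> ?F"
    have "(\<lambda>y. snd (\<theta> (j, y))) \<in> fperm (Y j) (c j)" if j: "j \<in> J" for j
      unfolding fperm_def
    proof safe
      have p: "\<theta> permutes Sigma J Y" using \<theta> by (rule fpermD)
      show "(\<lambda>y. snd (\<theta> (j, y))) permutes Y j"
      proof (rule inj_imp_permutes)
        show "inj_on (\<lambda>y. snd (\<theta> (j, y))) (Y j)"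
        proof (rule inj_onI)
          fix x y assume "snd (\<theta> (j, x)) = snd (\<theta> (j, y))"
          then have "\<theta> (j, x) = \<theta> (j, y)"
            using fst[OF \<theta>] by (simp add: prod_eq_iff)
          then show "x = y"
            using permutes_inj[OF p] by (auto dest: injD)
        qed
        show "snd (\<theta> (j, y)) \<in> Y j" if "y \<in> Y j" for y
          using permutes_in_image[OF p, of "(j, y)"] that j fst[OF \<theta>, of j y]
          by (cases "\<theta> (j, y)") auto
      qed (use not[OF \<theta>] assms j in auto)
      show "c j (snd (\<theta> (j, y))) = c j y" if "y \<in> Y j" for y
        using fpermD(2)[OF \<theta>, of "(j, y)"] that j fst[OF \<theta>, of j y]
        by (cases "\<theta> (j, y)") auto
    qed
    then show "(\<lambda>j\<in>J. \<lambda>y. snd (\<theta> (j, y))) \<in> ?P"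
      by auto
  qed
qed

text \<open>The group is the product of the groups of the blocks, so a sum of products over the
  blocks becomes a product of sums. This is what splits the pairing over the columns of
  \<open>lam\<close>.\<close>

lemma sum_fperm_Sigma:
  fixes H :: "'j \<Rightarrow> ('a \<Rightarrow> 'a) \<Rightarrow> 'd::comm_semiring_1"
  assumes "finite J" "\<And>j. j \<in> J \<Longrightarrow> finite (Y j)"
  shows "(\<Sum>\<theta>\<in>fperm (Sigma J Y) (\<lambda>(j, y). (j, c j y)). \<Prod>j\<in>J. H j (\<lambda>y. snd (\<theta> (j, y))))
    = (\<Prod>j\<in>J. \<Sum>\<theta>\<in>fperm (Y j) (c j). H j \<theta>)"
proof -
  have "(\<Sum>\<theta>\<in>fperm (Sigma J Y) (\<lambda>(j, y). (j, c j y)). \<Prod>j\<in>J. H j (\<lambda>y. snd (\<theta> (j, y))))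
    = (\<Sum>h\<in>PiE J (\<lambda>j. fperm (Y j) (c j)). \<Prod>j\<in>J. H j (\<lambda>y. snd (glue J h (j, y))))"
    by (rule sum.reindex_bij_betw[symmetric]) (rule glue_bij[OF assms])
  also have "\<dots> = (\<Sum>h\<in>PiE J (\<lambda>j. fperm (Y j) (c j)). \<Prod>j\<in>J. H j (h j))"
    by (simp add: glue_def cong: prod.cong)
  finally show ?thesis
    by (simp add: sum_PiE_prod[OF assms(1)])
qed

lemma sign_fperm_Sigma:
  assumes "finite J" "\<And>j. j \<in> J \<Longrightarrow> finite (Y j)"
    and "\<theta> \<in> fperm (Sigma J Y) (\<lambda>(j, y). (j, c j y))"
  shows "sign \<theta> = (\<Prod>j\<in>J. sign (\<lambda>y. snd (\<theta> (j, y))))"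
proof -
  have "\<theta> \<in> glue J ` PiE J (\<lambda>j. fperm (Y j) (c j))"
    using assms(3) bij_betw_imp_surj_on[OF glue_bij[of J Y c, OF assms(1,2)]] by simp
  then obtain h where h: "h \<in> PiE J (\<lambda>j. fperm (Y j) (c j))" "\<theta> = glue J h"
    by blast
  have "sign (glue J h) = (\<Prod>j\<in>J. sign (h j))"
    by (rule sign_glue[where Y = Y]) (use assms(1,2) fpermD(1)[OF PiE_mem[OF h(1)]] in auto)
  then show ?thesis
    unfolding h(2) by (auto simp: glue_def intro!: prod.cong)
qed

section \<open>Latin squares and minors\<close>

definition less_pairs :: "nat \<Rightarrow> (nat \<times> nat) set"
  where "less_pairs m = (SIGMA j:{..<m}. {..<j})"

lemma finite_less_pairs [simp]: "finite (less_pairs m)"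
  by (simp add: less_pairs_def)

text \<open>\<open>q\<close> permutes the unordered pairs, and \<open>\<phi>\<close> is this
  permutation when each pair is written with its larger element first. Antisymmetry gives a factor
  -1 for each pair that \<open>q\<close> reverses.\<close>

lemma prod_less_pairs_permute:
  fixes g :: "nat \<Rightarrow> nat \<Rightarrow> int"
  assumes q: "q permutes {..<m}" and anti: "\<And>i j. g i j = - g j i"
  shows "(\<Prod>(j, i)\<in>less_pairs m. g (q i) (q j))
    = (\<Prod>(j, i)\<in>less_pairs m. sgn (int (q j) - int (q i))) * (\<Prod>(j, i)\<in>less_pairs m. g i j)"
proof -
  define \<phi> where "\<phi> = (\<lambda>(j, i). (max (q i) (q j), min (q i) (q j)))"
  have inj_q: "q i = q j \<longleftrightarrow> i = j" for i j
    using permutes_inj[OF q] by (auto dest: injD)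
  have lt: "q i < m \<longleftrightarrow> i < m" for i
    using permutes_in_image[OF q] by simp
  have "inj_on \<phi> (less_pairs m)"
  proof (rule inj_onI, clarify)
    fix j i j' i' assume l: "(j, i) \<in> less_pairs m" "(j', i') \<in> less_pairs m"
      and "\<phi> (j, i) = \<phi> (j', i')"
    then have "q i = q i' \<and> q j = q j' \<or> q i = q j' \<and> q j = q i'"
      by (auto simp: \<phi>_def max_def min_def split: if_splits)
    then show "j = j' \<and> i = i'"
      using l by (auto simp: inj_q less_pairs_def)
  qed
  moreover have "\<phi> ` less_pairs m \<subseteq> less_pairs m"
  proof (rule image_subsetI, clarify)
    fix j i assume "(j, i) \<in> less_pairs m"
    then have "q j < m" "q i < m" "q i < q j \<or> q j < q i"
      by (auto simp: less_pairs_def lt neq_iff[symmetric] inj_q)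
    then show "\<phi> (j, i) \<in> less_pairs m"
      by (auto simp: \<phi>_def less_pairs_def)
  qed
  ultimately have bij: "bij_betw \<phi> (less_pairs m) (less_pairs m)"
    by (simp add: bij_betw_def endo_inj_surj)
  have "g (q i) (q j) = sgn (int (q j) - int (q i)) * (case \<phi> (j, i) of (j, i) \<Rightarrow> g i j)"
    if "(j, i) \<in> less_pairs m" for i j
  proof -
    have "q i \<noteq> q j"
      using that by (auto simp: less_pairs_def inj_q)
    then consider "q i < q j" | "q j < q i"
      by linarith
    then show ?thesis
    proof cases
      case 2
      then show ?thesis
        by (subst anti) (simp add: \<phi>_def max_def min_def)
    qed (simp add: \<phi>_def max_def min_def)
  qed
  then have "(\<Prod>(j, i)\<in>less_pairs m. g (q i) (q j))
      = (\<Prod>(j, i)\<in>less_pairs m. sgn (int (q j) - int (q i)) * (case \<phi> (j, i) of (j, i) \<Rightarrow> g i j))"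
    by (intro prod.cong) auto
  also have "\<dots> = (\<Prod>(j, i)\<in>less_pairs m. sgn (int (q j) - int (q i)))
      * (\<Prod>p\<in>less_pairs m. case \<phi> p of (j, i) \<Rightarrow> g i j)"
    by (simp only: prod.distrib case_prod_unfold prod.collapse)
  also have "(\<Prod>p\<in>less_pairs m. case \<phi> p of (j, i) \<Rightarrow> g i j) = (\<Prod>(j, i)\<in>less_pairs m. g i j)"
    by (rule prod.reindex_bij_betw[OF bij])
  finally show ?thesis .
qed

lemma prod_less_pairs_transpose:
  assumes "a < m" "b < m" "a \<noteq> b"
  shows "(\<Prod>(j, i)\<in>less_pairs m. sgn (int (transpose a b j) - int (transpose a b i))) = -1"
proof -
  \<comment> \<open>The order in which \<open>a, b\<close> come first: the transposition changes the sign of \<open>g i j\<close>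
    only for the pair \<open>{a, b}\<close>.\<close>
  define r :: "nat \<Rightarrow> int" where "r x = (if x = a then 0 else if x = b then 0 else int x + 1)" for x
  define g :: "nat \<Rightarrow> nat \<Rightarrow> int" where
    "g x y = (if x = a \<and> y = b then 1 else if x = b \<and> y = a then -1 else sgn (r y - r x))" for x y
  let ?t = "transpose a b"
  let ?p = "(max a b, min a b)"
  have anti: "g i j = - g j i" for i j
    using assms by (auto simp: g_def sgn_if)
  have p: "?p \<in> less_pairs m"
    using assms by (auto simp: less_pairs_def)
  have r_t: "r (?t x) = r x" for x
    by (auto simp: r_def transpose_def)
  have gt: "g (?t i) (?t j) = g i j * (if (j, i) = ?p then -1 else 1)" if "(j, i) \<in> less_pairs m" for i j
  proof (cases "{i, j} = {a, b}")
    case True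
    then show ?thesis
      using that assms by (auto simp: doubleton_eq_iff g_def less_pairs_def)
  next
    case False
    then have "\<not> (i = a \<and> j = b)" "\<not> (i = b \<and> j = a)"
      by auto
    moreover from this have "\<not> (?t i = a \<and> ?t j = b)" "\<not> (?t i = b \<and> ?t j = a)"
      by (auto simp: transpose_def split: if_splits)
    moreover from False have "(j, i) \<noteq> ?p"
      by (auto simp: max_def min_def split: if_splits)
    ultimately show ?thesis
      unfolding g_def r_t by (simp only: if_False mult_1_right)
  qed
  have "(\<Prod>(j, i)\<in>less_pairs m. g (?t i) (?t j))
      = (\<Prod>(j, i)\<in>less_pairs m. g i j * (if (j, i) = ?p then -1 else 1))"
    using gt by (intro prod.cong) auto
  also have "\<dots> = (\<Prod>(j, i)\<in>less_pairs m. g i j) * (\<Prod>x\<in>less_pairs m. if x = ?p then -1 else 1)"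
    by (simp only: prod.distrib[symmetric] case_prod_unfold prod.collapse)
  also have "(\<Prod>x\<in>less_pairs m. if x = ?p then -1 else 1) = (-1::int)"
    using p by simp
  finally have "(\<Prod>(j, i)\<in>less_pairs m. g (?t i) (?t j)) = - (\<Prod>(j, i)\<in>less_pairs m. g i j)"
    by simp
  moreover have "g i j \<noteq> 0" if "i < j" for i j
  proof (cases "{i, j} = {a, b}")
    case True
    then show ?thesis
      by (auto simp: doubleton_eq_iff g_def)
  next
    case False
    then have "r i \<noteq> r j"
      using that by (auto simp: r_def)
    with False show ?thesis
      by (auto simp: g_def sgn_if)
  qed
  \<comment> \<open>Being nonzero, this product can be cancelled from the two expressions for its
    transposed version, which leaves the factor -1.\<close>
  then have "(\<Prod>(j, i)\<in>less_pairs m. g i j) \<noteq> 0"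
    by (subst prod_zero_iff) (auto simp: less_pairs_def)
  moreover have "?t permutes {..<m}"
    using assms by (simp add: permutes_swap_id)
  ultimately show ?thesis
    unfolding prod_less_pairs_permute[of ?t m g, OF \<open>?t permutes {..<m}\<close> anti]
    by (metis mult_minus1 mult_right_cancel)
qed

text \<open>By induction over transpositions: a further transposition changes the sign of both
  sides. The right-hand side is the form in which \<open>column_sign\<close> measures a
  column.\<close>

lemma sign_eq_prod_less_pairs:
  assumes "p permutes {..<m}"
  shows "sign p = (\<Prod>(j, i)\<in>less_pairs m. sgn (int (p j) - int (p i)))"
  using finite_lessThan assms
proof (induction rule: permutes_rev_induct)
  case id
  have "(\<Prod>(j, i)\<in>less_pairs m. sgn (int (id j) - int (id i))) = 1"
    by (intro prod.neutral) (auto simp: less_pairs_def)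
  then show ?case
    by simp
next
  case (swap a b p)
  have "sgn (int (p j) - int (p i)) = - sgn (int (p i) - int (p j))" for i j
    by (simp add: sgn_if)
  \<comment> \<open>The antisymmetric function compares the values of \<open>p\<close>, so the
    formula expresses the product for \<open>p \<circ> transpose a b\<close> through the one for
    \<open>p\<close>.\<close>
  from prod_less_pairs_permute[of "transpose a b" m "\<lambda>x y. sgn (int (p y) - int (p x))",
    OF permutes_swap_id this]
  have "(\<Prod>(j, i)\<in>less_pairs m. sgn (int ((p \<circ> transpose a b) j) - int ((p \<circ> transpose a b) i)))
    = - sign p"
    using prod_less_pairs_transpose[of a m b] swap by simp
  moreover have "sign (p \<circ> transpose a b) = - sign p"
    using swap by (subst sign_compose)
      (auto simp: sign_swap_id permutation_swap_id permutes_imp_permutation[of "{..<m}"])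
  ultimately show ?case
    by (simp add: comp_def)
qed

section \<open>Column antisymmetrization of fillings of an array\<close>

text \<open>The cell \<open>(q, i)\<close> is in column \<open>q\<close> and row \<open>i\<close>.\<close>

definition cells :: "nat \<Rightarrow> nat \<Rightarrow> (nat \<times> nat) set"
  where "cells m k = {..<m} \<times> {..<k}"

lemma finite_cells [simp]: "finite (cells m k)"
  by (simp add: cells_def)

lemma fperm_cellsD:
  assumes "\<theta> \<in> fperm (cells m k) fst" "q < m" "i < k"
  shows "fst (\<theta> (q, i)) = q" "snd (\<theta> (q, i)) < k"
  using fpermD(2)[OF assms(1), of "(q, i)"] permutes_in_image[OF fpermD(1)[OF assms(1)], of "(q, i)"] assms(2,3)
  by (auto simp: cells_def mem_Times_iff)

text \<open>There are \<open>m\<close> cells in each row, so for entries below \<open>m\<close> this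
  says that every row is a permutation of the letters.\<close>

definition row_inj :: "nat \<Rightarrow> nat \<Rightarrow> (nat \<times> nat \<Rightarrow> nat) \<Rightarrow> bool"
  where "row_inj m k w \<longleftrightarrow> inj_on (\<lambda>y. (snd y, w y)) (cells m k)"

text \<open>This is the value at \<open>w\<close> of the antisymmetrization, under column
  permutations, of the indicator function of the fillings with injective rows.\<close>

definition signed_count :: "nat \<Rightarrow> nat \<Rightarrow> (nat \<times> nat \<Rightarrow> nat) \<Rightarrow> int"
  where "signed_count m k w =
    (\<Sum>\<theta>\<in>fperm (cells m k) fst. sign \<theta> * (if row_inj m k (w \<circ> \<theta>) then 1 else 0))"

lemma row_inj_cong: "(\<And>y. y \<in> cells m k \<Longrightarrow> w y = w' y) \<Longrightarrow> row_inj m k w = row_inj m k w'"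
  unfolding row_inj_def by (intro inj_on_cong) auto

lemma signed_count_cong:
  assumes "\<And>y. y \<in> cells m k \<Longrightarrow> w y = w' y"
  shows "signed_count m k w = signed_count m k w'"
proof -
  have "row_inj m k (w \<circ> \<theta>) = row_inj m k (w' \<circ> \<theta>)" if "\<theta> \<in> fperm (cells m k) fst" for \<theta>
    using assms permutes_in_image[OF fpermD(1)[OF that]] by (intro row_inj_cong) auto
  then show ?thesis
    by (auto simp: signed_count_def)
qed

lemma signed_count_compose:
  assumes "\<tau> \<in> fperm (cells m k) fst"
  shows "signed_count m k (w \<circ> \<tau>) = sign \<tau> * signed_count m k w"
proof -
  have "signed_count m k (w \<circ> \<tau>)
    = (\<Sum>\<theta>\<in>fperm (cells m k) fst. sign \<tau> * (sign (\<tau> \<circ> \<theta>) * (if row_inj m k (w \<circ> (\<tau> \<circ> \<theta>)) then 1 else 0)))"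
    unfolding signed_count_def
    by (intro sum.cong) (simp_all add: sign_fperm_compose[OF _ assms] comp_assoc flip: mult.assoc)
  also have "\<dots> = sign \<tau> * signed_count m k w"
    unfolding sum_distrib_left[symmetric] signed_count_def
    by (subst sum_fperm_compose_left[OF assms, where F = "\<lambda>\<theta>. sign \<theta> * (if row_inj m k (w \<circ> \<theta>) then 1 else 0)"]) simp
  finally show ?thesis .
qed

text \<open>The column permutations of the first \<open>k\<close> rows form a subgroup, so the signed sum over all column
  permutations is a sum over its cosets.\<close>

lemma signed_count_restrict_eq_0:
  assumes "k \<le> m" and zero: "\<And>w. w \<in> cells m k \<rightarrow> {..<m} \<Longrightarrow> signed_count m k w = 0"
    and w: "w \<in> cells m m \<rightarrow> {..<m}"
  shows "signed_count m m w = 0"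
proof -
  let ?H = "fperm (cells m k) fst" and ?H' = "fperm (cells m m) fst"
  have sub: "cells m k \<subseteq> cells m m"
    using assms(1) by (auto simp: cells_def)
  have H: "\<tau> \<in> ?H'" if "\<tau> \<in> ?H" for \<tau>
    using that fperm_mono[OF sub] by blast
  \<comment> \<open>The condition on the rows from \<open>k\<close> on, which column permutations of
    the first \<open>k\<close> rows leave untouched.\<close>
  define rest where "rest w \<longleftrightarrow> inj_on (\<lambda>y. (snd y, w y)) (cells m m - cells m k)" for w :: "nat \<times> nat \<Rightarrow> nat"
  have row_split: "row_inj m m w \<longleftrightarrow> row_inj m k w \<and> rest w" for w
  proof -
    have "(\<lambda>y. (snd y, w y)) ` (cells m k - (cells m m - cells m k))
        \<inter> (\<lambda>y. (snd y, w y)) ` (cells m m - cells m k - cells m k) = {}"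
      by (auto simp: cells_def)
    then have "inj_on (\<lambda>y. (snd y, w y)) (cells m k \<union> (cells m m - cells m k))
      \<longleftrightarrow> row_inj m k w \<and> rest w"
      unfolding inj_on_Un row_inj_def rest_def by blast
    then show ?thesis
      using sub by (simp add: row_inj_def Un_absorb1)
  qed
  have inner: "(\<Sum>\<tau>\<in>?H. sign \<tau> * (if row_inj m m (w \<circ> \<sigma> \<circ> \<tau>) then 1 else 0)) = 0" if "\<sigma> \<in> ?H'" for \<sigma>
  proof -
    have "rest (w \<circ> \<sigma> \<circ> \<tau>) = rest (w \<circ> \<sigma>)" if "\<tau> \<in> ?H" for \<tau>
      unfolding rest_def using fpermD(1)[OF that] by (intro inj_on_cong) (auto simp: permutes_not_in)
    then have "(\<Sum>\<tau>\<in>?H. sign \<tau> * (if row_inj m m (w \<circ> \<sigma> \<circ> \<tau>) then 1 else 0))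
      = (\<Sum>\<tau>\<in>?H. (sign \<tau> * (if row_inj m k (w \<circ> \<sigma> \<circ> \<tau>) then 1 else 0)) * (if rest (w \<circ> \<sigma>) then 1 else 0))"
      by (intro sum.cong) (auto simp: row_split)
    also have "\<dots> = signed_count m k (w \<circ> \<sigma>) * (if rest (w \<circ> \<sigma>) then 1 else 0)"
      by (simp add: signed_count_def sum_distrib_right)
    also have "signed_count m k (w \<circ> \<sigma>) = 0"
      using w sub permutes_in_image[OF fpermD(1)[OF that]] by (intro zero) fastforce
    finally show ?thesis by (simp only: mult_zero_left)
  qed
  \<comment> \<open>Every \<open>\<tau>\<close> in the subgroup can be absorbed into the sum over
    the whole column group. After the sums are exchanged, the inner ones run over cosets of
    \<open>?H\<close> and vanish by \<open>inner\<close>.\<close>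
  have "int (card ?H) * signed_count m m w = (\<Sum>\<tau>\<in>?H. signed_count m m w)"
    by simp
  also have "\<dots> = (\<Sum>\<tau>\<in>?H. \<Sum>\<sigma>\<in>?H'. sign (\<sigma> \<circ> \<tau>) * (if row_inj m m (w \<circ> (\<sigma> \<circ> \<tau>)) then 1 else 0))"
    unfolding signed_count_def
    by (intro sum.cong refl sum_fperm_compose_right[symmetric] H)
  also have "\<dots> = (\<Sum>\<sigma>\<in>?H'. \<Sum>\<tau>\<in>?H. sign \<sigma> * (sign \<tau> * (if row_inj m m (w \<circ> \<sigma> \<circ> \<tau>) then 1 else 0)))"
    by (subst sum.swap, intro sum.cong refl) (simp add: sign_fperm_compose[OF _ _ H] comp_assoc)
  also have "\<dots> = 0"
    by (simp add: inner flip: sum_distrib_left)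
  finally have "int (card ?H) * signed_count m m w = 0" .
  moreover have "card ?H \<noteq> 0"
    using id_in_fperm[of "cells m k" fst] by (metis card_eq_0_iff empty_iff finite_cells finite_fperm)
  ultimately show ?thesis
    by simp
qed

lemma compose_in_PiE:
  assumes "\<theta> permutes X" "w \<in> X \<rightarrow>\<^sub>E B"
  shows "w \<circ> \<theta> \<in> X \<rightarrow>\<^sub>E B"
  using assms permutes_in_image[OF assms(1)]
  by (auto simp: PiE_def extensional_def permutes_not_in)

lemma sum_PiE_compose:
  assumes "\<theta> permutes X"
  shows "(\<Sum>w\<in>X \<rightarrow>\<^sub>E B. F (w \<circ> \<theta>)) = (\<Sum>w\<in>X \<rightarrow>\<^sub>E B. F w)"
  by (rule sum.reindex_bij_witness[of _ "\<lambda>w. w \<circ> inv \<theta>" "\<lambda>w. w \<circ> \<theta>"])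
     (use assms in \<open>auto simp: compose_in_PiE permutes_inv comp_assoc permutes_inv_o\<close>)

text \<open>The sum times the order of the group of column permutations is the sum of the squares of all
  values of \<open>signed_count m k\<close>.\<close>

lemma sum_row_inj_signed_count_neq_0:
  assumes "w\<^sub>0 \<in> cells m k \<rightarrow> {..<m}" "signed_count m k w\<^sub>0 \<noteq> 0"
  shows "(\<Sum>w\<in>cells m k \<rightarrow>\<^sub>E {..<m}. (if row_inj m k w then signed_count m k w else 0)) \<noteq> 0"
    (is "?N \<noteq> 0")
proof
  let ?W = "cells m k \<rightarrow>\<^sub>E {..<m}" and ?H = "fperm (cells m k) fst"
  let ?P = "\<lambda>w. if row_inj m k w then 1 else 0 :: int"
  assume "?N = 0"
  \<comment> \<open>One factor is expanded, and the sign of \<open>\<tau>\<close> in it turns the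
    other factor into its value at \<open>w \<circ> \<tau>\<close>. Replacing
    \<open>w \<circ> \<tau>\<close> by \<open>w\<close> then makes all \<open>\<tau>\<close>
    contribute the same.\<close>
  have "(\<Sum>w\<in>?W. signed_count m k w * signed_count m k w)
      = (\<Sum>w\<in>?W. \<Sum>\<tau>\<in>?H. ?P (w \<circ> \<tau>) * signed_count m k (w \<circ> \<tau>))"
    by (intro sum.cong refl)
       (subst (1) signed_count_def, auto simp: sum_distrib_right signed_count_compose intro!: sum.cong)
  also have "\<dots> = (\<Sum>\<tau>\<in>?H. \<Sum>w\<in>?W. ?P w * signed_count m k w)"
    by (subst sum.swap, intro sum.cong refl sum_PiE_compose[where F = "\<lambda>w. ?P w * signed_count m k w"])
       (rule fpermD)
  also have "(\<Sum>w\<in>?W. ?P w * signed_count m k w) = ?N"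
    by (intro sum.cong) auto
  finally have "(\<Sum>w\<in>?W. signed_count m k w * signed_count m k w) = 0"
    using \<open>?N = 0\<close> by simp
  then have "\<forall>w\<in>?W. signed_count m k w * signed_count m k w = 0"
    by (subst (asm) sum_nonneg_eq_0_iff) (auto intro: finite_PiE)
  moreover have "restrict w\<^sub>0 (cells m k) \<in> ?W"
    using assms(1) by auto
  moreover have "signed_count m k (restrict w\<^sub>0 (cells m k)) = signed_count m k w\<^sub>0"
    by (rule signed_count_cong) simp
  ultimately show False
    using assms(2) by auto
qed


section \<open>Minor polynomials and their coefficient at the product of all variables\<close>

text \<open>Here \<open>\<theta>\<close> runs over the terms of the minors of \<open>g\<close>, one for each column of cells, and \<open>\<eta>\<close> over
  the fillings whose rows are permutations.\<close>

definition minor_poly :: "nat \<Rightarrow> nat \<Rightarrow> (nat \<Rightarrow> nat \<Rightarrow> complex) \<Rightarrow> complex"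
  where "minor_poly m k g = (\<Sum>\<theta>\<in>fperm (cells m k) fst. \<Sum>\<eta>\<in>fperm (cells m k) snd.
    of_int (sign \<theta>) * (\<Prod>y\<in>cells m k. g (snd (\<theta> y)) (fst (\<eta> y))))"

text \<open>A permutation within rows is determined by the columns of its images, and in each row
  these columns form a permutation of the \<open>m\<close> letters. So elements of the row group and
  fillings with permutation rows are the same data.\<close>

lemma fperm_snd_bij:
  "bij_betw (\<lambda>\<eta>. restrict (fst \<circ> \<eta>) (cells m k)) (fperm (cells m k) snd)
     {w \<in> cells m k \<rightarrow>\<^sub>E {..<m}. row_inj m k w}"
proof (rule bij_betw_byWitness[where f' = "\<lambda>w y. if y \<in> cells m k then (w y, snd y) else y"])
  let ?C = "cells m k" and ?f = "\<lambda>w y. if y \<in> cells m k then (w y, snd y) else y"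
  have snd: "snd (\<eta> y) = snd y" and im: "\<eta> y \<in> ?C \<longleftrightarrow> y \<in> ?C" and
    not_in: "y \<notin> ?C \<Longrightarrow> \<eta> y = y" if "\<eta> \<in> fperm ?C snd" for \<eta> y
  proof -
    have p: "\<eta> permutes ?C"
      using that by (rule fpermD)
    show "\<eta> y \<in> ?C \<longleftrightarrow> y \<in> ?C" "y \<notin> ?C \<Longrightarrow> \<eta> y = y"
      by (simp_all add: permutes_in_image[OF p] permutes_not_in[OF p])
    then show "snd (\<eta> y) = snd y"
      using fpermD(2)[OF that] by (cases "y \<in> ?C") auto
  qed
  show "\<forall>\<eta>\<in>fperm ?C snd. ?f (restrict (fst \<circ> \<eta>) ?C) = \<eta>"
    by (auto simp: fun_eq_iff snd not_in intro!: prod_eqI)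
  show "\<forall>w\<in>{w \<in> ?C \<rightarrow>\<^sub>E {..<m}. row_inj m k w}. restrict (fst \<circ> ?f w) ?C = w"
    by (auto simp: fun_eq_iff PiE_def extensional_def)
  show "(\<lambda>\<eta>. restrict (fst \<circ> \<eta>) ?C) ` fperm ?C snd \<subseteq> {w \<in> ?C \<rightarrow>\<^sub>E {..<m}. row_inj m k w}"
  proof clarify
    fix \<eta> assume \<eta>: "\<eta> \<in> fperm ?C snd"
    have "inj_on (\<lambda>y. (snd y, restrict (fst \<circ> \<eta>) ?C y)) ?C"
    proof (rule inj_onI)
      fix x y assume "x \<in> ?C" "y \<in> ?C"
        and "(snd x, restrict (fst \<circ> \<eta>) ?C x) = (snd y, restrict (fst \<circ> \<eta>) ?C y)"
      then have "\<eta> x = \<eta> y"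
        by (simp add: prod_eq_iff snd[OF \<eta>])
      then show "x = y"
        by (simp add: inj_eq[OF permutes_inj[OF fpermD(1)[OF \<eta>]]])
    qed
    moreover have "fst (\<eta> y) < m" if "y \<in> ?C" for y
      using im[OF \<eta>, of y] that by (simp add: cells_def mem_Times_iff)
    ultimately show "restrict (fst \<circ> \<eta>) ?C \<in> ?C \<rightarrow>\<^sub>E {..<m} \<and> row_inj m k (restrict (fst \<circ> \<eta>) ?C)"
      by (auto simp: row_inj_def)
  qed
  show "?f ` {w \<in> ?C \<rightarrow>\<^sub>E {..<m}. row_inj m k w} \<subseteq> fperm ?C snd"
  proof clarify
    fix w assume w: "w \<in> ?C \<rightarrow>\<^sub>E {..<m}" "row_inj m k w"
    have "?f w permutes ?C"
    proof (rule inj_imp_permutes)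
      show "inj_on (?f w) ?C"
        using w(2) by (auto simp: row_inj_def inj_on_def)
      show "?f w y \<in> ?C" if "y \<in> ?C" for y
        using PiE_mem[OF w(1) that] that by (simp add: cells_def mem_Times_iff)
    qed simp_all
    then show "?f w \<in> fperm ?C snd"
      by (simp add: fperm_def)
  qed
qed

text \<open>If some \<open>z\<close> lies outside \<open>S\<close>, then adding or removing
  \<open>z\<close> pairs the sets with opposite signs. With the variables of a monomial as
  \<open>S\<close>, this selects the monomials that contain all variables.\<close>

lemma sum_signed_subsets:
  assumes "finite Z" "S \<subseteq> Z"
  shows "(\<Sum>G\<in>Pow Z. (-1) ^ card G * (if S \<subseteq> G then 1 else 0))
    = (if S = Z then (-1) ^ card Z else 0 :: complex)"
proof (cases "S = Z")
  case True
  have "(\<Sum>G\<in>Pow Z. (-1) ^ card G * (if S \<subseteq> G then 1 else 0))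
      = (\<Sum>G\<in>Pow Z. if G = Z then (-1) ^ card Z else 0 :: complex)"
    using True by (intro sum.cong) auto
  with True assms show ?thesis
    by simp
next
  case False
  then obtain z where z: "z \<in> Z" "z \<notin> S"
    using assms by auto
  let ?F = "\<lambda>G. (-1) ^ card G * (if S \<subseteq> G then 1 else 0) :: complex"
  have Z: "Z = insert z (Z - {z})"
    using z by auto
  have "(\<Sum>G\<in>Pow Z. ?F G) = (\<Sum>G\<in>Pow (Z - {z}). ?F G) + (\<Sum>G\<in>insert z ` Pow (Z - {z}). ?F G)"
    by (subst Z, subst Pow_insert, rule sum.union_disjoint) (use assms in auto)
  also have "(\<Sum>G\<in>insert z ` Pow (Z - {z}). ?F G) = (\<Sum>G\<in>Pow (Z - {z}). ?F (insert z G))"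
    by (subst sum.reindex) (auto simp: inj_on_def)
  also have "\<dots> = (\<Sum>G\<in>Pow (Z - {z}). - ?F G)"
  proof (intro sum.cong refl)
    fix G assume G: "G \<in> Pow (Z - {z})"
    then have "finite G" "z \<notin> G"
      using assms by (auto intro: finite_subset)
    then show "?F (insert z G) = - ?F G"
      using z(2) by auto
  qed
  finally show ?thesis
    using False by (simp add: sum_negf)
qed

text \<open>Up to sign, the alternating sum of the values of \<open>minor_poly\<close> at 0-1 matrices is its coefficient
  at the product of all variables.\<close>

lemma alternating_sum_minor_poly:
  "(\<Sum>G\<in>Pow ({..<k} \<times> {..<m}). (-1) ^ card G * minor_poly m k (\<lambda>a b. if (a, b) \<in> G then 1 else 0))
    = (-1) ^ (k * m) * of_int (\<Sum>w\<in>cells m k \<rightarrow>\<^sub>E {..<m}. (if row_inj m k w then signed_count m k w else 0))"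
proof -
  let ?C = "cells m k" and ?Z = "{..<k} \<times> {..<m}"
  let ?H = "fperm ?C fst" and ?V = "fperm ?C snd"
  \<comment> \<open>The variables of the monomial that belongs to \<open>\<theta>\<close> and
    \<open>\<eta>\<close>; at a 0-1 matrix with support \<open>G\<close> the monomial is 1 exactly
    if they all lie in \<open>G\<close>.\<close>
  let ?S = "\<lambda>\<theta> \<eta>. (\<lambda>y. (snd (\<theta> y), fst (\<eta> y))) ` ?C"
  have S: "?S \<theta> \<eta> \<subseteq> ?Z" if "\<theta> \<in> ?H" "\<eta> \<in> ?V" for \<theta> \<eta>
  proof (rule image_subsetI)
    fix y assume "y \<in> ?C"
    then have "\<theta> y \<in> ?C" "\<eta> y \<in> ?C"
      using permutes_in_image fpermD(1) that by metis+
    then show "(snd (\<theta> y), fst (\<eta> y)) \<in> ?Z"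
      by (simp add: cells_def mem_Times_iff)
  qed
  have prod_eq: "(\<Prod>y\<in>?C. if (snd (\<theta> y), fst (\<eta> y)) \<in> G then 1 else 0) = (if ?S \<theta> \<eta> \<subseteq> G then 1 else (0::complex))"
    for \<theta> \<eta> G
  proof (cases "?S \<theta> \<eta> \<subseteq> G")
    case True
    then show ?thesis
      by (simp add: image_subset_iff)
  qed (auto simp: prod_zero_iff)
  \<comment> \<open>There are as many variables as factors, so all variables occur exactly if the
    factors are distinct. Reindexed by \<open>inv \<theta>\<close>, distinctness says that no row of
    the permuted filling repeats an entry.\<close>
  have full: "?S \<theta> \<eta> = ?Z \<longleftrightarrow> row_inj m k ((fst \<circ> \<eta>) \<circ> inv \<theta>)" if \<theta>: "\<theta> \<in> ?H" and \<eta>: "\<eta> \<in> ?V" for \<theta> \<eta>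
  proof -
    have p: "\<theta> permutes ?C"
      using \<theta> by (rule fpermD)
    have card: "card ?Z = card ?C" and fin: "finite ?Z"
      by (simp_all add: cells_def)
    have "?S \<theta> \<eta> = ?Z \<longleftrightarrow> inj_on (\<lambda>y. (snd (\<theta> y), fst (\<eta> y))) ?C"
    proof
      assume "?S \<theta> \<eta> = ?Z"
      then show "inj_on (\<lambda>y. (snd (\<theta> y), fst (\<eta> y))) ?C"
        by (intro eq_card_imp_inj_on) (simp_all only: card finite_cells)
    next
      assume "inj_on (\<lambda>y. (snd (\<theta> y), fst (\<eta> y))) ?C"
      then show "?S \<theta> \<eta> = ?Z"
        by (intro card_subset_eq fin S that) (simp only: card_image card)
    qed
    also have "\<dots> \<longleftrightarrow> inj_on ((\<lambda>y. (snd y, ((fst \<circ> \<eta>) \<circ> inv \<theta>) y)) \<circ> \<theta>) ?C"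
      by (simp add: comp_def permutes_inverses[OF p])
    also have "\<dots> \<longleftrightarrow> inj_on (\<lambda>y. (snd y, ((fst \<circ> \<eta>) \<circ> inv \<theta>) y)) (\<theta> ` ?C)"
      by (rule comp_inj_on_iff[symmetric]) (use permutes_inj_on[OF p] in blast)
    finally show ?thesis
      by (simp add: permutes_image[OF p] row_inj_def)
  qed
  have "(\<Sum>G\<in>Pow ?Z. (-1) ^ card G * minor_poly m k (\<lambda>a b. if (a, b) \<in> G then 1 else 0))
    = (\<Sum>G\<in>Pow ?Z. \<Sum>\<theta>\<in>?H. \<Sum>\<eta>\<in>?V. of_int (sign \<theta>) * ((-1) ^ card G * (if ?S \<theta> \<eta> \<subseteq> G then 1 else 0)))"
    unfolding minor_poly_def prod_eq sum_distrib_left by (simp only: mult.left_commute)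
  also have "\<dots> = (\<Sum>\<theta>\<in>?H. \<Sum>\<eta>\<in>?V. \<Sum>G\<in>Pow ?Z. of_int (sign \<theta>) * ((-1) ^ card G * (if ?S \<theta> \<eta> \<subseteq> G then 1 else 0)))"
    by (subst sum.swap, intro sum.cong refl, rule sum.swap)
  also have "\<dots> = (\<Sum>\<theta>\<in>?H. \<Sum>\<eta>\<in>?V. of_int (sign \<theta>) * (if ?S \<theta> \<eta> = ?Z then (-1) ^ card ?Z else 0))"
    unfolding sum_distrib_left[symmetric] by (intro sum.cong refl arg_cong2[where f = "(*)"] sum_signed_subsets S) auto
  also have "\<dots> = (\<Sum>\<theta>\<in>?H. \<Sum>\<eta>\<in>?V. (-1) ^ (k * m) * of_int (sign (inv \<theta>) * (if row_inj m k ((fst \<circ> \<eta>) \<circ> inv \<theta>) then 1 else 0)))"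
    by (intro sum.cong refl) (simp add: full sign_inverse[OF fperm_permutation[OF finite_cells]])
  also have "\<dots> = (-1) ^ (k * m) * (\<Sum>\<eta>\<in>?V. of_int (\<Sum>\<theta>\<in>?H. sign (inv \<theta>) * (if row_inj m k ((fst \<circ> \<eta>) \<circ> inv \<theta>) then 1 else 0)))"
    by (subst sum.swap) (simp only: sum_distrib_left of_int_sum)
  also have "\<dots> = (-1) ^ (k * m) * (\<Sum>\<eta>\<in>?V. of_int (signed_count m k (restrict (fst \<circ> \<eta>) ?C)))"
    by (subst sum_fperm_inv[where F = "\<lambda>\<theta>. sign \<theta> * (if row_inj m k (w \<circ> \<theta>) then 1 else 0)" for w])
       (auto simp: signed_count_def[symmetric] intro!: sum.cong signed_count_cong)
  also have "(\<Sum>\<eta>\<in>?V. of_int (signed_count m k (restrict (fst \<circ> \<eta>) ?C)))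
    = (\<Sum>w\<in>{w \<in> ?C \<rightarrow>\<^sub>E {..<m}. row_inj m k w}. of_int (signed_count m k w))"
    by (rule sum.reindex_bij_betw[OF fperm_snd_bij])
  also have "\<dots> = of_int (\<Sum>w\<in>?C \<rightarrow>\<^sub>E {..<m}. if row_inj m k w then signed_count m k w else 0)"
    by (auto simp: sum.inter_filter finite_PiE intro!: sum.cong)
  finally show ?thesis .
qed

lemma minor_poly_neq_0_if_signed_count_neq_0:
  assumes "w\<^sub>0 \<in> cells m k \<rightarrow> {..<m}" "signed_count m k w\<^sub>0 \<noteq> 0"
  shows "\<exists>g. minor_poly m k g \<noteq> 0"
proof (rule ccontr)
  assume "\<nexists>g. minor_poly m k g \<noteq> 0"
  then show False
    using alternating_sum_minor_poly[of m k] sum_row_inj_signed_count_neq_0[OF assms]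
    by (simp del: of_int_sum)
qed


section \<open>Common non-roots of finitely many polynomials\<close>

definition polynomial_on_lines :: "((nat \<Rightarrow> nat \<Rightarrow> complex) \<Rightarrow> complex) \<Rightarrow> bool"
  where "polynomial_on_lines F \<longleftrightarrow> (\<forall>a b. \<exists>p. \<forall>x. F (\<lambda>i j. a i j + x * b i j) = poly p x)"

lemma polynomial_on_linesD:
  "polynomial_on_lines F \<Longrightarrow> \<exists>p. \<forall>x. F (\<lambda>i j. a i j + x * b i j) = poly p x"
  by (simp add: polynomial_on_lines_def)

lemma polynomial_on_lines_entry: "polynomial_on_lines (\<lambda>g. g i j)"
  unfolding polynomial_on_lines_def by (intro allI exI[of _ "[:a i j, b i j:]" for a b]) simp

lemma polynomial_on_lines_const: "polynomial_on_lines (\<lambda>g. c)"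
  unfolding polynomial_on_lines_def by (intro allI exI[of _ "[:c:]"]) simp

lemma polynomial_on_lines_mult:
  assumes "polynomial_on_lines F" "polynomial_on_lines G"
  shows "polynomial_on_lines (\<lambda>g. F g * G g)"
  using assms unfolding polynomial_on_lines_def by (metis poly_mult)

lemma polynomial_on_lines_add:
  assumes "polynomial_on_lines F" "polynomial_on_lines G"
  shows "polynomial_on_lines (\<lambda>g. F g + G g)"
  using assms unfolding polynomial_on_lines_def by (metis poly_add)

lemma polynomial_on_lines_sum:
  "(\<And>i. i \<in> I \<Longrightarrow> polynomial_on_lines (F i)) \<Longrightarrow> polynomial_on_lines (\<lambda>g. \<Sum>i\<in>I. F i g)"
  by (induction I rule: infinite_finite_induct)
     (simp_all add: polynomial_on_lines_const polynomial_on_lines_add)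

lemma polynomial_on_lines_prod:
  "(\<And>i. i \<in> I \<Longrightarrow> polynomial_on_lines (F i)) \<Longrightarrow> polynomial_on_lines (\<lambda>g. \<Prod>i\<in>I. F i g)"
  by (induction I rule: infinite_finite_induct)
     (simp_all add: polynomial_on_lines_const polynomial_on_lines_mult)

lemma polynomial_on_lines_minor_poly: "polynomial_on_lines (minor_poly m k)"
  unfolding minor_poly_def
  by (intro polynomial_on_lines_sum polynomial_on_lines_mult polynomial_on_lines_const
      polynomial_on_lines_prod polynomial_on_lines_entry)

text \<open>A non-root \<open>a\<close> of the earlier functions is joined by a line to a non-root
  \<open>b\<close> of the new one. On this line every function is a nonzero polynomial in one
  variable, so some point avoids the finitely many roots. Hence polynomiality along lines is
  enough.\<close>

lemma common_nonzero:
  assumes "finite K" "\<And>k. k \<in> K \<Longrightarrow> polynomial_on_lines (F k)" "\<And>k. k \<in> K \<Longrightarrow> \<exists>g. F k g \<noteq> 0"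
  shows "\<exists>g. \<forall>k\<in>K. F k g \<noteq> 0"
  using assms
proof (induction K)
  case (insert l K)
  obtain a where a: "\<forall>k\<in>K. F k a \<noteq> 0"
    using insert by auto
  obtain b where b: "F l b \<noteq> 0"
    using insert.prems by auto
  let ?g = "\<lambda>x i j. a i j + x * (b i j - a i j)"
  have "\<forall>k\<in>insert l K. \<exists>p. \<forall>x. F k (?g x) = poly p x"
    using polynomial_on_linesD[OF insert.prems(1), where b = "\<lambda>i j. b i j - a i j"] by blast
  from bchoice[OF this] obtain p where p: "F k (?g x) = poly (p k) x" if "k \<in> insert l K" for k x
    by blast
  \<comment> \<open>The new function is nonzero at \<open>x = 1\<close>, the earlier ones at
    \<open>x = 0\<close>.\<close>
  have "p k \<noteq> 0" if "k \<in> insert l K" for k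
  proof (cases "k = l")
    case True
    then have "poly (p k) 1 \<noteq> 0"
      using p[OF that, of 1] b by simp
    then show ?thesis by auto
  next
    case False
    then have "poly (p k) 0 \<noteq> 0"
      using p[OF that, of 0] a that False by auto
    then show ?thesis by auto
  qed
  then have "finite (\<Union>k\<in>insert l K. {x. poly (p k) x = 0})"
    using insert.hyps by (auto intro: poly_roots_finite)
  then obtain x where "x \<notin> (\<Union>k\<in>insert l K. {x. poly (p k) x = 0})"
    using ex_new_if_finite[OF infinite_UNIV_char_0] by blast
  then show ?case
    using p by (intro exI[of _ "?g x"]) auto
qed auto

section \<open>Latin squares as column permutations of the cells\<close>

lemma sgn_prod: "sgn (\<Prod>x\<in>A. f x) = (\<Prod>x\<in>A. sgn (f x :: 'b::linordered_idom))"
  by (induction A rule: infinite_finite_induct) (simp_all add: idom_abs_sgn_class.sgn_mult)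

lemma column_sign_eq_sign:
  assumes "p permutes {..<m}" "\<And>i. i < m \<Longrightarrow> A (Suc i, Suc q) = Suc (p i)"
  shows "column_sign m A (Suc q) = sign p"
proof -
  have "(\<Prod>p'\<in>{1..m}. \<Prod>p\<in>{1..<p'}. int (A (p', Suc q)) - int (A (p, Suc q)))
    = (\<Prod>j<m. \<Prod>i<j. int (A (Suc j, Suc q)) - int (A (Suc i, Suc q)))"
    by (simp add: prod.atLeast1_atMost_eq atLeastLessThanSuc_atLeastAtMost)
  also have "\<dots> = (\<Prod>j<m. \<Prod>i<j. int (p j) - int (p i))"
    by (intro prod.cong refl) (simp add: assms(2))
  also have "\<dots> = (\<Prod>(j, i)\<in>less_pairs m. int (p j) - int (p i))"
    by (simp add: less_pairs_def prod.Sigma)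
  finally show ?thesis
    unfolding column_sign_def sign_eq_prod_less_pairs[OF assms(1)]
    by (simp add: sgn_prod case_prod_unfold)
qed

text \<open>Cells name the column first and count from 0, while squares name the row first and count
  from 1; hence the exchanged, shifted arguments and the \<open>Suc\<close>.\<close>

definition latin_of_perm :: "nat \<Rightarrow> (nat \<times> nat \<Rightarrow> nat \<times> nat) \<Rightarrow> nat \<times> nat \<Rightarrow> nat"
  where "latin_of_perm m \<theta> = (\<lambda>(p, q)\<in>{1..m} \<times> {1..m}. Suc (snd (\<theta> (q - 1, p - 1))))"

lemma bij_betw_Suc_iff:
  "bij_betw f {1..m} {1..m} \<longleftrightarrow> bij_betw (\<lambda>i. f (Suc i) - 1) {..<m} {..<m}" if "f ` {1..m} \<subseteq> {1..m}"
proof -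
  have S: "bij_betw Suc {..<m} {1..m}"
    by (auto simp: bij_betw_def image_Suc_lessThan)
  have P: "bij_betw (\<lambda>i. i - 1) {1..m} {..<m}"
    by (rule bij_betw_byWitness[where f' = Suc]) auto
  have "bij_betw f {1..m} {1..m} \<longleftrightarrow> bij_betw (f \<circ> Suc) {..<m} {1..m}"
    using S by (rule bij_betw_comp_iff)
  also have "\<dots> \<longleftrightarrow> bij_betw ((\<lambda>i. i - 1) \<circ> (f \<circ> Suc)) {..<m} {..<m}"
    by (rule bij_betw_comp_iff2[OF P]) (use that in auto)
  finally show ?thesis
    by (simp add: comp_def)
qed

text \<open>Permuting within columns makes the columns permutations, and the condition on
  \<open>snd \<circ> \<theta>\<close> does the same for the rows.\<close>

lemma latin_of_perm_bij:
  "bij_betw (latin_of_perm m) {\<theta> \<in> fperm (cells m m) fst. row_inj m m (snd \<circ> \<theta>)} (latin_squares m)"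
proof (rule bij_betw_byWitness[where f' = "\<lambda>A y. if y \<in> cells m m then (fst y, A (Suc (snd y), Suc (fst y)) - 1) else y"])
  let ?C = "cells m m" and ?X = "{\<theta> \<in> fperm (cells m m) fst. row_inj m m (snd \<circ> \<theta>)}"
  let ?f = "\<lambda>A y. if y \<in> ?C then (fst y, A (Suc (snd y), Suc (fst y)) - 1) else y"
  show "\<forall>\<theta>\<in>?X. ?f (latin_of_perm m \<theta>) = \<theta>"
  proof clarify
    fix \<theta> assume \<theta>: "\<theta> \<in> fperm ?C fst"
    show "?f (latin_of_perm m \<theta>) = \<theta>"
      using fperm_cellsD(1)[OF \<theta>] permutes_not_in[OF fpermD(1)[OF \<theta>]]
      by (auto simp: fun_eq_iff latin_of_perm_def cells_def intro!: prod_eqI)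
  qed
  show "\<forall>A\<in>latin_squares m. latin_of_perm m (?f A) = A"
  proof
    fix A assume "A \<in> latin_squares m"
    then have A: "A \<in> ({1..m} \<times> {1..m}) \<rightarrow>\<^sub>E {1..m}"
      by (simp add: latin_squares_def)
    show "latin_of_perm m (?f A) = A"
    proof
      fix x show "latin_of_perm m (?f A) x = A x"
      proof (cases "x \<in> {1..m} \<times> {1..m}")
        case True
        then show ?thesis
          using PiE_mem[OF A True] by (cases x) (auto simp: latin_of_perm_def cells_def)
      next
        case False
        then show ?thesis
          using PiE_arb[OF A False] by (simp add: latin_of_perm_def)
      qed
    qed
  qed
  show "latin_of_perm m ` ?X \<subseteq> latin_squares m"
  proof clarify
    fix \<theta> assume \<theta>: "\<theta> \<in> fperm ?C fst" and row: "row_inj m m (snd \<circ> \<theta>)"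
    let ?A = "latin_of_perm m \<theta>"
    have inj: "inj \<theta>"
      using fpermD(1)[OF \<theta>] by (rule permutes_inj)
    have A: "?A (Suc i, Suc q) = Suc (snd (\<theta> (q, i)))" if "q < m" "i < m" for q i
      using that by (simp add: latin_of_perm_def)
    have lt: "snd (\<theta> (q, i)) < m" if "q < m" "i < m" for q i
      using fperm_cellsD[OF \<theta> that] by simp
    have mem: "?A (p, q) \<in> {1..m}" if "p \<in> {1..m}" "q \<in> {1..m}" for p q
    proof -
      have "Suc (snd (\<theta> (q - 1, p - 1))) \<le> m"
        using that by (intro Suc_leI lt) auto
      then show ?thesis
        using that by (simp add: latin_of_perm_def)
    qed
    have "inj_on (\<lambda>q. snd (\<theta> (q, i))) {..<m}" if "i < m" for i
      using row that by (auto simp: row_inj_def inj_on_def cells_def)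
    then have rows: "bij_betw (\<lambda>q. snd (\<theta> (q, i))) {..<m} {..<m}" if "i < m" for i
      using lt that by (simp add: bij_betw_def endo_inj_surj image_subset_iff)
    have "inj_on (\<lambda>i. snd (\<theta> (q, i))) {..<m}" if "q < m" for q
    proof (rule inj_onI)
      fix i j assume "i \<in> {..<m}" "j \<in> {..<m}" "snd (\<theta> (q, i)) = snd (\<theta> (q, j))"
      then have "\<theta> (q, i) = \<theta> (q, j)"
        using fperm_cellsD(1)[OF \<theta>] that by (auto simp: prod_eq_iff)
      then show "i = j"
        using inj by (auto dest: injD)
    qed
    then have cols: "bij_betw (\<lambda>i. snd (\<theta> (q, i))) {..<m} {..<m}" if "q < m" for q
      using lt that by (simp add: bij_betw_def endo_inj_surj image_subset_iff)
    have "bij_betw (\<lambda>q. ?A (p, q)) {1..m} {1..m}" if "p \<in> {1..m}" for p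
    proof (subst bij_betw_Suc_iff)
      have eq: "bij_betw (\<lambda>q. ?A (p, Suc q) - 1) {..<m} {..<m}
          \<longleftrightarrow> bij_betw (\<lambda>q. snd (\<theta> (q, p - 1))) {..<m} {..<m}"
        using that by (intro bij_betw_cong) (simp add: latin_of_perm_def)
      show "bij_betw (\<lambda>q. ?A (p, Suc q) - 1) {..<m} {..<m}"
      proof -
        have "p - 1 < m"
          using that unfolding atLeastAtMost_iff by linarith
        then show ?thesis
          using rows eq by blast
      qed
    qed (use mem that in blast)
    moreover have "bij_betw (\<lambda>p. ?A (p, q)) {1..m} {1..m}" if "q \<in> {1..m}" for q
    proof (subst bij_betw_Suc_iff)
      have eq: "bij_betw (\<lambda>p. ?A (Suc p, q) - 1) {..<m} {..<m}
          \<longleftrightarrow> bij_betw (\<lambda>p. snd (\<theta> (q - 1, p))) {..<m} {..<m}"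
        using that by (intro bij_betw_cong) (simp add: latin_of_perm_def)
      show "bij_betw (\<lambda>p. ?A (Suc p, q) - 1) {..<m} {..<m}"
      proof -
        have "q - 1 < m"
          using that unfolding atLeastAtMost_iff by linarith
        then show ?thesis
          using cols eq by blast
      qed
    qed (use mem that in blast)
    moreover have "?A \<in> ({1..m} \<times> {1..m}) \<rightarrow>\<^sub>E {1..m}"
      using mem by (auto simp: latin_of_perm_def)
    ultimately show "?A \<in> latin_squares m"
      by (simp add: latin_squares_def)
  qed
  show "?f ` latin_squares m \<subseteq> ?X"
  proof clarify
    fix A assume A: "A \<in> latin_squares m"
    have mem: "A (p, q) \<in> {1..m}" if "p \<in> {1..m}" "q \<in> {1..m}" for p q
      using A that by (auto simp: latin_squares_def)
    have mem': "A (Suc p, Suc q) - 1 < m" "0 < A (Suc p, Suc q)" if "p < m" "q < m" for p q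
      using mem[of "Suc p" "Suc q"] that by auto
    have inj: "inj_on (\<lambda>q. A (p, q)) {1..m}" "inj_on (\<lambda>q. A (q, p)) {1..m}" if "p \<in> {1..m}" for p
      using A that by (auto simp: latin_squares_def bij_betw_def)
    \<comment> \<open>Entries are positive, so subtracting 1 loses nothing and injectivity survives
      the shift.\<close>
    have eq: "q = q'" if "i < m" "q < m" "q' < m" "A (Suc i, Suc q) - 1 = A (Suc i, Suc q') - 1" for i q q'
    proof -
      have "A (Suc i, Suc q) = A (Suc i, Suc q')"
        using mem'(2)[of i q] mem'(2)[of i q'] that by linarith
      with inj(1)[of "Suc i"] have "Suc q = Suc q'"
        by (rule inj_onD) (use that in auto)
      then show ?thesis by simp
    qed
    have eq': "q = q'" if "i < m" "q < m" "q' < m" "A (Suc q, Suc i) - 1 = A (Suc q', Suc i) - 1" for i q q'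
    proof -
      have "A (Suc q, Suc i) = A (Suc q', Suc i)"
        using mem'(2)[of q i] mem'(2)[of q' i] that by linarith
      with inj(2)[of "Suc i"] have "Suc q = Suc q'"
        by (rule inj_onD) (use that in auto)
      then show ?thesis by simp
    qed
    have "?f A permutes ?C"
    proof (rule inj_imp_permutes)
      show "inj_on (?f A) ?C"
        using eq' by (auto simp: inj_on_def cells_def)
      show "?f A y \<in> ?C" if "y \<in> ?C" for y
        using that mem'(1)[of "snd y" "fst y"] by (simp add: cells_def mem_Times_iff)
    qed simp_all
    then have "?f A \<in> fperm ?C fst"
      by (simp add: fperm_def)
    moreover have "row_inj m m (snd \<circ> ?f A)"
      using eq by (auto simp: row_inj_def inj_on_def cells_def)
    ultimately show "?f A \<in> fperm ?C fst \<and> row_inj m m (snd \<circ> ?f A)"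
      by blast
  qed
qed

lemma prod_column_sign_latin_of_perm:
  assumes \<theta>: "\<theta> \<in> fperm (cells m m) fst"
  shows "(\<Prod>q\<in>{1..m}. column_sign m (latin_of_perm m \<theta>) q) = sign \<theta>"
proof -
  \<comment> \<open>A dummy second component brings the colouring into the shape that
    \<open>sign_fperm_Sigma\<close> expects, with the columns as blocks.\<close>
  have "fperm (cells m m) fst = fperm (SIGMA q:{..<m}. {..<m}) (\<lambda>(q, i). (q, ()))"
    by (auto simp: fperm_def cells_def case_prod_unfold)
  with \<theta> have \<theta>': "\<theta> \<in> fperm (SIGMA q:{..<m}. {..<m}) (\<lambda>(q, i). (q, ()))"
    by simp
  let ?p = "\<lambda>q i. snd (\<theta> (q, i))"
  have "column_sign m (latin_of_perm m \<theta>) (Suc q) = sign (?p q)" if q: "q < m" for q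
  proof (rule column_sign_eq_sign)
    show "?p q permutes {..<m}"
    proof (rule inj_imp_permutes)
      show "inj_on (?p q) {..<m}"
      proof (rule inj_onI)
        fix i j assume "i \<in> {..<m}" "j \<in> {..<m}" "?p q i = ?p q j"
        then have "\<theta> (q, i) = \<theta> (q, j)"
          using fperm_cellsD(1)[OF \<theta>] q by (auto simp: prod_eq_iff)
        then show "i = j"
          using permutes_inj[OF fpermD(1)[OF \<theta>]] by (auto dest: injD)
      qed
    qed (use fperm_cellsD(2)[OF \<theta>] q permutes_not_in[OF fpermD(1)[OF \<theta>]] in \<open>auto simp: cells_def\<close>)
  qed (use q in \<open>simp add: latin_of_perm_def\<close>)
  then show ?thesis
    unfolding sign_fperm_Sigma[OF finite_lessThan finite_lessThan \<theta>']
    by (simp add: prod.atLeast1_atMost_eq)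
qed

text \<open>The filling \<open>snd\<close> is constant along each row. The column permutations that
  give it permutation rows correspond to the Latin squares, and the sign of the permutation is the
  product of the column signs.\<close>

lemma signed_count_snd_eq:
  "signed_count m m snd = int (card {A \<in> latin_squares m. column_even m A})
    - int (card {A \<in> latin_squares m. \<not> column_even m A})"
proof -
  let ?X = "{\<theta> \<in> fperm (cells m m) fst. row_inj m m (snd \<circ> \<theta>)}"
  have fin: "finite (latin_squares m)"
    by (rule finite_subset[OF _ finite_PiE[of "{1..m} \<times> {1..m}" "\<lambda>_. {1..m}"]]) (auto simp: latin_squares_def)
  \<comment> \<open>The product of the column signs is the sign of a permutation, so for a square
    that is not \<open>column_even\<close> it is -1.\<close>
  have sgn: "(\<Prod>q\<in>{1..m}. column_sign m A q) = (if column_even m A then 1 else -1)" if A: "A \<in> latin_squares m" for A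
  proof -
    obtain \<theta> where "\<theta> \<in> fperm (cells m m) fst" "A = latin_of_perm m \<theta>"
      using A bij_betw_imp_surj_on[OF latin_of_perm_bij[of m]] by blast
    then show ?thesis
      using prod_column_sign_latin_of_perm[of \<theta> m] sign_cases[of \<theta>] by (auto simp: column_even_def)
  qed
  have "signed_count m m snd = (\<Sum>\<theta>\<in>?X. sign \<theta>)"
    by (simp add: signed_count_def sum.inter_filter if_distrib[of "(*) x" for x] cong: if_cong)
  also have "\<dots> = (\<Sum>\<theta>\<in>?X. \<Prod>q\<in>{1..m}. column_sign m (latin_of_perm m \<theta>) q)"
    by (intro sum.cong refl prod_column_sign_latin_of_perm[symmetric]) simp
  also have "\<dots> = (\<Sum>A\<in>latin_squares m. \<Prod>q\<in>{1..m}. column_sign m A q)"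
    by (rule sum.reindex_bij_betw[OF latin_of_perm_bij])
  also have "\<dots> = (\<Sum>A\<in>latin_squares m. if column_even m A then 1 else -1)"
    by (intro sum.cong refl sgn)
  also have "\<dots> = (\<Sum>A\<in>{A \<in> latin_squares m. column_even m A}. 1) + (\<Sum>A\<in>{A \<in> latin_squares m. \<not> column_even m A}. -1)"
    by (subst sum.If_cases[OF fin]) (simp add: Int_def)
  finally show ?thesis
    by simp
qed

lemma common_minor_poly_neq_0:
  assumes "card {A \<in> latin_squares m. column_even m A} \<noteq> card {A \<in> latin_squares m. \<not> column_even m A}"
  shows "\<exists>g. \<forall>k\<le>m. minor_poly m k g \<noteq> 0"
proof -
  have "\<exists>g. minor_poly m k g \<noteq> 0" if "k \<le> m" for k
  proof -
    have "signed_count m m snd \<noteq> 0"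
      using assms by (simp add: signed_count_snd_eq)
    moreover have "snd \<in> cells m m \<rightarrow> {..<m}"
      by (auto simp: cells_def)
    ultimately obtain w where "w \<in> cells m k \<rightarrow> {..<m}" "signed_count m k w \<noteq> 0"
      using signed_count_restrict_eq_0[OF \<open>k \<le> m\<close>] by blast
    then show ?thesis
      by (rule minor_poly_neq_0_if_signed_count_neq_0)
  qed
  then show ?thesis
    using common_nonzero[of "{..m}" "minor_poly m"] polynomial_on_lines_minor_poly by auto
qed

section \<open>Complete reducibility\<close>

text \<open>The form is definite on functions supported on \<open>X\<close>, and the modules to be
  decomposed consist of such functions.\<close>

definition fun_inner :: "'x set \<Rightarrow> ('x \<Rightarrow> complex) \<Rightarrow> ('x \<Rightarrow> complex) \<Rightarrow> complex"
  where "fun_inner X f h = (\<Sum>x\<in>X. f x * cnj (h x))"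

lemma fun_inner_simps:
  "fun_inner X (f + f') h = fun_inner X f h + fun_inner X f' h"
  "fun_inner X (f - f') h = fun_inner X f h - fun_inner X f' h"
  "fun_inner X (\<lambda>x. c * f x) h = c * fun_inner X f h"
  "fun_inner X f (h + h') = fun_inner X f h + fun_inner X f h'"
  "fun_inner X f (h - h') = fun_inner X f h - fun_inner X f h'"
  "fun_inner X f (\<lambda>x. c * h x) = cnj c * fun_inner X f h"
  "fun_inner X 0 h = 0" "fun_inner X f 0 = 0"
  by (simp_all add: fun_inner_def algebra_simps sum.distrib sum_subtractf sum_distrib_left)

lemma fun_inner_self_eq_0:
  assumes "finite X" "fun_inner X f f = 0" "x \<in> X"
  shows "f x = 0"
proof -
  have "complex_of_real (\<Sum>x\<in>X. (cmod (f x))\<^sup>2) = fun_inner X f f"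
    unfolding fun_inner_def of_real_sum by (intro sum.cong refl complex_norm_square)
  then have "(\<Sum>x\<in>X. (cmod (f x))\<^sup>2) = 0"
    using assms(2) by (metis of_real_eq_0_iff)
  then show ?thesis
    using assms(1,3) by (simp add: sum_nonneg_eq_0_iff)
qed

lemma fun_inner_span_right:
  assumes "h \<in> cfun_span B" "\<And>b. b \<in> B \<Longrightarrow> fun_inner X f b = 0"
  shows "fun_inner X f h = 0"
  using assms(1)
proof (induction rule: cfun.span_induct_alt)
  case base
  show ?case
    by (rule fun_inner_simps)
next
  case (step c b y)
  then show ?case
    unfolding fun_inner_simps using assms(2) by simp
qed

text \<open>Gram-Schmidt, one vector at a time: \<open>b\<close> is first replaced by its component
  \<open>b - v\<close> orthogonal to \<open>B\<close>.\<close>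

lemma orthogonal_projection:
  assumes "finite X" "finite B"
  shows "\<exists>u\<in>cfun_span B. \<forall>b\<in>B. fun_inner X (f - u) b = 0"
  using assms(2)
proof (induction B arbitrary: f)
  case empty
  show ?case
    using cfun.span_zero by blast
next
  case (insert b B)
  obtain u where u: "u \<in> cfun_span B" "\<forall>b\<in>B. fun_inner X (f - u) b = 0"
    using insert.IH by blast
  obtain v where v: "v \<in> cfun_span B" "\<forall>c\<in>B. fun_inner X (b - v) c = 0"
    using insert.IH by blast
  have mono: "cfun_span B \<subseteq> cfun_span (insert b B)"
    by (rule cfun.span_mono) auto
  have fv: "fun_inner X (f - u) v = 0" and bv: "fun_inner X (b - v) v = 0"
    using u v by (auto intro: fun_inner_span_right)
  show ?case
  \<comment> \<open>If this norm vanishes, \<open>b\<close> agrees with \<open>v\<close> on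
    \<open>X\<close>, so \<open>f - u\<close> is already orthogonal to \<open>b\<close>.\<close>
  proof (cases "fun_inner X (b - v) (b - v) = 0")
    case True
    then have "(b - v) x = 0" if "x \<in> X" for x
      using fun_inner_self_eq_0[OF assms(1) _ that] by blast
    then have "fun_inner X (f - u) (b - v) = 0"
      by (simp add: fun_inner_def)
    then have "fun_inner X (f - u) b = 0"
      using fv by (simp add: fun_inner_simps)
    with u mono show ?thesis
      by blast
  next
    case False
    \<comment> \<open>The coefficient that makes \<open>f - ?u\<close> orthogonal to
      \<open>b\<close>; subtracting a multiple of \<open>b - v\<close> leaves the orthogonality to
      \<open>B\<close> intact.\<close>
    define c where "c = fun_inner X (f - u) b / fun_inner X (b - v) (b - v)"
    let ?u = "u + (\<lambda>x. c * (b - v) x)"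
    have "b - v \<in> cfun_span (insert b B)"
      using v(1) mono cfun.span_base[of b "insert b B"] by (intro cfun.span_diff) auto
    then have mem: "?u \<in> cfun_span (insert b B)"
      using u(1) mono by (intro cfun.span_add cfun.span_scale) blast+
    have diff: "fun_inner X (f - ?u) h = fun_inner X (f - u) h - c * fun_inner X (b - v) h" for h
      by (simp only: fun_inner_simps) (simp add: algebra_simps)
    have bb: "fun_inner X (b - v) b = fun_inner X (b - v) (b - v)"
      using bv by (simp only: fun_inner_simps) simp
    have "fun_inner X (f - ?u) b' = 0" if b': "b' \<in> insert b B" for b'
    proof (cases "b' = b")
      case True
      have "c * fun_inner X (b - v) b = fun_inner X (f - u) b"
        unfolding bb c_def using False by (rule nonzero_eq_divide_eq[THEN iffD1]) (rule refl)
      then show ?thesis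
        unfolding diff True by simp
    next
      case False
      then have "b' \<in> B"
        using b' by simp
      then show ?thesis
        unfolding diff using u(2) v(2) by simp
    qed
    with mem show ?thesis
      by blast
  qed
qed

section \<open>Dimension of spaces of functions with finite support\<close>

definition supported_on :: "'x set \<Rightarrow> ('x \<Rightarrow> complex) set"
  where "supported_on X = {f. \<forall>x. x \<notin> X \<longrightarrow> f x = 0}"

lemma sum_fun_apply: "(\<Sum>i\<in>I. F i) x = (\<Sum>i\<in>I. F i x)"
  by (induction I rule: infinite_finite_induct) simp_all

lemma supported_on_finite_span:
  assumes "finite X"
  shows "\<exists>S. finite S \<and> supported_on X \<subseteq> cfun_span S"
proof (intro exI conjI subsetI)
  let ?e = "\<lambda>x y. if y = x then 1 else 0 :: complex"
  show "finite (?e ` X)"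
    using assms by simp
  fix f assume "f \<in> supported_on X"
  then have "f = (\<Sum>x\<in>X. (\<lambda>y. f x * ?e x y))"
    using assms by (auto simp: fun_eq_iff supported_on_def sum_fun_apply if_distrib cong: if_cong)
  also have "\<dots> \<in> cfun_span (?e ` X)"
    by (intro cfun.span_sum cfun.span_scale cfun.span_base) auto
  finally show "f \<in> cfun_span (?e ` X)" .
qed

lemma finite_basis:
  assumes "finite X" "V \<subseteq> supported_on X" "cfun_subspace V"
  obtains B where "finite B" "B \<subseteq> V" "cfun_span B = V" "card B = cfun.dim V" "\<not> cfun.dependent B"
proof -
  obtain B where B: "B \<subseteq> V" "\<not> cfun.dependent B" "V \<subseteq> cfun_span B" "card B = cfun.dim V"
    using cfun.basis_exists by blast
  moreover obtain S where "finite S" "supported_on X \<subseteq> cfun_span S"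
    using supported_on_finite_span[OF assms(1)] by blast
  then have "finite B"
    using cfun.independent_span_bound[of S B] B assms by blast
  moreover have "cfun_span B = V"
    using cfun.span_minimal[OF B(1) assms(3)] B(3) by blast
  ultimately show ?thesis
    using that by blast
qed

lemma dim_psubspace:
  assumes "finite X" "V \<subseteq> supported_on X" "cfun_subspace V" "cfun_subspace U" "U \<subset> V"
  shows "cfun.dim U < cfun.dim V"
proof -
  obtain B where B: "finite B" "B \<subseteq> U" "cfun_span B = U" "card B = cfun.dim U" "\<not> cfun.dependent B"
    using finite_basis[of X U] assms by blast
  obtain B' where B': "B \<subseteq> B'" "B' \<subseteq> V" "\<not> cfun.dependent B'" "V \<subseteq> cfun_span B'"
    using cfun.maximal_independent_subset_extend[of B V] B assms by blast
  obtain S where "finite S" "supported_on X \<subseteq> cfun_span S"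
    using supported_on_finite_span[OF assms(1)] by blast
  then have "finite B'"
    using cfun.independent_span_bound[of S B'] B' assms by blast
  moreover have "B \<noteq> B'"
    using B B' assms(5) by blast
  ultimately have "card B < card B'"
    using B'(1) by (intro psubset_card_mono) auto
  then show ?thesis
    using B(4) cfun.basis_card_eq_dim[OF B'(2,4,3)] by simp
qed

text \<open>The orthogonal complement of a submodule of minimal dimension is a submodule.\<close>

lemma irreducible_decomposition_exists:
  assumes X: "finite X"
    and act: "\<And>g x. g permutes {1..k} \<Longrightarrow> x \<in> X \<Longrightarrow> \<alpha> g x \<in> X"
      "\<And>g x. g permutes {1..k} \<Longrightarrow> x \<in> X \<Longrightarrow> \<alpha> (inv g) (\<alpha> g x) = x"
    and V: "submodule k (fun_act \<alpha>) V" "V \<subseteq> supported_on X"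
  shows "\<exists>D. irreducible_decomposition k (fun_act \<alpha>) V D"
  using V
proof (induction "cfun.dim V" arbitrary: V rule: less_induct)
  case less
  have sub: "cfun_subspace V"
    using less.prems by (simp add: submodule_def)
  show ?case
  proof (cases "V = {0}")
    case True
    then have "irreducible_decomposition k (fun_act \<alpha>) V {}"
      by (auto simp: irreducible_decomposition_def)
    then show ?thesis ..
  next
    case False
    define P where "P U \<longleftrightarrow> submodule k (fun_act \<alpha>) U \<and> U \<noteq> {0} \<and> U \<subseteq> V" for U
    obtain W where W: "P W" and min: "\<And>U. P U \<Longrightarrow> cfun.dim W \<le> cfun.dim U"
      using ex_has_least_nat[of P V cfun.dim] less.prems False by (auto simp: P_def)
    have subW: "cfun_subspace W" and WV: "W \<subseteq> V" and W0: "W \<noteq> {0}" "0 \<in> W"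
      using W by (auto simp: P_def submodule_def cfun.subspace_0)
    have irr: "irreducible_submodule k (fun_act \<alpha>) W"
      unfolding irreducible_submodule_def
    proof (intro conjI allI impI)
      fix U assume U: "U \<subseteq> W" "submodule k (fun_act \<alpha>) U"
      show "U = {0} \<or> U = W"
      proof (rule ccontr)
        assume n: "\<not> (U = {0} \<or> U = W)"
        then have "P U"
          using U W by (auto simp: P_def)
        moreover have "cfun.dim U < cfun.dim W"
          using U n W less.prems by (intro dim_psubspace[OF X, of W]) (auto simp: P_def submodule_def)
        ultimately show False
          using min by fastforce
      qed
    qed (use W in \<open>auto simp: P_def\<close>)
    define V' where "V' = {f \<in> V. \<forall>h\<in>W. fun_inner X f h = 0}"
    have disj: "f = 0" if "f \<in> W" "f \<in> V'" for f
    proof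
      fix x
      show "f x = 0 x"
        using that fun_inner_self_eq_0[OF X, of f x] less.prems(2) by (cases "x \<in> X") (auto simp: V'_def supported_on_def)
    qed
    have sub': "cfun_subspace V'"
      using sub unfolding cfun.subspace_def V'_def by (auto simp: fun_inner_simps)
    \<comment> \<open>The action permutes the points of \<open>X\<close>, so it preserves the form,
      and stability of \<open>W\<close> gives stability of its orthogonal complement.\<close>
    have adj: "fun_inner X (fun_act \<alpha> g f) h = fun_inner X f (fun_act \<alpha> (inv g) h)"
      if g: "g permutes {1..k}" for g f h
    proof -
      note gi = permutes_inv[OF g] and ii = permutes_inv_inv[OF g]
      show ?thesis
        unfolding fun_inner_def fun_act_def ii
        by (rule sum.reindex_bij_witness[of _ "\<alpha> g" "\<alpha> (inv g)"])
           (use act[OF g] act[OF gi] in \<open>auto simp: ii\<close>)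
    qed
    have mod': "submodule k (fun_act \<alpha>) V'"
      unfolding submodule_def
    proof (intro conjI sub' allI impI ballI)
      fix g f assume g: "g permutes {1..k}" and f: "f \<in> V'"
      have "fun_act \<alpha> (inv g) h \<in> W" if "h \<in> W" for h
        using W permutes_inv[OF g] that unfolding P_def submodule_def by blast
      moreover have "fun_act \<alpha> g f \<in> V"
        using less.prems(1) g f unfolding V'_def submodule_def by blast
      ultimately show "fun_act \<alpha> g f \<in> V'"
        using f by (simp add: V'_def adj[OF g])
    qed
    have "V' \<subset> V"
      using disj W0 WV by (auto simp: V'_def)
    then have "cfun.dim V' < cfun.dim V"
      by (rule dim_psubspace[OF X less.prems(2) sub sub'])
    moreover have V'supp: "V' \<subseteq> supported_on X"
      using less.prems(2) by (auto simp: V'_def)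
    ultimately obtain D where D: "irreducible_decomposition k (fun_act \<alpha>) V' D"
      using less.hyps mod' by blast
    note D = D[unfolded irreducible_decomposition_def]
    have fin: "finite D"
      using D by (rule conjunct1)
    have irrD: "\<forall>U\<in>D. irreducible_submodule k (fun_act \<alpha>) U"
      using D[THEN conjunct2] by (rule conjunct1)
    have V'_eq: "V' = {\<Sum>U\<in>D. u U | u. \<forall>U\<in>D. u U \<in> U}"
      using D[THEN conjunct2, THEN conjunct2] by (rule conjunct1)
    have indep: "\<forall>u. (\<forall>U\<in>D. u U \<in> U) \<and> (\<Sum>U\<in>D. u U) = 0 \<longrightarrow> (\<forall>U\<in>D. u U = 0)"
      using D[THEN conjunct2, THEN conjunct2] by (rule conjunct2)
    have zero: "0 \<in> U" if "U \<in> D" for U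
      using irrD that unfolding irreducible_submodule_def submodule_def by (blast intro: cfun.subspace_0)
    \<comment> \<open>The summands form a set, so \<open>W\<close> must be new for
      \<open>insert W D\<close> to have one more summand. A summand equal to \<open>W\<close> would
      lie in \<open>V'\<close>, which meets \<open>W\<close> only in 0.\<close>
    have "W \<notin> D"
    proof
      assume "W \<in> D"
      obtain w where w: "w \<in> W" "w \<noteq> 0"
        using W0 by blast
      let ?u = "\<lambda>U. if U = W then w else 0"
      have "(\<Sum>U\<in>D. ?u U) = w"
        using fin \<open>W \<in> D\<close> by simp
      moreover have "\<forall>U\<in>D. ?u U \<in> U"
        using w zero by auto
      ultimately have "w \<in> V'"
        unfolding V'_eq by (intro CollectI exI[of _ ?u]) simp
      with disj w show False by blast
    qed
    have "V = {\<Sum>U\<in>insert W D. u U | u. \<forall>U\<in>insert W D. u U \<in> U}" (is "_ = ?R")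
    proof
      show "V \<subseteq> ?R"
      proof
        fix f assume f: "f \<in> V"
        obtain B where B: "finite B" "cfun_span B = W"
          by (rule finite_basis[OF X subset_trans[OF WV less.prems(2)] subW])
        \<comment> \<open>\<open>w\<close> is the orthogonal projection of \<open>f\<close> to
          \<open>W\<close>, so \<open>f - w\<close> lies in the complement
          \<open>V'\<close>.\<close>
        then obtain w where w: "w \<in> W" "\<forall>b\<in>B. fun_inner X (f - w) b = 0"
          using orthogonal_projection[OF X, of B f] by blast
        then have "fun_inner X (f - w) h = 0" if "h \<in> W" for h
          using that B by (auto intro: fun_inner_span_right)
        then have "f - w \<in> V'"
          using f w WV cfun.subspace_diff[OF sub] by (auto simp: V'_def)
        then obtain u where u: "f - w = (\<Sum>U\<in>D. u U)" "\<forall>U\<in>D. u U \<in> U"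
          unfolding V'_eq by blast
        have "(\<Sum>U\<in>D. (u(W := w)) U) = (\<Sum>U\<in>D. u U)"
          using \<open>W \<notin> D\<close> by (intro sum.cong) auto
        then have "f = (\<Sum>U\<in>insert W D. (u(W := w)) U)"
          using u(1) fin \<open>W \<notin> D\<close> by (simp add: algebra_simps)
        moreover have "\<forall>U\<in>insert W D. (u(W := w)) U \<in> U"
          using u(2) w by auto
        ultimately show "f \<in> ?R"
          by blast
      qed
      show "?R \<subseteq> V"
      proof clarify
        fix u assume u: "\<forall>U\<in>insert W D. u U \<in> U"
        then have "(\<Sum>U\<in>D. u U) \<in> V'"
          unfolding V'_eq by blast
        then have "u W + (\<Sum>U\<in>D. u U) \<in> V"
          using u WV by (intro cfun.subspace_add[OF sub]) (auto simp: V'_def)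
        then show "(\<Sum>U\<in>insert W D. u U) \<in> V"
          using fin \<open>W \<notin> D\<close> by simp
      qed
    qed
    moreover have "\<forall>U\<in>insert W D. u U = 0"
      if u: "\<forall>U\<in>insert W D. u U \<in> U" and s: "(\<Sum>U\<in>insert W D. u U) = 0" for u
    proof -
      have sD: "(\<Sum>U\<in>D. u U) \<in> V'"
        using u unfolding V'_eq by blast
      have "u W = - (\<Sum>U\<in>D. u U)"
        using s fin \<open>W \<notin> D\<close> by (simp add: eq_neg_iff_add_eq_0)
      then have "u W \<in> V'"
        using cfun.subspace_neg[OF sub' sD] by simp
      then have "u W = 0"
        using disj u by blast
      moreover have "(\<Sum>U\<in>D. u U) = 0"
        using s fin \<open>W \<notin> D\<close> \<open>u W = 0\<close> by simp
      ultimately show ?thesis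
        using indep u by blast
    qed
    ultimately have "irreducible_decomposition k (fun_act \<alpha>) V (insert W D)"
      unfolding irreducible_decomposition_def using fin irrD irr by blast
    then show ?thesis ..
  qed
qed

section \<open>Specht modules\<close>

lemma young_diagram_eq: "young_diagram \<nu> = (SIGMA i:{..<length \<nu>}. {..<\<nu> ! i})"
  by (auto simp: young_diagram_def)

lemma finite_young_diagram [simp]: "finite (young_diagram \<nu>)"
  by (simp add: young_diagram_eq)

lemma card_young_diagram: "card (young_diagram \<nu>) = sum_list \<nu>"
  by (simp add: young_diagram_eq sum_list_sum_nth atLeast0LessThan)

lemma tableau_exists: "\<exists>t. is_tableau \<nu> t"
  unfolding is_tableau_def by (rule finite_same_card_bij) (simp_all add: card_young_diagram)

lemma is_tableauD:
  assumes "is_tableau \<nu> t"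
  shows "inj_on t (young_diagram \<nu>)" "t ` young_diagram \<nu> = {1..sum_list \<nu>}"
  using assms by (auto simp: is_tableau_def bij_betw_def)

lemma tabloid_cong:
  "(\<And>y. y \<in> young_diagram \<nu> \<Longrightarrow> t y = t' y) \<Longrightarrow> tabloid \<nu> t = tabloid \<nu> t'"
  unfolding tabloid_def by (intro ext Collect_cong) metis

lemma tabloid_act_tabloid: "tabloid_act g (tabloid \<nu> t) = tabloid \<nu> (g \<circ> t)"
  by (rule ext) (auto simp: tabloid_act_def tabloid_def)

lemma tabloid_act_compose: "tabloid_act g (tabloid_act h T) = tabloid_act (g \<circ> h) T"
  by (simp add: tabloid_act_def image_comp)

lemma tabloid_act_id [simp]: "tabloid_act id T = T"
  by (simp add: tabloid_act_def)

lemma tabloid_act_inv: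
  assumes "g permutes X"
  shows "tabloid_act (inv g) (tabloid_act g T) = T" "tabloid_act g (tabloid_act (inv g) T) = T"
  using permutes_inv_o[OF assms] by (simp_all add: tabloid_act_compose)

lemma tabloid_act_inv_eq_iff:
  assumes "g permutes X"
  shows "tabloid_act (inv g) T = T' \<longleftrightarrow> T = tabloid_act g T'"
  using tabloid_act_inv[OF assms] by metis

lemma is_tableau_compose:
  "g permutes {1..sum_list \<nu>} \<Longrightarrow> is_tableau \<nu> t \<Longrightarrow> is_tableau \<nu> (g \<circ> t)"
  unfolding is_tableau_def by (blast intro: bij_betw_trans permutes_imp_bij)

section \<open>Tabloids as words, column stabilizers as colour-preserving groups\<close>

definition tabloids :: "nat list \<Rightarrow> (nat \<Rightarrow> nat set) set"
  where "tabloids \<nu> = {tabloid \<nu> t | t. is_tableau \<nu> t}"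

lemma finite_tabloids [simp]: "finite (tabloids \<nu>)"
proof (rule finite_subset)
  show "tabloids \<nu> \<subseteq> tabloid \<nu> ` (young_diagram \<nu> \<rightarrow>\<^sub>E {1..sum_list \<nu>})"
  proof
    fix T assume "T \<in> tabloids \<nu>"
    then obtain t where t: "is_tableau \<nu> t" "T = tabloid \<nu> t"
      by (auto simp: tabloids_def)
    then have "T = tabloid \<nu> (restrict t (young_diagram \<nu>))"
      by (auto intro: tabloid_cong)
    moreover have "restrict t (young_diagram \<nu>) \<in> young_diagram \<nu> \<rightarrow>\<^sub>E {1..sum_list \<nu>}"
      using is_tableauD(2)[OF t(1)] by auto
    ultimately show "T \<in> tabloid \<nu> ` (young_diagram \<nu> \<rightarrow>\<^sub>E {1..sum_list \<nu>})"
      by blast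
  qed
qed (intro finite_imageI finite_PiE; simp)

lemma tabloid_act_in_tabloids:
  "g permutes {1..sum_list \<nu>} \<Longrightarrow> T \<in> tabloids \<nu> \<Longrightarrow> tabloid_act g T \<in> tabloids \<nu>"
  unfolding tabloids_def mem_Collect_eq using tabloid_act_tabloid is_tableau_compose by blast

text \<open>The rows of a tabloid are disjoint, so the description is unique for every entry; at
  other arguments the value is unspecified.\<close>

definition row_of :: "(nat \<Rightarrow> nat set) \<Rightarrow> nat \<Rightarrow> nat"
  where "row_of T x = (THE i. x \<in> T i)"

lemma row_of_tabloid:
  assumes "is_tableau \<nu> t" "(i, j) \<in> young_diagram \<nu>"
  shows "row_of (tabloid \<nu> t) (t (i, j)) = i"
  unfolding row_of_def
proof (rule the_equality)
  show "t (i, j) \<in> tabloid \<nu> t i"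
    using assms(2) by (auto simp: tabloid_def)
  fix i' assume "t (i, j) \<in> tabloid \<nu> t i'"
  then show "i' = i"
    using inj_onD[OF is_tableauD(1)[OF assms(1)]] assms(2) by (auto simp: tabloid_def)
qed

lemma row_of_tabloid_act:
  assumes "g permutes X"
  shows "row_of (tabloid_act g T) x = row_of T (inv g x)"
proof -
  have "x \<in> g ` A \<longleftrightarrow> inv g x \<in> A" for A
    using permutes_inverses[OF assms] by (metis image_iff)
  then show ?thesis
    by (simp add: row_of_def tabloid_act_def)
qed

lemma tabloid_row_eq:
  assumes "T \<in> tabloids \<nu>"
  shows "T i = {x \<in> {1..sum_list \<nu>}. row_of T x = i}"
proof -
  obtain t where t: "is_tableau \<nu> t" "T = tabloid \<nu> t"
    using assms by (auto simp: tabloids_def)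
  show ?thesis
    unfolding is_tableauD(2)[OF t(1), symmetric] t(2)
    by (auto simp: tabloid_def row_of_tabloid[OF t(1)])
qed

lemma tabloids_eqI:
  assumes "T \<in> tabloids \<nu>" "T' \<in> tabloids \<nu>"
    and "\<And>x. x \<in> {1..sum_list \<nu>} \<Longrightarrow> row_of T x = row_of T' x"
  shows "T = T'"
proof
  fix i show "T i = T' i"
    using tabloid_row_eq[OF assms(1), of i] tabloid_row_eq[OF assms(2), of i] assms(3) by auto
qed

definition column_of :: "nat list \<Rightarrow> (nat \<times> nat \<Rightarrow> nat) \<Rightarrow> nat \<Rightarrow> nat"
  where "column_of \<nu> t x = snd (inv_into (young_diagram \<nu>) t x)"

lemma column_of_tableau:
  assumes "is_tableau \<nu> t" "y \<in> young_diagram \<nu>"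
  shows "column_of \<nu> t (t y) = snd y"
  using assms is_tableauD(1) by (simp add: column_of_def)

text \<open>A column is a level set of \<open>column_of\<close>, so stabilizing each column as a set
  amounts to preserving column numbers. This brings column stabilizers under the lemmas on
  \<open>fperm\<close>.\<close>

lemma column_stabilizer_eq:
  assumes t: "is_tableau \<nu> t"
  shows "column_stabilizer \<nu> t = fperm {1..sum_list \<nu>} (column_of \<nu> t)"
proof -
  have col: "tableau_column \<nu> t j = {x \<in> {1..sum_list \<nu>}. column_of \<nu> t x = j}" for j
    unfolding is_tableauD(2)[OF t, symmetric]
    by (auto simp: tableau_column_def column_of_tableau[OF t])
  have "(\<forall>j. g ` tableau_column \<nu> t j = tableau_column \<nu> t j)
      \<longleftrightarrow> (\<forall>x\<in>{1..sum_list \<nu>}. column_of \<nu> t (g x) = column_of \<nu> t x)"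
    if g: "g permutes {1..sum_list \<nu>}" for g
  proof
    assume *: "\<forall>j. g ` tableau_column \<nu> t j = tableau_column \<nu> t j"
    show "\<forall>x\<in>{1..sum_list \<nu>}. column_of \<nu> t (g x) = column_of \<nu> t x"
    proof
      fix x assume "x \<in> {1..sum_list \<nu>}"
      then have "x \<in> tableau_column \<nu> t (column_of \<nu> t x)"
        by (simp add: col)
      then have "g x \<in> tableau_column \<nu> t (column_of \<nu> t x)"
        using * by blast
      then show "column_of \<nu> t (g x) = column_of \<nu> t x"
        by (simp add: col)
    qed
  next
    assume *: "\<forall>x\<in>{1..sum_list \<nu>}. column_of \<nu> t (g x) = column_of \<nu> t x"
    show "\<forall>j. g ` tableau_column \<nu> t j = tableau_column \<nu> t j"
    proof (intro allI endo_inj_surj)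
      fix j
      show "finite (tableau_column \<nu> t j)"
        by (simp add: col)
      show "g ` tableau_column \<nu> t j \<subseteq> tableau_column \<nu> t j"
      proof (rule image_subsetI)
        fix x assume "x \<in> tableau_column \<nu> t j"
        then show "g x \<in> tableau_column \<nu> t j"
          using * permutes_in_image[OF g, of x] unfolding col by blast
      qed
      show "inj_on g (tableau_column \<nu> t j)"
        using g by (rule permutes_inj_on)
    qed
  qed
  then show ?thesis
    by (auto simp: column_stabilizer_def fperm_def)
qed

lemma tableau_position_eqI:
  assumes t: "is_tableau \<nu> t" and "x \<in> {1..sum_list \<nu>}" "x' \<in> {1..sum_list \<nu>}"
    and "row_of (tabloid \<nu> t) x = row_of (tabloid \<nu> t) x'" "column_of \<nu> t x = column_of \<nu> t x'"
  shows "x = x'"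
proof -
  obtain y y' where y: "y \<in> young_diagram \<nu>" "x = t y" "y' \<in> young_diagram \<nu>" "x' = t y'"
    using assms(2,3) unfolding is_tableauD(2)[OF t, symmetric] by blast
  then have "fst y = fst y'"
    using assms(4) row_of_tabloid[OF t, of "fst y" "snd y"] row_of_tabloid[OF t, of "fst y'" "snd y'"] by simp
  moreover have "snd y = snd y'"
    using assms(5) y column_of_tableau[OF t] by simp
  ultimately have "y = y'"
    by (rule prod_eqI)
  then show ?thesis
    using y by simp
qed

text \<open>If both permutations give the same tabloid, then the two preimages of any
  \<open>x\<close> lie in the same row of \<open>t\<close>, and both stay in the column of
  \<open>x\<close>. A row and a column determine an entry.\<close>

lemma tabloid_act_column_free:
  assumes t: "is_tableau \<nu> t" and "\<sigma> \<in> column_stabilizer \<nu> t" "\<tau> \<in> column_stabilizer \<nu> t"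
    and eq: "tabloid_act \<sigma> (tabloid \<nu> t) = tabloid_act \<tau> (tabloid \<nu> t)"
  shows "\<sigma> = \<tau>"
proof -
  let ?X = "{1..sum_list \<nu>}"
  have \<sigma>: "\<sigma> \<in> fperm ?X (column_of \<nu> t)" and \<tau>: "\<tau> \<in> fperm ?X (column_of \<nu> t)"
    using assms column_stabilizer_eq[OF t] by auto
  note p\<sigma> = permutes_inv[OF fpermD(1)[OF \<sigma>]] and p\<tau> = permutes_inv[OF fpermD(1)[OF \<tau>]]
  have "inv \<sigma> x = inv \<tau> x" for x
  proof (cases "x \<in> ?X")
    case True
    have "row_of (tabloid_act \<sigma> (tabloid \<nu> t)) x = row_of (tabloid_act \<tau> (tabloid \<nu> t)) x"
      using eq by simp
    then have row: "row_of (tabloid \<nu> t) (inv \<sigma> x) = row_of (tabloid \<nu> t) (inv \<tau> x)"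
      by (simp only: row_of_tabloid_act[OF fpermD(1)[OF \<sigma>]] row_of_tabloid_act[OF fpermD(1)[OF \<tau>]])
    have col: "column_of \<nu> t (inv \<sigma> x) = column_of \<nu> t (inv \<tau> x)"
      using fpermD(2)[OF fperm_inv[OF \<sigma>] True] fpermD(2)[OF fperm_inv[OF \<tau>] True] by simp
    have mem: "inv \<sigma> x \<in> ?X" "inv \<tau> x \<in> ?X"
      using True permutes_in_image[OF p\<sigma>] permutes_in_image[OF p\<tau>] by blast+
    show ?thesis
      by (rule tableau_position_eqI[OF t mem row col])
  next
    case False
    then show ?thesis
      using permutes_not_in[OF p\<sigma>] permutes_not_in[OF p\<tau>] by simp
  qed
  then have "inv \<sigma> = inv \<tau>" ..
  then show ?thesis
    using permutes_inv_inv[OF fpermD(1)[OF \<sigma>]] permutes_inv_inv[OF fpermD(1)[OF \<tau>]] by metis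
qed

section \<open>James's submodule theorem\<close>

lemma card_rows_less:
  assumes "is_tableau \<nu> t"
  shows "card {x \<in> {1..sum_list \<nu>}. row_of (tabloid \<nu> t) x < i} = card {y \<in> young_diagram \<nu>. fst y < i}"
proof -
  have "{x \<in> {1..sum_list \<nu>}. row_of (tabloid \<nu> t) x < i} = t ` {y \<in> young_diagram \<nu>. fst y < i}"
    unfolding is_tableauD(2)[OF assms, symmetric] by (auto simp: row_of_tabloid[OF assms])
  moreover have "inj_on t {y \<in> young_diagram \<nu>. fst y < i}"
    using is_tableauD(1)[OF assms] by (rule inj_on_subset) auto
  ultimately show ?thesis
    by (simp add: card_image)
qed

text \<open>If no two entries of a column of \<open>t\<close> share a row of \<open>T\<close>, then column \<open>j\<close> of \<open>t\<close> has at most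
  \<open>min i c\<close> entries in the first \<open>i\<close> rows of \<open>T\<close>, where \<open>c\<close> is its length.  These bounds add up to the
  number of all entries there, so each is attained, and \<open>i = c\<close> gives the claim.\<close>

lemma row_less_column_length:
  assumes sorted: "sorted_wrt (\<ge>) \<nu>" and t: "is_tableau \<nu> t" and T: "T \<in> tabloids \<nu>"
    and inj: "\<And>x y. x \<in> {1..sum_list \<nu>} \<Longrightarrow> y \<in> {1..sum_list \<nu>} \<Longrightarrow> column_of \<nu> t x = column_of \<nu> t y
      \<Longrightarrow> row_of T x = row_of T y \<Longrightarrow> x = y"
    and x: "x \<in> {1..sum_list \<nu>}"
  shows "(row_of T x, column_of \<nu> t x) \<in> young_diagram \<nu>"
proof -
  let ?X = "{1..sum_list \<nu>}" and ?Y = "young_diagram \<nu>"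
  define len where "len j = card {i. (i, j) \<in> ?Y}" for j
  \<comment> \<open>As \<open>\<nu>\<close> is weakly decreasing, every column of the diagram is an
    initial segment of the rows.\<close>
  have initial: "(i', j) \<in> ?Y" if "(i, j) \<in> ?Y" "i' \<le> i" for i i' j
  proof -
    have "\<nu> ! i \<le> \<nu> ! i'"
      using that sorted by (cases "i' = i") (auto simp: young_diagram_def sorted_wrt_iff_nth_less)
    with that show ?thesis
      by (auto simp: young_diagram_def)
  qed
  have finc: "finite {i. (i, j) \<in> ?Y}" for j
    by (rule finite_subset[of _ "{..<length \<nu>}"]) (auto simp: young_diagram_def)
  have col: "(i, j) \<in> ?Y \<longleftrightarrow> i < len j" for i j
  proof
    assume "(i, j) \<in> ?Y"
    then have "card {..i} \<le> len j"
      unfolding len_def by (intro card_mono finc) (auto intro: initial)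
    then show "i < len j"
      by simp
  next
    assume "i < len j"
    show "(i, j) \<in> ?Y"
    proof (rule ccontr)
      assume "(i, j) \<notin> ?Y"
      then have "{i. (i, j) \<in> ?Y} \<subseteq> {..<i}"
        using initial by (auto simp: not_less[symmetric])
      then have "len j \<le> card {..<i}"
        unfolding len_def by (intro card_mono) auto
      with \<open>i < len j\<close> show False by simp
    qed
  qed
  define c where "c = column_of \<nu> t"
  have cimg: "c ` ?X = snd ` ?Y"
    unfolding is_tableauD(2)[OF t, symmetric] image_image c_def
    by (intro image_cong refl) (simp add: column_of_tableau[OF t])
  define J where "J = snd ` ?Y"
  have finJ: "finite J"
    by (simp add: J_def)
  \<comment> \<open>The comparison is made at the length of the column of \<open>x\<close>, where
    the bound for this column equals its full number of entries.\<close>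
  define l where "l = len (c x)"
  let ?A = "\<lambda>j. {x \<in> ?X. c x = j \<and> row_of T x < l}"
  let ?B = "\<lambda>j. {y \<in> ?Y. snd y = j \<and> fst y < l}"
  have cardB: "card (?B j) = min l (len j)" for j
  proof -
    have "?B j = (\<lambda>i. (i, j)) ` {..<min l (len j)}"
      by (auto simp: col)
    then show ?thesis
      by (simp add: card_image inj_on_def)
  qed
  have cardcol: "card {x \<in> ?X. c x = j} = len j" for j
  proof -
    have "{x \<in> ?X. c x = j} = (\<lambda>i. t (i, j)) ` {..<len j}"
      unfolding is_tableauD(2)[OF t, symmetric] c_def
      by (auto simp: column_of_tableau[OF t] col image_iff)
    moreover have "inj_on (\<lambda>i. t (i, j)) {..<len j}"
      by (rule inj_onI) (use inj_onD[OF is_tableauD(1)[OF t]] in \<open>auto simp: col[symmetric]\<close>)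
    ultimately show ?thesis
      by (simp add: card_image)
  qed
  have le: "card (?A j) \<le> card (?B j)" for j
  proof -
    have "inj_on (row_of T) (?A j)"
      by (rule inj_onI) (auto intro: inj simp: c_def)
    then have "card (?A j) = card (row_of T ` ?A j)"
      by (simp add: card_image)
    also have "\<dots> \<le> card {..<l}"
      by (intro card_mono) auto
    finally have "card (?A j) \<le> l" by simp
    moreover have "card (?A j) \<le> len j"
      unfolding cardcol[symmetric] by (intro card_mono) auto
    ultimately show ?thesis
      by (simp add: cardB)
  qed
  obtain u where u: "is_tableau \<nu> u" "T = tabloid \<nu> u"
    using T by (auto simp: tabloids_def)
  \<comment> \<open>The number of entries in the first \<open>l\<close> rows depends only on the
    shape, so it is the same for \<open>T\<close> and for the diagram. Equality of the sums then
    forces equality in each of the bounds \<open>le\<close>.\<close>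
  have "(\<Sum>j\<in>J. card (?A j)) = card (\<Union>j\<in>J. ?A j)"
    using finJ by (intro card_UN_disjoint[symmetric]) auto
  also have "(\<Union>j\<in>J. ?A j) = {x \<in> ?X. row_of T x < l}"
    using cimg by (auto simp: J_def)
  also have "card \<dots> = card {y \<in> ?Y. fst y < l}"
    unfolding u(2) by (rule card_rows_less[OF u(1)])
  also have "{y \<in> ?Y. fst y < l} = (\<Union>j\<in>J. ?B j)"
    by (auto simp: J_def)
  also have "card \<dots> = (\<Sum>j\<in>J. card (?B j))"
    using finJ by (intro card_UN_disjoint) auto
  finally have sum_eq: "(\<Sum>j\<in>J. card (?A j)) = (\<Sum>j\<in>J. card (?B j))" .
  have "c x \<in> J"
    using x cimg by (auto simp: J_def)
  then have "card (?A (c x)) = card (?B (c x))"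
    using sum_mono_inv[OF sum_eq le _ finJ] by blast
  then have "card (?A (c x)) = card {x' \<in> ?X. c x' = c x}"
    unfolding cardB cardcol by (simp add: l_def)
  then have "?A (c x) = {x' \<in> ?X. c x' = c x}"
    by (intro card_subset_eq) auto
  then have "row_of T x < l"
    using x by blast
  then show ?thesis
    by (simp add: col l_def c_def)
qed


text \<open>If two entries of one column of \<open>t\<close> share a row of \<open>T\<close>, their
  transposition fixes \<open>T\<close> but changes the sign, so the sum vanishes. Otherwise a column
  permutation carries \<open>T\<close> to the tabloid of \<open>t\<close>, which changes the sum
  only by a sign.\<close>

lemma antisymmetrized_tabloid:
  assumes sorted: "sorted_wrt (\<ge>) \<nu>" and t: "is_tableau \<nu> t" and T: "T \<in> tabloids \<nu>"
  shows "\<exists>c. \<forall>X. (\<Sum>\<sigma>\<in>column_stabilizer \<nu> t. of_int (sign \<sigma>) * (if X = tabloid_act \<sigma> T then 1 else 0))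
    = c * polytabloid \<nu> t X"
proof -
  let ?X = "{1..sum_list \<nu>}" and ?c = "column_of \<nu> t"
  let ?F = "\<lambda>T X \<sigma>. of_int (sign \<sigma>) * (if X = tabloid_act \<sigma> T then 1 else 0) :: complex"
  note C = column_stabilizer_eq[OF t]
  have shift: "(\<Sum>\<sigma>\<in>fperm ?X ?c. ?F (tabloid_act \<tau> T') X \<sigma>)
      = of_int (sign \<tau>) * (\<Sum>\<sigma>\<in>fperm ?X ?c. ?F T' X \<sigma>)" if \<tau>: "\<tau> \<in> fperm ?X ?c" for \<tau> T' X
  proof -
    have "(\<Sum>\<sigma>\<in>fperm ?X ?c. ?F (tabloid_act \<tau> T') X \<sigma>)
      = (\<Sum>\<sigma>\<in>fperm ?X ?c. of_int (sign \<tau>) * ?F T' X (\<sigma> \<circ> \<tau>))"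
    proof (intro sum.cong refl)
      fix \<sigma> assume \<sigma>: "\<sigma> \<in> fperm ?X ?c"
      have "sign \<tau> * sign (\<sigma> \<circ> \<tau>) = sign \<sigma>"
        unfolding sign_fperm_compose[OF finite_atLeastAtMost \<sigma> \<tau>] by simp
      then have "of_int (sign \<tau>) * (of_int (sign (\<sigma> \<circ> \<tau>)) :: complex) = of_int (sign \<sigma>)"
        by (metis of_int_mult)
      then show "?F (tabloid_act \<tau> T') X \<sigma> = of_int (sign \<tau>) * ?F T' X (\<sigma> \<circ> \<tau>)"
        by (simp add: tabloid_act_compose flip: mult.assoc)
    qed
    also have "\<dots> = of_int (sign \<tau>) * (\<Sum>\<sigma>\<in>fperm ?X ?c. ?F T' X \<sigma>)"
      unfolding sum_distrib_left[symmetric] by (subst sum_fperm_compose_right[OF \<tau>]) (rule refl)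
    finally show ?thesis .
  qed
  show ?thesis
  proof (cases "\<exists>x\<in>?X. \<exists>y\<in>?X. x \<noteq> y \<and> ?c x = ?c y \<and> row_of T x = row_of T y")
    case True
    then obtain x y where xy: "x \<in> ?X" "y \<in> ?X" "x \<noteq> y" "?c x = ?c y" "row_of T x = row_of T y"
      by blast
    let ?\<tau> = "transpose x y"
    have p: "?\<tau> permutes ?X"
      using xy by (intro permutes_swap_id)
    have \<tau>: "?\<tau> \<in> fperm ?X ?c"
      using p xy by (auto simp: fperm_def transpose_def)
    have "tabloid_act ?\<tau> T = T"
    proof (rule tabloids_eqI[OF tabloid_act_in_tabloids[OF p T] T])
      fix z show "row_of (tabloid_act ?\<tau> T) z = row_of T z"
        using xy(5) by (auto simp: row_of_tabloid_act[OF p] transpose_def)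
    qed
    then have neg: "(\<Sum>\<sigma>\<in>fperm ?X ?c. ?F T X \<sigma>) = - (\<Sum>\<sigma>\<in>fperm ?X ?c. ?F T X \<sigma>)" for X
      using shift[OF \<tau>, where T' = T and X = X] xy(3) by (simp add: sign_swap_id)
    have "(\<Sum>\<sigma>\<in>fperm ?X ?c. ?F T X \<sigma>) = 0" for X
    proof -
      have "2 * (\<Sum>\<sigma>\<in>fperm ?X ?c. ?F T X \<sigma>) = 0"
        using eq_neg_iff_add_eq_0[THEN iffD1, OF neg[of X]] by (simp only: mult_2)
      then show ?thesis
        by (simp only: mult_eq_0_iff) simp
    qed
    then show ?thesis
      unfolding C by (intro exI[of _ 0]) simp
  next
    case False
    then have inj: "x = y" if "x \<in> ?X" "y \<in> ?X" "?c x = ?c y" "row_of T x = row_of T y" for x y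
      using that by blast
    have pos: "(row_of T x, ?c x) \<in> young_diagram \<nu>" if "x \<in> ?X" for x
      using row_less_column_length[OF sorted t T inj that] .
    \<comment> \<open>\<open>\<tau>\<close> moves \<open>x\<close> along its column of
      \<open>t\<close> to the row that contains it in \<open>T\<close>; by \<open>pos\<close> this
      place lies in the diagram.\<close>
    define \<tau> where "\<tau> x = (if x \<in> ?X then t (row_of T x, ?c x) else x)" for x
    have \<tau>_mem: "\<tau> x \<in> ?X" if "x \<in> ?X" for x
      unfolding \<tau>_def is_tableauD(2)[OF t, symmetric] using pos[OF that] that is_tableauD(2)[OF t] by auto
    have \<tau>_c: "?c (\<tau> x) = ?c x" and \<tau>_r: "row_of (tabloid \<nu> t) (\<tau> x) = row_of T x" if "x \<in> ?X" for x
      using that column_of_tableau[OF t pos[OF that]] row_of_tabloid[OF t pos[OF that]]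
      by (simp_all add: \<tau>_def)
    have p: "\<tau> permutes ?X"
    proof (rule inj_imp_permutes)
      show "inj_on \<tau> ?X"
      proof (rule inj_onI)
        fix x y assume *: "x \<in> ?X" "y \<in> ?X" "\<tau> x = \<tau> y"
        then show "x = y"
          using inj[OF *(1,2)] \<tau>_c[OF *(1)] \<tau>_c[OF *(2)] \<tau>_r[OF *(1)] \<tau>_r[OF *(2)] by simp
      qed
      show "\<tau> x = x" if "x \<notin> ?X" for x
        using that by (simp only: \<tau>_def if_False)
    qed (use \<tau>_mem in simp_all)
    have \<tau>: "\<tau> \<in> fperm ?X ?c"
      using p \<tau>_c by (simp add: fperm_def)
    have tt: "tabloid \<nu> t \<in> tabloids \<nu>"
      using t by (auto simp: tabloids_def)
    have "tabloid_act \<tau> T = tabloid \<nu> t"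
    proof (rule tabloids_eqI[OF tabloid_act_in_tabloids[OF p T] tt])
      fix x assume "x \<in> ?X"
      then have "inv \<tau> x \<in> ?X"
        using permutes_in_image[OF permutes_inv[OF p]] by blast
      then show "row_of (tabloid_act \<tau> T) x = row_of (tabloid \<nu> t) x"
        using \<tau>_r[OF \<open>inv \<tau> x \<in> ?X\<close>] unfolding row_of_tabloid_act[OF p] permutes_inverses(1)[OF p] by simp
    qed
    then have "T = tabloid_act (inv \<tau>) (tabloid \<nu> t)"
      using tabloid_act_inv(1)[OF p] by metis
    then show ?thesis
      using shift[OF fperm_inv[OF \<tau>]] unfolding polytabloid_def C by blast
  qed
qed

text \<open>The main step of James's submodule theorem: the column antisymmetrization of \<open>u\<close> is a multiple of
  the polytabloid, and its coefficient is the pairing of \<open>u\<close> with the polytabloid.\<close>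

lemma polytabloid_in_submodule:
  assumes sorted: "sorted_wrt (\<ge>) \<nu>" and t: "is_tableau \<nu> t"
    and U: "submodule (sum_list \<nu>) (fun_act tabloid_act) U" "U \<subseteq> supported_on (tabloids \<nu>)"
    and u: "u \<in> U" "(\<Sum>\<sigma>\<in>column_stabilizer \<nu> t. of_int (sign \<sigma>) * u (tabloid_act \<sigma> (tabloid \<nu> t))) \<noteq> 0"
  shows "polytabloid \<nu> t \<in> U"
proof -
  let ?X = "{1..sum_list \<nu>}" and ?C = "column_stabilizer \<nu> t"
  note C = column_stabilizer_eq[OF t]
  have subU: "cfun_subspace U"
    using U(1) by (simp add: submodule_def)
  have perm: "\<sigma> permutes ?X" if "\<sigma> \<in> ?C" for \<sigma>
    using that C fpermD(1) by blast
  define \<kappa> where "\<kappa> = (\<Sum>\<sigma>\<in>?C. (\<lambda>X. of_int (sign \<sigma>) * fun_act tabloid_act \<sigma> u X))"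
  have \<kappa>: "\<kappa> \<in> U"
    unfolding \<kappa>_def
  proof (intro cfun.subspace_sum[OF subU] cfun.subspace_scale[OF subU])
    fix \<sigma> assume "\<sigma> \<in> ?C"
    then show "fun_act tabloid_act \<sigma> u \<in> U"
      using U(1) u(1) perm unfolding submodule_def by blast
  qed
  have "\<forall>T\<in>tabloids \<nu>. \<exists>c. \<forall>X. (\<Sum>\<sigma>\<in>?C. of_int (sign \<sigma>) * (if X = tabloid_act \<sigma> T then 1 else 0)) = c * polytabloid \<nu> t X"
    using antisymmetrized_tabloid[OF sorted t] by blast
  from bchoice[OF this] obtain c where
    c: "\<And>T X. T \<in> tabloids \<nu> \<Longrightarrow> (\<Sum>\<sigma>\<in>?C. of_int (sign \<sigma>) * (if X = tabloid_act \<sigma> T then 1 else 0)) = c T * polytabloid \<nu> t X"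
    by blast
  define a where "a = (\<Sum>T\<in>tabloids \<nu>. u T * c T)"
  \<comment> \<open>Written as a combination of indicator functions of tabloids, \<open>u\<close>
    can be antisymmetrized term by term.\<close>
  have expand: "u Y = (\<Sum>T\<in>tabloids \<nu>. u T * (if Y = T then 1 else 0))" for Y
  proof (cases "Y \<in> tabloids \<nu>")
    case False
    then have "u Y = 0"
      using u(1) U(2) by (auto simp: supported_on_def)
    moreover have "(\<Sum>T\<in>tabloids \<nu>. u T * (if Y = T then 1 else 0)) = 0"
      using False by (intro sum.neutral) auto
    ultimately show ?thesis
      by simp
  qed (simp add: if_distrib cong: if_cong)
  have \<kappa>_eq: "\<kappa> X = a * polytabloid \<nu> t X" for X
  proof -
    have "\<kappa> X = (\<Sum>\<sigma>\<in>?C. of_int (sign \<sigma>) * (\<Sum>T\<in>tabloids \<nu>. u T * (if X = tabloid_act \<sigma> T then 1 else 0)))"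
      unfolding \<kappa>_def sum_fun_apply fun_act_def
      by (intro sum.cong refl arg_cong2[where f = "(*)"]) (subst expand, simp add: tabloid_act_inv_eq_iff[OF perm])
    also have "\<dots> = (\<Sum>T\<in>tabloids \<nu>. u T * (\<Sum>\<sigma>\<in>?C. of_int (sign \<sigma>) * (if X = tabloid_act \<sigma> T then 1 else 0)))"
      unfolding sum_distrib_left by (subst sum.swap) (simp only: mult.left_commute)
    also have "\<dots> = a * polytabloid \<nu> t X"
      by (simp add: c a_def sum_distrib_right mult.assoc)
    finally show ?thesis .
  qed
  \<comment> \<open>The value of \<open>\<kappa>\<close> at the tabloid of \<open>t\<close> is the
    pairing, which is nonzero by assumption; so the factor \<open>a\<close> cannot be 0.\<close>
  have "\<kappa> (tabloid \<nu> t) = (\<Sum>\<sigma>\<in>?C. of_int (sign (inv \<sigma>)) * u (tabloid_act (inv \<sigma>) (tabloid \<nu> t)))"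
    unfolding \<kappa>_def sum_fun_apply fun_act_def
    by (intro sum.cong refl) (simp add: sign_inverse[OF permutes_imp_permutation[OF finite_atLeastAtMost perm]])
  also have "\<dots> = (\<Sum>\<sigma>\<in>?C. of_int (sign \<sigma>) * u (tabloid_act \<sigma> (tabloid \<nu> t)))"
    unfolding C by (rule sum_fperm_inv) simp
  finally have "a \<noteq> 0"
    using u(2) \<kappa>_eq by auto
  then have "polytabloid \<nu> t = (\<lambda>X. (1 / a) * \<kappa> X)"
    by (simp add: fun_eq_iff \<kappa>_eq)
  then show ?thesis
    using cfun.subspace_scale[OF subU \<kappa>, of "1 / a"] by simp
qed

section \<open>The Specht module as the submodule generated by one polytabloid\<close>

lemma polytabloid_cong:
  assumes "\<And>y. y \<in> young_diagram \<nu> \<Longrightarrow> t y = t' y"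
  shows "polytabloid \<nu> t = polytabloid \<nu> t'"
proof -
  have "tableau_column \<nu> t = tableau_column \<nu> t'"
    unfolding tableau_column_def using assms by (intro ext Collect_cong) metis
  then show ?thesis
    unfolding polytabloid_def column_stabilizer_def using tabloid_cong[of \<nu> t t'] assms by simp
qed

text \<open>The column stabilizer of \<open>g \<circ> t\<close> is the conjugate by \<open>g\<close>
  of that of \<open>t\<close>, and conjugation keeps signs.\<close>

lemma fun_act_polytabloid:
  assumes g: "g permutes {1..sum_list \<nu>}" and t: "is_tableau \<nu> t"
  shows "fun_act tabloid_act g (polytabloid \<nu> t) = polytabloid \<nu> (g \<circ> t)"
proof
  let ?X = "{1..sum_list \<nu>}" and ?m = "map_permutation {1..sum_list \<nu>} g"
  note t' = is_tableau_compose[OF g t]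
  have gt: "column_of \<nu> (g \<circ> t) (g x) = column_of \<nu> t x" if x: "x \<in> ?X" for x
  proof -
    obtain y where "y \<in> young_diagram \<nu>" "x = t y"
      using x is_tableauD(2)[OF t] by blast
    then show ?thesis
      using column_of_tableau[OF t, of y] column_of_tableau[OF t', of y] by simp
  qed
  fix T
  have inj: "inj_on g ?X"
    using g by (rule permutes_inj_on)
  have "polytabloid \<nu> (g \<circ> t) T = (\<Sum>\<sigma>\<in>fperm ?X (column_of \<nu> t). of_int (sign (?m \<sigma>))
      * (if T = tabloid_act (?m \<sigma>) (tabloid \<nu> (g \<circ> t)) then 1 else 0))"
    unfolding polytabloid_def column_stabilizer_eq[OF t']
    by (rule sum_fperm_transport[OF permutes_imp_bij[OF g]]) (simp add: gt)
  also have "\<dots> = (\<Sum>\<sigma>\<in>fperm ?X (column_of \<nu> t). of_int (sign \<sigma>)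
      * (if tabloid_act (inv g) T = tabloid_act \<sigma> (tabloid \<nu> t) then 1 else 0))"
  proof (intro sum.cong refl arg_cong2[where f = "(*)"] arg_cong[where f = of_int] if_cong)
    fix \<sigma> assume "\<sigma> \<in> fperm ?X (column_of \<nu> t)"
    then have \<sigma>: "\<sigma> permutes ?X"
      by (rule fpermD)
    show "sign (?m \<sigma>) = sign \<sigma>"
      by (rule sign_map_permutation[OF inj \<sigma>]) simp
    have "tabloid_act (?m \<sigma>) (tabloid \<nu> (g \<circ> t)) = tabloid_act g (tabloid_act \<sigma> (tabloid \<nu> t))"
      unfolding tabloid_act_tabloid
    proof (rule tabloid_cong)
      fix y assume "y \<in> young_diagram \<nu>"
      then have "t y \<in> ?X"
        using is_tableauD(2)[OF t] by blast
      then show "(?m \<sigma> \<circ> (g \<circ> t)) y = (g \<circ> (\<sigma> \<circ> t)) y"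
        by (simp only: comp_apply map_permutation_apply[OF inj])
    qed
    then show "T = tabloid_act (?m \<sigma>) (tabloid \<nu> (g \<circ> t)) \<longleftrightarrow> tabloid_act (inv g) T = tabloid_act \<sigma> (tabloid \<nu> t)"
      by (simp add: tabloid_act_inv_eq_iff[OF g])
  qed
  also have "\<dots> = fun_act tabloid_act g (polytabloid \<nu> t) T"
    by (simp add: fun_act_def polytabloid_def column_stabilizer_eq[OF t])
  finally show "fun_act tabloid_act g (polytabloid \<nu> t) T = polytabloid \<nu> (g \<circ> t) T" ..
qed

text \<open>The symmetric group acts transitively on the fillings of the diagram, so the
  polytabloids are all translates of one.\<close>

lemma specht_subset_submodule:
  assumes t: "is_tableau \<nu> t" and U: "submodule (sum_list \<nu>) (fun_act tabloid_act) U" "polytabloid \<nu> t \<in> U"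
  shows "specht \<nu> \<subseteq> U"
  unfolding specht_def
proof (rule cfun.span_minimal)
  show "cfun_subspace U"
    using U by (simp add: submodule_def)
  show "{polytabloid \<nu> t | t. is_tableau \<nu> t} \<subseteq> U"
  proof clarify
    fix t' assume t': "is_tableau \<nu> t'"
    let ?X = "{1..sum_list \<nu>}" and ?Y = "young_diagram \<nu>"
    \<comment> \<open>\<open>g\<close> carries the entry of \<open>t\<close> in each box to the
      entry of \<open>t'\<close> there. Outside the diagram \<open>g \<circ> t\<close> and
      \<open>t'\<close> may differ, hence \<open>polytabloid_cong\<close>.\<close>
    define g where "g x = (if x \<in> ?X then t' (inv_into ?Y t x) else x)" for x
    have "bij_betw (t' \<circ> inv_into ?Y t) ?X ?X"
      using t t' unfolding is_tableau_def by (blast intro: bij_betw_trans bij_betw_inv_into)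
    then have "bij_betw g ?X ?X"
      by (rule bij_betw_cong[THEN iffD1, rotated]) (simp add: g_def)
    then have g: "g permutes ?X"
      by (rule bij_imp_permutes) (auto simp: g_def)
    have "polytabloid \<nu> t' = polytabloid \<nu> (g \<circ> t)"
    proof (rule polytabloid_cong)
      fix y assume y: "y \<in> ?Y"
      then have "t y \<in> ?X"
        using is_tableauD(2)[OF t] by blast
      then show "t' y = (g \<circ> t) y"
        using inv_into_f_f[OF is_tableauD(1)[OF t] y] by (simp add: g_def)
    qed
    also have "\<dots> = fun_act tabloid_act g (polytabloid \<nu> t)"
      by (rule fun_act_polytabloid[OF g t, symmetric])
    also have "\<dots> \<in> U"
      using U g unfolding submodule_def by blast
    finally show "polytabloid \<nu> t' \<in> U" .
  qed
qed

lemma fun_act_linear: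
  "fun_act \<alpha> g (f + h) = fun_act \<alpha> g f + fun_act \<alpha> g h"
  "fun_act \<alpha> g (\<lambda>x. c * f x) = (\<lambda>x. c * fun_act \<alpha> g f x)"
  "fun_act \<alpha> g 0 = 0"
  by (simp_all add: fun_act_def fun_eq_iff)

lemma fun_act_span:
  assumes "u \<in> cfun_span B" "\<And>b. b \<in> B \<Longrightarrow> fun_act \<alpha> g b \<in> cfun_span B"
  shows "fun_act \<alpha> g u \<in> cfun_span B"
  using assms(1)
proof (induction rule: cfun.span_induct_alt)
  case base
  show ?case
    unfolding fun_act_linear by (rule cfun.span_zero)
next
  case (step c b y)
  then show ?case
    unfolding fun_act_linear using assms(2) by (blast intro: cfun.span_add cfun.span_scale)
qed

lemma submodule_specht: "submodule (sum_list \<nu>) (fun_act tabloid_act) (specht \<nu>)"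
  unfolding submodule_def specht_def
proof (intro conjI allI impI ballI)
  show "cfun_subspace (cfun_span {polytabloid \<nu> t | t. is_tableau \<nu> t})"
    by (rule cfun.subspace_span)
  fix g u assume g: "g permutes {1..sum_list \<nu>}" and "u \<in> cfun_span {polytabloid \<nu> t | t. is_tableau \<nu> t}"
  then show "fun_act tabloid_act g u \<in> cfun_span {polytabloid \<nu> t | t. is_tableau \<nu> t}"
    by (elim fun_act_span) (use g in \<open>auto simp: fun_act_polytabloid intro!: cfun.span_base is_tableau_compose\<close>)
qed

lemma subspace_supported_on: "cfun_subspace (supported_on X)"
  by (auto simp: cfun.subspace_def supported_on_def)

lemma specht_supported_on: "specht \<nu> \<subseteq> supported_on (tabloids \<nu>)"
  unfolding specht_def
proof (rule cfun.span_minimal[OF _ subspace_supported_on], clarify)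
  fix t assume t: "is_tableau \<nu> t"
  have "polytabloid \<nu> t T = 0" if "T \<notin> tabloids \<nu>" for T
    unfolding polytabloid_def
  proof (rule sum.neutral, rule ballI)
    fix \<sigma> assume "\<sigma> \<in> column_stabilizer \<nu> t"
    then have "tabloid_act \<sigma> (tabloid \<nu> t) \<in> tabloids \<nu>"
      using t by (intro tabloid_act_in_tabloids) (auto simp: column_stabilizer_def tabloids_def)
    with that show "of_int (sign \<sigma>) * (if T = tabloid_act \<sigma> (tabloid \<nu> t) then 1 else 0) = (0::complex)"
      by auto
  qed
  then show "polytabloid \<nu> t \<in> supported_on (tabloids \<nu>)"
    by (simp add: supported_on_def)
qed

lemma symmetric_square_supported_on:
  assumes "V \<subseteq> supported_on X"
  shows "symmetric_square V \<subseteq> supported_on (X \<times> X)"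
proof -
  have "tensor_square V \<subseteq> supported_on (X \<times> X)"
    unfolding tensor_square_def
    by (rule cfun.span_minimal[OF _ subspace_supported_on]) (use assms in \<open>auto simp: supported_on_def\<close>)
  then show ?thesis
    by (auto simp: symmetric_square_def)
qed

lemma submodule_symmetric_square:
  assumes V: "submodule k (fun_act \<alpha>) V"
  shows "submodule k (fun_act (pair_act \<alpha>)) (symmetric_square V)"
  unfolding submodule_def
proof (intro conjI allI impI ballI)
  have "cfun_subspace (tensor_square V)"
    unfolding tensor_square_def by (rule cfun.subspace_span)
  then show "cfun_subspace (symmetric_square V)"
    by (auto simp: cfun.subspace_def symmetric_square_def)
  fix g u assume g: "g permutes {1..k}" and u: "u \<in> symmetric_square V"
  have "fun_act (pair_act \<alpha>) g u \<in> tensor_square V"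
    unfolding tensor_square_def
  proof (rule fun_act_span)
    show "u \<in> cfun_span {\<lambda>(x, y). f x * h y | f h. f \<in> V \<and> h \<in> V}"
      using u by (simp add: symmetric_square_def tensor_square_def)
    fix b assume "b \<in> {\<lambda>(x, y). f x * h y | f h. f \<in> V \<and> h \<in> V}"
    then obtain f h where b: "b = (\<lambda>(x, y). f x * h y)" "f \<in> V" "h \<in> V"
      by blast
    have "fun_act (pair_act \<alpha>) g b = (\<lambda>(x, y). fun_act \<alpha> g f x * fun_act \<alpha> g h y)"
      by (auto simp: b(1) fun_act_def pair_act_def)
    moreover have "fun_act \<alpha> g f \<in> V" "fun_act \<alpha> g h \<in> V"
      using V g b unfolding submodule_def by blast+
    ultimately show "fun_act (pair_act \<alpha>) g b \<in> cfun_span {\<lambda>(x, y). f x * h y | f h. f \<in> V \<and> h \<in> V}"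
      by (intro cfun.span_base) blast
  qed
  then show "fun_act (pair_act \<alpha>) g u \<in> symmetric_square V"
    using u by (simp add: symmetric_square_def fun_act_def pair_act_def)
qed

section \<open>The symmetric square of a rectangular Specht module\<close>

text \<open>Distinct column permutations give distinct tabloids, so the coefficients of a
  polytabloid are 0 or a sign, and squaring removes the sign. The result is the indicator function
  of an orbit of the column stabilizer.\<close>

lemma polytabloid_square:
  assumes t: "is_tableau \<nu> t"
  shows "polytabloid \<nu> t T * polytabloid \<nu> t T
    = (\<Sum>\<sigma>\<in>column_stabilizer \<nu> t. if T = tabloid_act \<sigma> (tabloid \<nu> t) then 1 else 0)"
proof (cases "\<exists>\<sigma>\<in>column_stabilizer \<nu> t. T = tabloid_act \<sigma> (tabloid \<nu> t)")
  case True
  then obtain \<tau> where \<tau>: "\<tau> \<in> column_stabilizer \<nu> t" "T = tabloid_act \<tau> (tabloid \<nu> t)"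
    by blast
  have fin: "finite (column_stabilizer \<nu> t)"
    by (simp add: column_stabilizer_eq[OF t])
  have iff: "T = tabloid_act \<sigma> (tabloid \<nu> t) \<longleftrightarrow> \<sigma> = \<tau>" if "\<sigma> \<in> column_stabilizer \<nu> t" for \<sigma>
  proof
    assume "T = tabloid_act \<sigma> (tabloid \<nu> t)"
    with \<tau>(2) show "\<sigma> = \<tau>"
      by (intro tabloid_act_column_free[OF t that \<tau>(1)]) simp
  qed (use \<tau>(2) in simp)
  have "polytabloid \<nu> t T = (\<Sum>\<sigma>\<in>column_stabilizer \<nu> t. if \<sigma> = \<tau> then of_int (sign \<tau>) else 0)"
    unfolding polytabloid_def by (intro sum.cong refl) (simp add: iff)
  also have "\<dots> = of_int (sign \<tau>)"
    using fin \<tau>(1) by simp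
  finally have "polytabloid \<nu> t T * polytabloid \<nu> t T = of_int (sign \<tau> * sign \<tau>)"
    by (simp only: of_int_mult)
  moreover have "(\<Sum>\<sigma>\<in>column_stabilizer \<nu> t. if T = tabloid_act \<sigma> (tabloid \<nu> t) then 1 else 0)
      = (\<Sum>\<sigma>\<in>column_stabilizer \<nu> t. if \<sigma> = \<tau> then 1 else (0::complex))"
    by (intro sum.cong refl) (simp add: iff)
  ultimately show ?thesis
    using fin \<tau>(1) by (simp del: of_int_mult)
next
  case False
  then have "polytabloid \<nu> t T = 0"
    by (auto simp: polytabloid_def intro!: sum.neutral)
  moreover have "(\<Sum>\<sigma>\<in>column_stabilizer \<nu> t. if T = tabloid_act \<sigma> (tabloid \<nu> t) then 1 else 0) = (0::complex)"
    using False by (intro sum.neutral) auto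
  ultimately show ?thesis
    by simp
qed

lemma polytabloid_neq_0:
  assumes t: "is_tableau \<nu> t"
  shows "polytabloid \<nu> t \<noteq> 0"
proof
  assume 0: "polytabloid \<nu> t = 0"
  have id: "id \<in> column_stabilizer \<nu> t"
    by (simp add: column_stabilizer_eq[OF t])
  have "tabloid \<nu> t = tabloid_act \<sigma> (tabloid \<nu> t) \<longleftrightarrow> \<sigma> = id" if "\<sigma> \<in> column_stabilizer \<nu> t" for \<sigma>
  proof
    assume "tabloid \<nu> t = tabloid_act \<sigma> (tabloid \<nu> t)"
    then show "\<sigma> = id"
      by (intro tabloid_act_column_free[OF t that id]) simp
  qed simp
  then have "polytabloid \<nu> t (tabloid \<nu> t) * polytabloid \<nu> t (tabloid \<nu> t)
      = (\<Sum>\<sigma>\<in>column_stabilizer \<nu> t. if \<sigma> = id then 1 else 0)"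
    unfolding polytabloid_square[OF t] by (intro sum.cong refl) simp
  also have "\<dots> = 1"
    using id by (simp add: column_stabilizer_eq[OF t])
  finally show False
    unfolding 0 by simp
qed

text \<open>The map sends a tensor to its restriction to the diagonal, and then applies the equivariant map
  from functions on words to functions on words induced by the matrix \<open>g\<close>; here a tabloid stands
  for the word that lists the row of each entry.\<close>

definition diagonal_transform ::
    "nat list \<Rightarrow> nat list \<Rightarrow> (nat \<Rightarrow> nat \<Rightarrow> complex) \<Rightarrow>
     ((nat \<Rightarrow> nat set) \<times> (nat \<Rightarrow> nat set) \<Rightarrow> complex) \<Rightarrow> (nat \<Rightarrow> nat set) \<Rightarrow> complex"
  where "diagonal_transform \<nu> \<mu> g z T = (if T \<in> tabloids \<nu>
    then \<Sum>S\<in>tabloids \<mu>. (\<Prod>x\<in>{1..sum_list \<mu>}. g (row_of T x) (row_of S x)) * z (S, S) else 0)"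

lemma diagonal_transform_linear:
  "diagonal_transform \<nu> \<mu> g (z + z') = diagonal_transform \<nu> \<mu> g z + diagonal_transform \<nu> \<mu> g z'"
  "diagonal_transform \<nu> \<mu> g (\<lambda>p. c * z p) = (\<lambda>T. c * diagonal_transform \<nu> \<mu> g z T)"
  "diagonal_transform \<nu> \<mu> g 0 = 0"
  by (auto simp: diagonal_transform_def fun_eq_iff algebra_simps sum.distrib sum_distrib_left)

lemma diagonal_transform_sum:
  "diagonal_transform \<nu> \<mu> g (\<Sum>i\<in>I. z i) = (\<Sum>i\<in>I. diagonal_transform \<nu> \<mu> g (z i))"
proof (induction I rule: infinite_finite_induct)
  case (insert i I)
  then show ?case
    unfolding sum.insert[OF insert.hyps] diagonal_transform_linear by simp
qed (simp_all only: sum.infinite sum.empty diagonal_transform_linear not_False_eq_True)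

text \<open>The kernel is a product over all positions, so it does not change when one permutation
  is applied to both words.\<close>

lemma diagonal_transform_act:
  assumes h: "h permutes {1..sum_list \<mu>}" and eq: "sum_list \<nu> = sum_list \<mu>"
  shows "diagonal_transform \<nu> \<mu> g (fun_act (pair_act tabloid_act) h z)
    = fun_act tabloid_act h (diagonal_transform \<nu> \<mu> g z)"
proof
  let ?X = "{1..sum_list \<mu>}"
  fix T
  note hi = permutes_inv[OF h]
  have mem: "tabloid_act (inv h) T \<in> tabloids \<nu> \<longleftrightarrow> T \<in> tabloids \<nu>"
    using tabloid_act_in_tabloids[of "inv h" \<nu> T] tabloid_act_in_tabloids[of h \<nu> "tabloid_act (inv h) T"]
      h hi eq tabloid_act_inv[OF h] by metis
  have "(\<Sum>S\<in>tabloids \<mu>. (\<Prod>x\<in>?X. g (row_of T x) (row_of S x)) * z (tabloid_act (inv h) S, tabloid_act (inv h) S))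
    = (\<Sum>S\<in>tabloids \<mu>. (\<Prod>x\<in>?X. g (row_of T x) (row_of (tabloid_act h S) x)) * z (S, S))"
    by (rule sum.reindex_bij_witness[of _ "tabloid_act h" "tabloid_act (inv h)"])
       (use h hi in \<open>simp_all add: tabloid_act_in_tabloids tabloid_act_inv[OF h]\<close>)
  also have "\<dots> = (\<Sum>S\<in>tabloids \<mu>. (\<Prod>x\<in>?X. g (row_of (tabloid_act (inv h) T) x) (row_of S x)) * z (S, S))"
  proof (intro sum.cong refl arg_cong2[where f = "(*)"])
    fix S
    have "(\<Prod>x\<in>?X. g (row_of T x) (row_of (tabloid_act h S) x))
      = (\<Prod>x\<in>?X. g (row_of T (h x)) (row_of (tabloid_act h S) (h x)))"
      by (rule prod.reindex_bij_betw[symmetric, OF permutes_imp_bij[OF h]])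
    also have "\<dots> = (\<Prod>x\<in>?X. g (row_of (tabloid_act (inv h) T) x) (row_of S x))"
      by (simp only: row_of_tabloid_act[OF h] row_of_tabloid_act[OF hi] permutes_inv_inv[OF h] permutes_inverses(2)[OF h])
    finally show "(\<Prod>x\<in>?X. g (row_of T x) (row_of (tabloid_act h S) x))
      = (\<Prod>x\<in>?X. g (row_of (tabloid_act (inv h) T) x) (row_of S x))" .
  qed
  finally show "diagonal_transform \<nu> \<mu> g (fun_act (pair_act tabloid_act) h z) T
    = fun_act tabloid_act h (diagonal_transform \<nu> \<mu> g z) T"
    by (simp only: diagonal_transform_def fun_act_def pair_act_def map_prod_simp mem)
qed

lemma sum_column_stabilizer_diagonal_transform:
  assumes t: "is_tableau \<nu> t" and s: "is_tableau \<mu> s" and eq: "sum_list \<nu> = sum_list \<mu>"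
  shows "(\<Sum>\<sigma>\<in>column_stabilizer \<nu> t. of_int (sign \<sigma>) *
      diagonal_transform \<nu> \<mu> g (\<lambda>(S, S'). polytabloid \<mu> s S * polytabloid \<mu> s S') (tabloid_act \<sigma> (tabloid \<nu> t)))
    = (\<Sum>\<sigma>\<in>column_stabilizer \<nu> t. \<Sum>\<tau>\<in>column_stabilizer \<mu> s. of_int (sign \<sigma>) *
      (\<Prod>x\<in>{1..sum_list \<mu>}. g (row_of (tabloid \<nu> t) (\<sigma> x)) (row_of (tabloid \<mu> s) (\<tau> x))))"
    (is "?L = ?R")
proof -
  let ?X = "{1..sum_list \<mu>}" and ?C = "column_stabilizer \<nu> t" and ?C' = "column_stabilizer \<mu> s"
  have C: "?C = fperm ?X (column_of \<nu> t)" and C': "?C' = fperm ?X (column_of \<mu> s)"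
    using column_stabilizer_eq[OF t] column_stabilizer_eq[OF s] eq by simp_all
  have mem: "tabloid_act \<sigma> (tabloid \<nu> t) \<in> tabloids \<nu>" if "\<sigma> \<in> ?C" for \<sigma>
    using that t by (intro tabloid_act_in_tabloids) (auto simp: column_stabilizer_def tabloids_def)
  have mem': "tabloid_act \<tau> (tabloid \<mu> s) \<in> tabloids \<mu>" if "\<tau> \<in> ?C'" for \<tau>
    using that s by (intro tabloid_act_in_tabloids) (auto simp: column_stabilizer_def tabloids_def)
  have inner: "diagonal_transform \<nu> \<mu> g (\<lambda>(S, S'). polytabloid \<mu> s S * polytabloid \<mu> s S') (tabloid_act \<sigma> (tabloid \<nu> t))
    = (\<Sum>\<tau>\<in>?C'. \<Prod>x\<in>?X. g (row_of (tabloid \<nu> t) (inv \<sigma> x)) (row_of (tabloid \<mu> s) (\<tau> x)))" if \<sigma>: "\<sigma> \<in> ?C" for \<sigma>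
  proof -
    have p\<sigma>: "\<sigma> permutes ?X"
      using \<sigma> C fpermD(1) by blast
    let ?P = "\<lambda>S. \<Prod>x\<in>?X. g (row_of (tabloid \<nu> t) (inv \<sigma> x)) (row_of S x)"
    have "diagonal_transform \<nu> \<mu> g (\<lambda>(S, S'). polytabloid \<mu> s S * polytabloid \<mu> s S') (tabloid_act \<sigma> (tabloid \<nu> t))
      = (\<Sum>S\<in>tabloids \<mu>. ?P S * (\<Sum>\<tau>\<in>?C'. if S = tabloid_act \<tau> (tabloid \<mu> s) then 1 else 0))"
      using mem[OF \<sigma>] by (simp add: diagonal_transform_def row_of_tabloid_act[OF p\<sigma>] polytabloid_square[OF s])
    also have "\<dots> = (\<Sum>\<tau>\<in>?C'. \<Sum>S\<in>tabloids \<mu>. if S = tabloid_act \<tau> (tabloid \<mu> s) then ?P S else 0)"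
      unfolding sum_distrib_left by (subst sum.swap) (simp add: if_distrib cong: if_cong)
    also have "\<dots> = (\<Sum>\<tau>\<in>?C'. ?P (tabloid_act \<tau> (tabloid \<mu> s)))"
      using mem' by (intro sum.cong refl) simp
    also have "\<dots> = (\<Sum>\<tau>\<in>?C'. \<Prod>x\<in>?X. g (row_of (tabloid \<nu> t) (inv \<sigma> x)) (row_of (tabloid \<mu> s) (inv \<tau> x)))"
    proof (rule sum.cong[OF refl])
      fix \<tau> assume "\<tau> \<in> ?C'"
      then have "\<tau> permutes ?X"
        using C' fpermD(1) by blast
      then show "?P (tabloid_act \<tau> (tabloid \<mu> s))
        = (\<Prod>x\<in>?X. g (row_of (tabloid \<nu> t) (inv \<sigma> x)) (row_of (tabloid \<mu> s) (inv \<tau> x)))"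
        by (simp only: row_of_tabloid_act)
    qed
    also have "\<dots> = (\<Sum>\<tau>\<in>?C'. \<Prod>x\<in>?X. g (row_of (tabloid \<nu> t) (inv \<sigma> x)) (row_of (tabloid \<mu> s) (\<tau> x)))"
      unfolding C' by (rule sum_fperm_inv) simp
    finally show ?thesis .
  qed
  have "?L = (\<Sum>\<sigma>\<in>?C. of_int (sign (inv \<sigma>)) *
      (\<Sum>\<tau>\<in>?C'. \<Prod>x\<in>?X. g (row_of (tabloid \<nu> t) (inv \<sigma> x)) (row_of (tabloid \<mu> s) (\<tau> x))))"
  proof (rule sum.cong[OF refl])
    fix \<sigma> assume \<sigma>: "\<sigma> \<in> ?C"
    then have "sign (inv \<sigma>) = sign \<sigma>"
      using sign_inverse[OF fperm_permutation[OF finite_atLeastAtMost]] C by blast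
    then show "of_int (sign \<sigma>) *
        diagonal_transform \<nu> \<mu> g (\<lambda>(S, S'). polytabloid \<mu> s S * polytabloid \<mu> s S') (tabloid_act \<sigma> (tabloid \<nu> t))
      = of_int (sign (inv \<sigma>)) *
      (\<Sum>\<tau>\<in>?C'. \<Prod>x\<in>?X. g (row_of (tabloid \<nu> t) (inv \<sigma> x)) (row_of (tabloid \<mu> s) (\<tau> x)))"
      by (simp only: inner[OF \<sigma>])
  qed
  also have "\<dots> = (\<Sum>\<sigma>\<in>?C. of_int (sign \<sigma>) *
      (\<Sum>\<tau>\<in>?C'. \<Prod>x\<in>?X. g (row_of (tabloid \<nu> t) (\<sigma> x)) (row_of (tabloid \<mu> s) (\<tau> x))))"
    unfolding C by (rule sum_fperm_inv) simp
  finally show ?thesis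
    by (simp only: sum_distrib_left)
qed

text \<open>A nonzero pairing survives on some irreducible summand \<open>U\<close>. Irreducibility
  is applied twice: to the kernel of the map, which gives injectivity, and to the preimage of
  \<open>specht \<nu>\<close>, which shows that the image is no larger than the Specht
  module.\<close>

lemma sym_kronecker_pos:
  fixes g :: "nat \<Rightarrow> nat \<Rightarrow> complex"
  assumes sorted: "sorted_wrt (\<ge>) \<nu>" and eq: "sum_list \<nu> = sum_list \<mu>"
    and t: "is_tableau \<nu> t" and s: "is_tableau \<mu> s"
    and nz: "(\<Sum>\<sigma>\<in>column_stabilizer \<nu> t. \<Sum>\<tau>\<in>column_stabilizer \<mu> s. of_int (sign \<sigma>) *
      (\<Prod>x\<in>{1..sum_list \<mu>}. g (row_of (tabloid \<nu> t) (\<sigma> x)) (row_of (tabloid \<mu> s) (\<tau> x)))) \<noteq> 0"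
  shows "sym_kronecker \<nu> \<mu> > 0"
proof -
  let ?n = "sum_list \<mu>" and ?X = "{1..sum_list \<mu>}" and ?V = "symmetric_square (specht \<mu>)"
  let ?\<rho> = "fun_act (pair_act tabloid_act)" and ?\<phi> = "diagonal_transform \<nu> \<mu> g"
  \<comment> \<open>The pairing of a function with the polytabloid of \<open>t\<close>.\<close>
  define F :: "((nat \<Rightarrow> nat set) \<Rightarrow> complex) \<Rightarrow> complex"
    where "F u = (\<Sum>\<sigma>\<in>column_stabilizer \<nu> t. of_int (sign \<sigma>) * u (tabloid_act \<sigma> (tabloid \<nu> t)))" for u
  have F_sum: "F (\<Sum>i\<in>I. u i) = (\<Sum>i\<in>I. F (u i))" for I :: "'i set" and u
    unfolding F_def sum_fun_apply sum_distrib_left by (rule sum.swap)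
  have F0: "F 0 = 0"
    by (simp add: F_def)
  define z where "z = (\<lambda>(S, S'). polytabloid \<mu> s S * polytabloid \<mu> s S')"
  have "polytabloid \<mu> s \<in> specht \<mu>"
    unfolding specht_def using s by (intro cfun.span_base) blast
  then have "z \<in> tensor_square (specht \<mu>)"
    unfolding tensor_square_def z_def by (intro cfun.span_base) blast
  then have z: "z \<in> ?V"
    by (simp add: symmetric_square_def z_def)
  have Fz: "F (?\<phi> z) \<noteq> 0"
    using nz unfolding F_def z_def sum_column_stabilizer_diagonal_transform[OF t s eq] .
  \<comment> \<open>This is the decomposition in which \<open>rep_multiplicity\<close> counts, so
    the required summand has to be found in it.\<close>
  define D where "D = (SOME D. irreducible_decomposition ?n ?\<rho> ?V D)"
  have "\<exists>D. irreducible_decomposition ?n ?\<rho> ?V D"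
  proof (rule irreducible_decomposition_exists)
    show "finite (tabloids \<mu> \<times> tabloids \<mu>)"
      by simp
    show "submodule ?n ?\<rho> ?V"
      by (rule submodule_symmetric_square[OF submodule_specht])
    show "?V \<subseteq> supported_on (tabloids \<mu> \<times> tabloids \<mu>)"
      by (rule symmetric_square_supported_on[OF specht_supported_on])
  qed (auto simp: pair_act_def tabloid_act_in_tabloids tabloid_act_inv)
  then have "irreducible_decomposition ?n ?\<rho> ?V D"
    unfolding D_def by (rule someI_ex)
  note D = this[unfolded irreducible_decomposition_def]
  have finD: "finite D"
    using D by (rule conjunct1)
  have irr: "\<forall>U\<in>D. irreducible_submodule ?n ?\<rho> U"
    using D[THEN conjunct2] by (rule conjunct1)
  have V_eq: "?V = {\<Sum>U\<in>D. u U | u. \<forall>U\<in>D. u U \<in> U}"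
    using D[THEN conjunct2, THEN conjunct2] by (rule conjunct1)
  obtain u where u: "z = (\<Sum>U\<in>D. u U)" "\<forall>U\<in>D. u U \<in> U"
    using z unfolding V_eq by blast
  have "(\<Sum>U\<in>D. F (?\<phi> (u U))) \<noteq> 0"
    using Fz unfolding u(1) diagonal_transform_sum F_sum .
  then obtain U where U: "U \<in> D" "F (?\<phi> (u U)) \<noteq> 0"
    by (meson sum.neutral)
  have irrU: "irreducible_submodule ?n ?\<rho> U" and uU: "u U \<in> U"
    using irr u(2) U(1) by blast+
  then have subU: "cfun_subspace U" and actU: "\<And>h v. h permutes ?X \<Longrightarrow> v \<in> U \<Longrightarrow> ?\<rho> h v \<in> U"
    and minU: "\<And>U'. U' \<subseteq> U \<Longrightarrow> submodule ?n ?\<rho> U' \<Longrightarrow> U' = {0} \<or> U' = U"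
    unfolding irreducible_submodule_def submodule_def by blast+
  have \<phi>u: "?\<phi> (u U) \<noteq> 0"
    using U(2) F0 by metis
  have preimage: "submodule ?n ?\<rho> {v \<in> U. ?\<phi> v \<in> W}" if "submodule ?n (fun_act tabloid_act) W" for W
    using that subU actU unfolding submodule_def cfun.subspace_def
    by (simp add: diagonal_transform_linear diagonal_transform_act[OF _ eq])
  have "submodule ?n (fun_act tabloid_act) {0}"
    by (simp add: submodule_def cfun.subspace_def fun_act_def func_zero)
  from minU[OF _ preimage[OF this]] have ker: "{v \<in> U. ?\<phi> v \<in> {0}} = {0}"
    using \<phi>u uU by blast
  have inj: "inj_on ?\<phi> U"
  proof (rule inj_onI)
    fix v w assume vw: "v \<in> U" "w \<in> U" "?\<phi> v = ?\<phi> w"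
    have "v + (\<lambda>p. (-1) * w p) \<in> U"
      using vw cfun.subspace_add[OF subU] cfun.subspace_scale[OF subU] by blast
    moreover have "?\<phi> (v + (\<lambda>p. (-1) * w p)) = 0"
      unfolding diagonal_transform_linear vw(3) by (simp add: fun_eq_iff)
    ultimately have "v + (\<lambda>p. (-1) * w p) = 0"
      using ker by blast
    then show "v = w"
      by (simp add: fun_eq_iff)
  qed
  have image: "submodule (sum_list \<nu>) (fun_act tabloid_act) (?\<phi> ` U)"
    unfolding submodule_def cfun.subspace_def
  proof (intro conjI ballI allI impI)
    show "0 \<in> ?\<phi> ` U"
      using diagonal_transform_linear(3) cfun.subspace_0[OF subU] by (metis image_eqI)
    fix a assume "a \<in> ?\<phi> ` U"
    then obtain v where v: "v \<in> U" "a = ?\<phi> v"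
      by blast
    show "(\<lambda>x. c * a x) \<in> ?\<phi> ` U" for c
      using diagonal_transform_linear(2)[of \<nu> \<mu> g c v] cfun.subspace_scale[OF subU v(1), of c] v(2)
      by (metis image_eqI)
    show "a + b \<in> ?\<phi> ` U" if b: "b \<in> ?\<phi> ` U" for b
    proof -
      obtain w where w: "w \<in> U" "b = ?\<phi> w"
        using b by blast
      show ?thesis
        using diagonal_transform_linear(1)[of \<nu> \<mu> g v w] cfun.subspace_add[OF subU v(1) w(1)] v(2) w(2)
        by (metis image_eqI)
    qed
    show "fun_act tabloid_act h a \<in> ?\<phi> ` U" if h: "h permutes {1..sum_list \<nu>}" for h
      using diagonal_transform_act[of h \<mu> \<nu> g v] actU[of h v] h eq v by (metis image_eqI)
  qed
  have "polytabloid \<nu> t \<in> ?\<phi> ` U"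
  proof (rule polytabloid_in_submodule[OF sorted t image])
    show "?\<phi> ` U \<subseteq> supported_on (tabloids \<nu>)"
      by (auto simp: supported_on_def diagonal_transform_def)
    show "?\<phi> (u U) \<in> ?\<phi> ` U"
      using uU by blast
  qed (use U(2) in \<open>simp add: F_def\<close>)
  then have sub: "specht \<nu> \<subseteq> ?\<phi> ` U"
    by (rule specht_subset_submodule[OF t image])
  have et: "polytabloid \<nu> t \<in> specht \<nu>"
    unfolding specht_def using t by (intro cfun.span_base) blast
  have "submodule ?n (fun_act tabloid_act) (specht \<nu>)"
    using submodule_specht[of \<nu>] eq by simp
  from minU[OF _ preimage[OF this]]
  have "{v \<in> U. ?\<phi> v \<in> specht \<nu>} = {0} \<or> {v \<in> U. ?\<phi> v \<in> specht \<nu>} = U"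
    by blast
  moreover have "{v \<in> U. ?\<phi> v \<in> specht \<nu>} \<noteq> {0}"
  proof
    assume *: "{v \<in> U. ?\<phi> v \<in> specht \<nu>} = {0}"
    obtain v where v: "v \<in> U" "?\<phi> v = polytabloid \<nu> t"
      using sub et by (metis imageE subsetD)
    then have "v \<in> {0}"
      using * et by (metis (mono_tags, lifting) mem_Collect_eq)
    then show False
      using v(2) polytabloid_neq_0[OF t] diagonal_transform_linear(3) by (metis singletonD)
  qed
  ultimately have "?\<phi> ` U = specht \<nu>"
    using sub by blast
  with inj have "bij_betw ?\<phi> U (specht \<nu>)"
    by (simp add: bij_betw_def)
  then have iso: "isomorphic_modules ?n ?\<rho> U (fun_act tabloid_act) (specht \<nu>)"
    unfolding isomorphic_modules_def
    by (intro exI[of _ ?\<phi>] conjI ballI allI impI diagonal_transform_linear diagonal_transform_act[OF _ eq])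
  then have "U \<in> {U \<in> D. isomorphic_modules ?n ?\<rho> U (fun_act tabloid_act) (specht \<nu>)}"
    using U(1) by simp
  then show ?thesis
    unfolding sym_kronecker_def rep_multiplicity_def D_def[symmetric]
    using finD by (auto simp: card_gt_0_iff)
qed

text \<open>\<open>k j\<close> is the length of column \<open>j\<close> of \<open>lam\<close>. Both
  tableaux are indexed by triples \<open>(j, q, i)\<close>: a box \<open>(i, j)\<close> of
  \<open>lam\<close> and a place \<open>q\<close> in its block. Columns of \<open>t\<close> fix
  \<open>j\<close> and \<open>q\<close>, those of \<open>s\<close> fix \<open>j\<close> and
  \<open>i\<close>; so both column stabilizers preserve \<open>j\<close> and the sum factors over
  \<open>j\<close>. An empty column has the factor 1.\<close>

lemma sum_column_stabilizers_eq_prod_minor_poly: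
  fixes m d :: nat and lam :: "nat list"
  assumes len: "length lam = m" and lam: "is_partition d lam"
    and k: "\<And>i j. i < k j \<longleftrightarrow> i < m \<and> j < lam ! i"
  shows "\<exists>t s. is_tableau (map ((*) m) lam) t \<and> is_tableau (replicate m d) s \<and>
    (\<Sum>\<sigma>\<in>column_stabilizer (map ((*) m) lam) t. \<Sum>\<tau>\<in>column_stabilizer (replicate m d) s. of_int (sign \<sigma>) *
      (\<Prod>x\<in>{1..m * d}. g (row_of (tabloid (map ((*) m) lam) t) (\<sigma> x)) (row_of (tabloid (replicate m d) s) (\<tau> x))))
    = (\<Prod>j<d. minor_poly m (k j) g)"
proof -
  let ?\<nu> = "map ((*) m) lam" and ?\<mu> = "replicate m d" and ?X = "{1..m * d}"
  have sum_lam: "sum_list lam = d"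
    using lam by (simp add: is_partition_def)
  have n\<nu>: "sum_list ?\<nu> = m * d"
    using sum_list_const_mult[of m "\<lambda>x. x" lam] sum_lam by simp
  have n\<mu>: "sum_list ?\<mu> = m * d"
    by (simp add: sum_list_replicate)
  have lam_le: "lam ! i \<le> d" if "i < m" for i
    using member_le_sum_list[of "lam ! i" lam] that len sum_lam by auto
  \<comment> \<open>The boxes of \<open>lam\<close>, with the column named first. There are
    \<open>d\<close> of them, and \<open>\<beta>\<close> below assigns to each a column of the
    rectangle, that is, a block.\<close>
  define Z where "Z = (SIGMA j:{..<d}. {..<k j})"
  have "bij_betw prod.swap (young_diagram lam) Z"
    by (rule bij_betw_byWitness[where f' = prod.swap])
       (use lam_le in \<open>auto simp: Z_def young_diagram_def k len intro: less_le_trans\<close>)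
  then have "card Z = card {..<d}"
    using card_young_diagram[of lam] sum_lam by (simp add: bij_betw_same_card[symmetric])
  moreover have finZ: "finite Z"
    by (simp add: Z_def)
  ultimately obtain \<beta> where \<beta>: "bij_betw \<beta> Z {..<d}"
    using finite_same_card_bij by blast
  define Y where "Y = (SIGMA j:{..<d}. cells m (k j))"
  \<comment> \<open>\<open>\<alpha>\<close> cuts each row of the shape \<open>m * lam\<close> into
    blocks of length \<open>m\<close>; \<open>\<psi>\<close> makes each block a column of the
    rectangle.\<close>
  define \<alpha> :: "nat \<times> nat \<times> nat \<Rightarrow> nat \<times> nat" where "\<alpha> = (\<lambda>(j, q, i). (i, m * j + q))"
  define \<psi> :: "nat \<times> nat \<times> nat \<Rightarrow> nat \<times> nat" where "\<psi> = (\<lambda>(j, q, i). (q, \<beta> (j, i)))"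
  have lt_mult: "m * j + q < m * l" if "q < m" "j < l" for j q l
  proof -
    have "m * j + q < m * Suc j"
      using that by simp
    also have "\<dots> \<le> m * l"
      using that by (intro mult_le_mono2) simp
    finally show ?thesis .
  qed
  have \<alpha>: "bij_betw \<alpha> Y (young_diagram ?\<nu>)"
  proof (rule bij_betw_byWitness[where f' = "\<lambda>(i, c). (c div m, c mod m, i)"])
    show "\<forall>y\<in>Y. (\<lambda>(i, c). (c div m, c mod m, i)) (\<alpha> y) = y"
      by (auto simp: \<alpha>_def Y_def cells_def)
    show "\<forall>y\<in>young_diagram ?\<nu>. \<alpha> ((\<lambda>(i, c). (c div m, c mod m, i)) y) = y"
      by (auto simp: \<alpha>_def)
    show "\<alpha> ` Y \<subseteq> young_diagram ?\<nu>"
      by (auto simp: \<alpha>_def Y_def cells_def young_diagram_def k len lt_mult)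
    show "(\<lambda>(i, c). (c div m, c mod m, i)) ` young_diagram ?\<nu> \<subseteq> Y"
    proof clarify
      fix i c assume "(i, c) \<in> young_diagram ?\<nu>"
      then have i: "i < m" and c: "c < m * lam ! i"
        by (auto simp: young_diagram_def len)
      then have "c div m < lam ! i"
        by (simp add: less_mult_imp_div_less mult.commute)
      moreover have "c div m < d"
        using calculation lam_le[OF i] by simp
      ultimately show "(c div m, c mod m, i) \<in> Y"
        using i by (simp add: Y_def cells_def k)
    qed
  qed
  have \<psi>: "bij_betw \<psi> Y (young_diagram ?\<mu>)"
    unfolding bij_betw_def
  proof
    show "inj_on \<psi> Y"
      using bij_betw_imp_inj_on[OF \<beta>] by (auto simp: inj_on_def \<psi>_def Y_def Z_def cells_def)
    show "\<psi> ` Y = young_diagram ?\<mu>"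
    proof
      show "\<psi> ` Y \<subseteq> young_diagram ?\<mu>"
        using bij_betwE[OF \<beta>] by (auto simp: \<psi>_def Y_def Z_def cells_def young_diagram_def)
      show "young_diagram ?\<mu> \<subseteq> \<psi> ` Y"
      proof clarify
        fix q e assume "(q, e) \<in> young_diagram ?\<mu>"
        then have q: "q < m" and "e \<in> {..<d}"
          by (auto simp: young_diagram_def)
        then obtain j i where "(j, i) \<in> Z" "\<beta> (j, i) = e"
          using bij_betw_imp_surj_on[OF \<beta>] by (metis imageE surj_pair)
        then show "(q, e) \<in> \<psi> ` Y"
          using q by (intro image_eqI[of _ _ "(j, q, i)"]) (auto simp: \<psi>_def Y_def Z_def cells_def)
      qed
    qed
  qed
  obtain t where t: "is_tableau ?\<nu> t"
    using tableau_exists by blast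
  define b where "b = t \<circ> \<alpha>"
  have b: "bij_betw b Y ?X"
    using bij_betw_trans[OF \<alpha> t[unfolded is_tableau_def]] unfolding b_def n\<nu> .
  \<comment> \<open>\<open>s\<close> puts the entry \<open>b y\<close> of \<open>t\<close> at the
    place \<open>\<psi> y\<close>, so both tableaux have the same entry at each triple.\<close>
  define s where "s = b \<circ> inv_into Y \<psi>"
  have s: "is_tableau ?\<mu> s"
    unfolding is_tableau_def n\<mu> s_def by (rule bij_betw_trans[OF bij_betw_inv_into[OF \<psi>] b])
  have s\<psi>: "s (\<psi> y) = b y" if "y \<in> Y" for y
    using bij_betw_inv_into_left[OF \<psi> that] by (simp add: s_def)
  have \<alpha>_mem: "\<alpha> y \<in> young_diagram ?\<nu>" and \<psi>_mem: "\<psi> y \<in> young_diagram ?\<mu>" if "y \<in> Y" for y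
    using that bij_betwE[OF \<alpha>] bij_betwE[OF \<psi>] by blast+
  have row_t: "row_of (tabloid ?\<nu> t) (b y) = snd (snd y)" if "y \<in> Y" for y
    using row_of_tabloid[OF t, of "fst (\<alpha> y)" "snd (\<alpha> y)"] \<alpha>_mem[OF that]
    by (simp add: b_def) (simp add: \<alpha>_def case_prod_unfold)
  have row_s: "row_of (tabloid ?\<mu> s) (b y) = fst (snd y)" if "y \<in> Y" for y
    using row_of_tabloid[OF s, of "fst (\<psi> y)" "snd (\<psi> y)"] \<psi>_mem[OF that]
    by (simp add: s\<psi>[OF that]) (simp add: \<psi>_def case_prod_unfold)
  have col_t: "column_of ?\<nu> t (b y) = m * fst y + fst (snd y)" if "y \<in> Y" for y
    using column_of_tableau[OF t \<alpha>_mem[OF that]] by (simp add: b_def) (simp add: \<alpha>_def case_prod_unfold)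
  have col_s: "column_of ?\<mu> s (b y) = \<beta> (fst y, snd (snd y))" if "y \<in> Y" for y
    using column_of_tableau[OF s \<psi>_mem[OF that]] by (simp add: s\<psi>[OF that]) (simp add: \<psi>_def case_prod_unfold)
  let ?H = "fperm Y (\<lambda>(j, y). (j, fst y))" and ?V = "fperm Y (\<lambda>(j, y). (j, snd y))"
  let ?b = "map_permutation Y b"
  have finY: "finite Y"
    by (simp add: Y_def)
  have inj_b: "inj_on b Y" and b_img: "b ` Y = ?X"
    using b by (simp_all add: bij_betw_def)
  \<comment> \<open>A number \<open>m * j + q\<close> with \<open>q < m\<close> determines
    \<open>j\<close> and \<open>q\<close>, so column numbers of \<open>t\<close> and pairs
    \<open>(j, q)\<close> distinguish the same triples.\<close>
  have kernel_t: "column_of ?\<nu> t (b x) = column_of ?\<nu> t (b y) \<longleftrightarrow> (\<lambda>(j, y). (j, fst y)) x = (\<lambda>(j, y). (j, fst y)) y"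
    if "x \<in> Y" "y \<in> Y" for x y
  proof -
    obtain j q i j' q' i' where xy: "x = (j, q, i)" "y = (j', q', i')"
      by (metis surj_pair)
    have "q < m" "q' < m"
      using that xy by (auto simp: Y_def cells_def)
    then have "m * j + q = m * j' + q' \<longleftrightarrow> j = j' \<and> q = q'"
      by (metis add.commute add_left_imp_eq div_mult_self2 div_less mod_less mod_mult_self2 add_0 not_less_zero)
    then show ?thesis
      using col_t[OF that(1)] col_t[OF that(2)] unfolding xy by simp
  qed
  have kernel_s: "column_of ?\<mu> s (b x) = column_of ?\<mu> s (b y) \<longleftrightarrow> (\<lambda>(j, y). (j, snd y)) x = (\<lambda>(j, y). (j, snd y)) y"
    if "x \<in> Y" "y \<in> Y" for x y
  proof -
    have "(fst x, snd (snd x)) \<in> Z" "(fst y, snd (snd y)) \<in> Z"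
      using that by (auto simp: Y_def Z_def cells_def)
    from inj_on_eq_iff[OF bij_betw_imp_inj_on[OF \<beta>] this] show ?thesis
      unfolding col_s[OF that(1)] col_s[OF that(2)] by (simp add: case_prod_unfold)
  qed
  have "(\<Sum>\<sigma>\<in>column_stabilizer ?\<nu> t. \<Sum>\<tau>\<in>column_stabilizer ?\<mu> s. of_int (sign \<sigma>) *
      (\<Prod>x\<in>?X. g (row_of (tabloid ?\<nu> t) (\<sigma> x)) (row_of (tabloid ?\<mu> s) (\<tau> x))))
    = (\<Sum>\<theta>\<in>?H. \<Sum>\<tau>\<in>column_stabilizer ?\<mu> s. of_int (sign (?b \<theta>)) *
      (\<Prod>x\<in>?X. g (row_of (tabloid ?\<nu> t) (?b \<theta> x)) (row_of (tabloid ?\<mu> s) (\<tau> x))))"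
    unfolding column_stabilizer_eq[OF t] n\<nu> by (rule sum_fperm_transport[OF b]) (rule kernel_t)
  also have "\<dots> = (\<Sum>\<theta>\<in>?H. \<Sum>\<eta>\<in>?V. of_int (sign (?b \<theta>)) *
      (\<Prod>x\<in>?X. g (row_of (tabloid ?\<nu> t) (?b \<theta> x)) (row_of (tabloid ?\<mu> s) (?b \<eta> x))))"
    unfolding column_stabilizer_eq[OF s] n\<mu> by (rule sum.cong[OF refl], rule sum_fperm_transport[OF b]) (rule kernel_s)
  also have "\<dots> = (\<Sum>\<theta>\<in>?H. \<Sum>\<eta>\<in>?V. \<Prod>j<d. of_int (sign (\<lambda>y. snd (\<theta> (j, y)))) *
      (\<Prod>y\<in>cells m (k j). g (snd (snd (\<theta> (j, y)))) (fst (snd (\<eta> (j, y))))))"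
  proof (intro sum.cong refl)
    fix \<theta> \<eta> assume \<theta>: "\<theta> \<in> ?H" and \<eta>: "\<eta> \<in> ?V"
    have sgn: "sign (?b \<theta>) = (\<Prod>j<d. sign (\<lambda>y. snd (\<theta> (j, y))))"
      unfolding sign_map_permutation[OF inj_b fpermD(1)[OF \<theta>] finY]
      by (rule sign_fperm_Sigma[where Y = "\<lambda>j. cells m (k j)" and c = "\<lambda>_. fst"])
         (use \<theta> in \<open>simp_all add: Y_def\<close>)
    have "(\<Prod>x\<in>?X. g (row_of (tabloid ?\<nu> t) (?b \<theta> x)) (row_of (tabloid ?\<mu> s) (?b \<eta> x)))
      = (\<Prod>y\<in>Y. g (row_of (tabloid ?\<nu> t) (?b \<theta> (b y))) (row_of (tabloid ?\<mu> s) (?b \<eta> (b y))))"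
      by (rule prod.reindex_bij_betw[OF b, symmetric])
    also have "\<dots> = (\<Prod>y\<in>Y. g (snd (snd (\<theta> y))) (fst (snd (\<eta> y))))"
    proof (rule prod.cong[OF refl])
      fix y assume y: "y \<in> Y"
      then have "\<theta> y \<in> Y" "\<eta> y \<in> Y"
        using permutes_in_image[OF fpermD(1)[OF \<theta>]] permutes_in_image[OF fpermD(1)[OF \<eta>]] by simp_all
      then show "g (row_of (tabloid ?\<nu> t) (?b \<theta> (b y))) (row_of (tabloid ?\<mu> s) (?b \<eta> (b y)))
        = g (snd (snd (\<theta> y))) (fst (snd (\<eta> y)))"
        by (simp only: map_permutation_apply[OF inj_b y] row_t row_s)
    qed
    also have "\<dots> = (\<Prod>j<d. \<Prod>y\<in>cells m (k j). g (snd (snd (\<theta> (j, y)))) (fst (snd (\<eta> (j, y)))))"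
      unfolding Y_def by (subst prod.Sigma) (simp_all add: case_prod_unfold)
    finally show "of_int (sign (?b \<theta>)) *
        (\<Prod>x\<in>?X. g (row_of (tabloid ?\<nu> t) (?b \<theta> x)) (row_of (tabloid ?\<mu> s) (?b \<eta> x)))
      = (\<Prod>j<d. of_int (sign (\<lambda>y. snd (\<theta> (j, y)))) *
        (\<Prod>y\<in>cells m (k j). g (snd (snd (\<theta> (j, y)))) (fst (snd (\<eta> (j, y))))))"
      by (simp only: sgn of_int_prod prod.distrib)
  qed
  \<comment> \<open>With \<open>\<theta>\<close> fixed, the sum over \<open>\<eta>\<close> is
    factored first; the remaining sum over \<open>\<theta>\<close> then factors in the same
    way.\<close>
  also have "\<dots> = (\<Sum>\<theta>\<in>?H. \<Prod>j<d. \<Sum>\<eta>\<in>fperm (cells m (k j)) snd. of_int (sign (\<lambda>y. snd (\<theta> (j, y)))) *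
      (\<Prod>y\<in>cells m (k j). g (snd (snd (\<theta> (j, y)))) (fst (\<eta> y))))"
    unfolding Y_def
    by (rule sum.cong[OF refl])
       (rule sum_fperm_Sigma[where c = "\<lambda>_. snd" and
         H = "\<lambda>j \<eta>. of_int (sign (\<lambda>y. snd (\<theta> (j, y)))) * (\<Prod>y\<in>cells m (k j). g (snd (snd (\<theta> (j, y)))) (fst (\<eta> y)))" for \<theta>],
        simp_all)
  also have "\<dots> = (\<Prod>j<d. minor_poly m (k j) g)"
    unfolding Y_def minor_poly_def
    by (rule sum_fperm_Sigma[where c = "\<lambda>_. fst" and
         H = "\<lambda>j \<theta>. \<Sum>\<eta>\<in>fperm (cells m (k j)) snd. of_int (sign \<theta>) * (\<Prod>y\<in>cells m (k j). g (snd (\<theta> y)) (fst (\<eta> y)))"])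
       simp_all
  finally show ?thesis
    using t s by blast
qed

theorem corollary6p5:
  fixes m d :: nat and lam :: "nat list"
  assumes "m > 0" and "even m"
    and "card {A \<in> latin_squares m. column_even m A} \<noteq> card {A \<in> latin_squares m. \<not> column_even m A}"
    and "length lam = m" and "is_partition d lam"
  shows "sym_kronecker (map (\<lambda>x. m * x) lam) (replicate m d) > 0"
proof -
  obtain g where g: "\<And>k. k \<le> m \<Longrightarrow> minor_poly m k g \<noteq> 0"
    using common_minor_poly_neq_0[OF assms(3)] by blast
  have sorted: "sorted_wrt (\<ge>) lam" and sum_lam: "sum_list lam = d"
    using assms(5) by (auto simp: is_partition_def)
  \<comment> \<open>The conjugate partition of \<open>lam\<close>: its parts are at most
    \<open>m\<close>, so the common non-root \<open>g\<close> serves every column.\<close>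
  define k where "k j = card {i. i < m \<and> j < lam ! i}" for j
  have k_le: "k j \<le> m" for j
    using card_mono[of "{..<m}" "{i. i < m \<and> j < lam ! i}"] by (auto simp: k_def)
  have k_iff: "i < k j \<longleftrightarrow> i < m \<and> j < lam ! i" for i j
  proof
    have initial: "j < lam ! i'" if "i' \<le> i" "i < m" "j < lam ! i" for i i'
      using that sorted assms(4) by (cases "i' = i") (auto simp: sorted_wrt_iff_nth_less intro: less_le_trans)
    show "i < m \<and> j < lam ! i" if "i < k j"
    proof (rule ccontr)
      assume "\<not> (i < m \<and> j < lam ! i)"
      then have "{i. i < m \<and> j < lam ! i} \<subseteq> {..<i}"
        using initial by (auto simp: not_less[symmetric])
      then have "k j \<le> card {..<i}"
        unfolding k_def by (intro card_mono) auto
      with that show False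
        by simp
    qed
    show "i < k j" if "i < m \<and> j < lam ! i"
    proof -
      have "{..i} \<subseteq> {i. i < m \<and> j < lam ! i}"
        using that initial by auto
      then have "card {..i} \<le> k j"
        unfolding k_def by (intro card_mono) auto
      then show ?thesis
        by simp
    qed
  qed
  obtain t s where ts: "is_tableau (map ((*) m) lam) t" "is_tableau (replicate m d) s"
    "(\<Sum>\<sigma>\<in>column_stabilizer (map ((*) m) lam) t. \<Sum>\<tau>\<in>column_stabilizer (replicate m d) s. of_int (sign \<sigma>) *
      (\<Prod>x\<in>{1..m * d}. g (row_of (tabloid (map ((*) m) lam) t) (\<sigma> x)) (row_of (tabloid (replicate m d) s) (\<tau> x))))
    = (\<Prod>j<d. minor_poly m (k j) g)"
    using sum_column_stabilizers_eq_prod_minor_poly[OF assms(4,5) k_iff, of g] by blast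
  have n: "sum_list (map ((*) m) lam) = m * d" "sum_list (replicate m d) = m * d"
    using sum_list_const_mult[of m "\<lambda>x. x" lam] sum_lam by (simp_all add: sum_list_replicate)
  have "sorted_wrt (\<ge>) (map ((*) m) lam)"
    using sorted by (auto simp: sorted_wrt_map intro: sorted_wrt_mono_rel[rotated])
  moreover have "(\<Prod>j<d. minor_poly m (k j) g) \<noteq> 0"
    using g k_le by simp
  ultimately show ?thesis
    by (intro sym_kronecker_pos[OF _ _ ts(1,2), where g = g]) (simp_all only: n ts(3) simp_thms)
qed

end
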